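(* Let $n\in\mathbb{N}$ and $0<\sigma_1^2<\sigma_2^2$, and assume Assumption (A) stated in the context. For $\mathsf{R}\ge 0$ define \[ f(\mathsf{R})=\int_{\sigma_1^2}^{\sigma_2^2} \frac{\mathbb{E}\left[ \mathsf{h}_{\frac{n}{2}}^2\left( \frac{\| \sqrt{s}\mathbf{Z}\| \mathsf{R}}{s} \right) + \mathsf{h}_{\frac{n}{2}}^2\left( \frac{\| \mathsf{R}\mathbf{e}_1+\sqrt{s}\mathbf{Z}\| \mathsf{R}}{s} \right) \right]-1}{s^2}\, \mathrm{d} s , \] where $\mathbf{Z}\sim\mathcal{N}(\mathbf{0}_n,\mathbf{I}_n)$ and $\mathbf{e}_1=(1,0,\dots,0)\in\mathbb{R}^n$. Then for every $\mathsf{R}\ge 0$, the input $\mathbf{X}_{\mathsf{R}}$ (uniform on the sphere of radius $\mathsf{R}$) is secrecy-capacity-achieving, i.e. attains $C_s(\sigma_1^2,\sigma_2^2,\mathsf{R},n)$, if and only if $\mathsf{R}\le \bar{\mathsf{R}}_n(\sigma_1^2,\sigma_2^2)$; moreover $\bar{\mathsf{R}}_n(\sigma_1^2,\sigma_2^2)$ is given as the solution $\mathsf{R}$ of the equation $f(\mathsf{R})=0$.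
   Context: Vector Gaussian wiretap channel: $\mathbf{Y}_1=\mathbf{X}+\mathbf{N}_1$, $\mathbf{Y}_2=\mathbf{X}+\mathbf{N}_2$, with $\mathbf{X}\in\mathbb{R}^n$, $\mathbf{N}_1\sim\mathcal{N}(\mathbf{0}_n,\sigma_1^2\mathbf{I}_n)$, $\mathbf{N}_2\sim\mathcal{N}(\mathbf{0}_n,\sigma_2^2\mathbf{I}_n)$, and $\mathbf{X},\mathbf{N}_1,\mathbf{N}_2$ mutually independent. The secrecy-capacity under amplitude constraint $\mathsf{R}$ is $C_s(\sigma_1^2,\sigma_2^2,\mathsf{R},n)=\max I(\mathbf{X};\mathbf{Y}_1)-I(\mathbf{X};\mathbf{Y}_2)$, the maximum over all distributions of $\mathbf{X}$ supported in the closed ball $\{\mathbf{x}:\|\mathbf{x}\|\le\mathsf{R}\}$. $P_{\mathbf{X}_{\mathsf{R}}}$ denotes the uniform distribution on the sphere $\{\mathbf{x}:\|\mathbf{x}\|=\mathsf{R}\}$. $\bar{\mathsf{R}}_n(\sigma_1^2,\sigma_2^2)=\max\{\mathsf{R}: P_{\mathbf{X}_{\mathsf{R}}}\text{ attains } C_s(\sigma_1^2,\sigma_2^2,\mathsf{R},n)\}$ (set to $0$ if this set is empty). $\mathsf{I}_v$ is the modified Bessel function of the first kind of order $v$, and $\mathsf{h}_v(x)=\mathsf{I}_v(x)/\mathsf{I}_{v-1}(x)$. The number of sign changes of a real function $\xi$ on a set $\Omega\subseteq\mathbb{R}$ is the supremum over $m$ and over $y_1<\dots<y_m$ in $\Omega$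 of the number of sign changes of the sequence $\xi(y_1),\dots,\xi(y_m)$. Assumption (A): for all $\mathsf{R}\ge0$, all $0\le\sigma_1\le\sigma_2$ and all $n\in\mathbb{N}$, the function $y\mapsto G_{\sigma_1,\sigma_2,\mathsf{R},n}(y)$ has at most one sign change on $y>0$, where $G_{\sigma_1,\sigma_2,\mathsf{R},n}(y)=\frac{1}{\sigma_2^2}\mathbb{E}\left[\frac{\mathsf{R}}{\|y\mathbf{e}_1+\mathbf{W}\|}\mathsf{h}_{\frac{n}{2}}\left(\frac{\mathsf{R}}{\sigma_2^2}\|y\mathbf{e}_1+\mathbf{W}\|\right)-1\right]-\frac{1}{\sigma_1^2}\left(\frac{\mathsf{R}}{y}\mathsf{h}_{\frac{n}{2}}\left(\frac{\mathsf{R}}{\sigma_1^2}y\right)-1\right)$, with $\mathbf{W}\sim\mathcal{N}(\mathbf{0}_{n+2},(\sigma_2^2-\sigma_1^2)\mathbf{I}_{n+2})$ and $\mathbf{e}_1$ the first unit vector of $\mathbb{R}^{n+2}$. *)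

theory Defs
  imports "HOL-Probability.Probability" "HOL-Library.Extended_Nat"
begin

definition Rn :: "nat \<Rightarrow> (nat \<Rightarrow> real) measure" where
  "Rn n = PiM {..<n} (\<lambda>_. (borel :: real measure))"

definition vnorm :: "nat \<Rightarrow> (nat \<Rightarrow> real) \<Rightarrow> real" where
  "vnorm n x = sqrt (\<Sum>i<n. (x i)\<^sup>2)"

definition vadd :: "nat \<Rightarrow> (nat \<Rightarrow> real) \<Rightarrow> (nat \<Rightarrow> real) \<Rightarrow> (nat \<Rightarrow> real)" where
  "vadd n x z = restrict (\<lambda>i. x i + z i) {..<n}"

definition vscale :: "nat \<Rightarrow> real \<Rightarrow> (nat \<Rightarrow> real) \<Rightarrow> (nat \<Rightarrow> real)" where
  "vscale n c x = restrict (\<lambda>i. c * x i) {..<n}"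

definition e1 :: "nat \<Rightarrow> (nat \<Rightarrow> real)" where
  "e1 n = restrict (\<lambda>i. if i = 0 then 1 else 0) {..<n}"

definition gauss :: "nat \<Rightarrow> real \<Rightarrow> (nat \<Rightarrow> real) measure" where
  "gauss n v = PiM {..<n} (\<lambda>_. density lborel (normal_density 0 (sqrt v)))"

definition awgn_mi :: "nat \<Rightarrow> real \<Rightarrow> (nat \<Rightarrow> real) measure \<Rightarrow> real" where
  "awgn_mi n v P =
     prob_space.mutual_information (P \<Otimes>\<^sub>M gauss n v) (exp 1) (Rn n) (Rn n)
       fst (\<lambda>(x, z). vadd n x z)"

definition secrecy_rate :: "nat \<Rightarrow> real \<Rightarrow> real \<Rightarrow> (nat \<Rightarrow> real) measure \<Rightarrow> real" where
  "secrecy_rate n v1 v2 P = awgn_mi n v1 P - awgn_mi n v2 P"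

definition admissible :: "nat \<Rightarrow> real \<Rightarrow> (nat \<Rightarrow> real) measure \<Rightarrow> bool" where
  "admissible n R P \<longleftrightarrow> prob_space P \<and> sets P = sets (Rn n) \<and> (AE x in P. vnorm n x \<le> R)"

text \<open>uniform distribution on the sphere of radius R: normalised surface (= cone) measure,
  i.e. the radial projection of the uniform distribution on the open unit ball\<close>
definition sphere_unif :: "nat \<Rightarrow> real \<Rightarrow> (nat \<Rightarrow> real) measure" where
  "sphere_unif n R =
     distr (uniform_measure (PiM {..<n} (\<lambda>_. lborel)) {x \<in> space (Rn n). vnorm n x < 1})
       (Rn n) (\<lambda>x. vscale n (R / vnorm n x) x)"

definition attains_Cs :: "nat \<Rightarrow> real \<Rightarrow> real \<Rightarrow> real \<Rightarrow> bool" where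
  "attains_Cs n v1 v2 R \<longleftrightarrow>
     admissible n R (sphere_unif n R) \<and>
     (\<forall>P. admissible n R P \<longrightarrow> secrecy_rate n v1 v2 P \<le> secrecy_rate n v1 v2 (sphere_unif n R))"

definition Rbar :: "nat \<Rightarrow> real \<Rightarrow> real \<Rightarrow> real" where
  "Rbar n v1 v2 =
     (if {R. 0 \<le> R \<and> attains_Cs n v1 v2 R} = {} then 0
      else (GREATEST R. 0 \<le> R \<and> attains_Cs n v1 v2 R))"

definition bessel_I :: "real \<Rightarrow> real \<Rightarrow> real" where
  "bessel_I v x = (\<Sum>m. (x / 2) powr (2 * real m + v) / (fact m * Gamma (real m + v + 1)))"

definition bessel_h :: "real \<Rightarrow> real \<Rightarrow> real" where
  "bessel_h v x = bessel_I v x / bessel_I (v - 1) x"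

definition seq_sign_changes :: "real list \<Rightarrow> nat" where
  "seq_sign_changes xs =
     (let ys = filter (\<lambda>x. x \<noteq> 0) xs in length (filter (\<lambda>(a, b). a * b < 0) (zip ys (tl ys))))"

definition num_sign_changes :: "(real \<Rightarrow> real) \<Rightarrow> real set \<Rightarrow> enat" where
  "num_sign_changes \<xi> \<Omega> =
     (SUP ys \<in> {ys. sorted_wrt (<) ys \<and> set ys \<subseteq> \<Omega>}. enat (seq_sign_changes (map \<xi> ys)))"

definition G_fun :: "real \<Rightarrow> real \<Rightarrow> real \<Rightarrow> nat \<Rightarrow> real \<Rightarrow> real" where
  "G_fun v1 v2 R n y =
     1 / v2 * (\<integral>w. R / vnorm (n + 2) (vadd (n + 2) (vscale (n + 2) y (e1 (n + 2))) w)
                   * bessel_h (real n / 2) (R / v2 * vnorm (n + 2) (vadd (n + 2) (vscale (n + 2) y (e1 (n + 2))) w))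
                 - 1 \<partial>gauss (n + 2) (v2 - v1))
     - 1 / v1 * (R / y * bessel_h (real n / 2) (R / v1 * y) - 1)"

definition assumption_A :: bool where
  "assumption_A \<longleftrightarrow>
     (\<forall>R \<ge> 0. \<forall>\<sigma>1 \<sigma>2 :: real. 0 < \<sigma>1 \<and> \<sigma>1 < \<sigma>2 \<longrightarrow> (\<forall>n \<ge> 1.
        num_sign_changes (G_fun (\<sigma>1\<^sup>2) (\<sigma>2\<^sup>2) R n) {0<..} \<le> 1))"

definition f_fun :: "nat \<Rightarrow> real \<Rightarrow> real \<Rightarrow> real \<Rightarrow> real" where
  "f_fun n v1 v2 R =
     integral {v1..v2} (\<lambda>s.
       ((\<integral>z. (bessel_h (real n / 2) (vnorm n (vscale n (sqrt s) z) * R / s))\<^sup>2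
             + (bessel_h (real n / 2)
                  (vnorm n (vadd n (vscale n R (e1 n)) (vscale n (sqrt s) z)) * R / s))\<^sup>2
           \<partial>gauss n 1) - 1) / s\<^sup>2)"

end

theory Submission
  imports Defs
begin

text \<open>
  By the I-MMSE relation the secrecy rate of an input \<open>X\<close> is
  \<open>\<integral> mmse(s) / (2 s\<^sup>2) ds\<close> over \<open>[\<sigma>\<^sub>1\<^sup>2, \<sigma>\<^sub>2\<^sup>2]\<close>, where \<open>mmse(s)\<close> is the error of estimating
  \<open>X\<close> in Gaussian noise of variance \<open>s\<close>. Estimating an arbitrary \<open>X\<close> by the Bayes estimator
  \<open>g\<close> of the spherical input bounds its \<open>mmse\<close> from above by the mean of \<open>\<Psi>(\<bar>X\<bar>\<^sup>2)\<close>, with equality on the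
  sphere. The function \<open>\<Psi>\<close> is convex: it is a Poisson mean of a sequence whose convexity follows, by Stein's
  identity, from the concavity of \<open>h\<^sup>2(\<surd>t)\<close> and \<open>\<surd>t h(\<surd>t)\<close> for the Bessel quotient \<open>h\<close>, which in turn come from its
  Riccati equation. Hence \<open>\<Psi>\<close> lies below its chord on \<open>[0, R\<^sup>2]\<close>, and the integral of
  \<open>\<Psi>(0) - \<Psi>(R\<^sup>2)\<close> is a positive multiple of \<open>f(R)\<close>; so \<open>f(R) \<le> 0\<close> suffices for the
  sphere to be optimal. Conversely, moving a small mass from the sphere to the origin shows that \<open>f(R) \<le> 0\<close> is
  necessary. Finally \<open>f\<close> is continuous and strictly increasing, negative at \<open>0\<close> and eventually nonnegative.
\<close>

section \<open>Gaussian measures and affine maps\<close>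

text \<open>The minimum error of a general input has no formula, while the error of the fixed
  estimator \<open>g\<close> depends on the input only through its norm; this is what makes inputs
  comparable. With noise variance \<open>s = 1 / r^2\<close> the problem depends on radius and noise
  only through \<open>a = R^2 / s\<close>. In units of \<open>s\<close>, the error of
  \<open>g\<close> is \<open>a * Afun n a\<close> at the origin and
  \<open>a * (1 - Bfun n a)\<close> on the sphere. The two chord ends thus differ by
  \<open>a * phi n a\<close>, and \<open>phi n (R^2 / s) / s^2\<close> is the integrand of
  \<open>f\<close>, so the sign of \<open>f\<close> decides. The obstacle is convexity: the squared
  length of \<open>g\<close> contributes a concave term with positive sign, and the cross term has
  no evident curvature. Stein's identity trades the cross term for minus twice that concave term and
  a further convex one, so the total becomes convex. The Poisson mixture reduces a noncentral law to
  a sequence indexed by integers; binomial thinning carries chord inequalities of the sequence back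
  to the continuous parameter.\<close>

definition dotp :: "nat \<Rightarrow> (nat \<Rightarrow> real) \<Rightarrow> (nat \<Rightarrow> real) \<Rightarrow> real" where
  "dotp n x y = (\<Sum>i<n. x i * y i)"

definition affmap :: "nat \<Rightarrow> (nat \<Rightarrow> real) \<Rightarrow> real \<Rightarrow> (nat \<Rightarrow> real) \<Rightarrow> (nat \<Rightarrow> real)" where
  "affmap n t c x = restrict (\<lambda>i. t i + c * x i) {..<n}"

abbreviation Lb :: "nat \<Rightarrow> (nat \<Rightarrow> real) measure" where
  "Lb n \<equiv> PiM {..<n} (\<lambda>_. lborel)"

abbreviation stdg :: "nat \<Rightarrow> (nat \<Rightarrow> real) measure" where
  "stdg n \<equiv> gauss n 1"

lemma sets_Rn_Lb: "sets (Rn n) = sets (Lb n)"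
  unfolding Rn_def by (intro sets_PiM_cong) auto

lemma sets_gauss [measurable_cong, simp]: "sets (gauss n v) = sets (Rn n)"
  unfolding Rn_def gauss_def by (intro sets_PiM_cong) auto

lemma sets_Lb [measurable_cong, simp]: "sets (Lb n) = sets (Rn n)"
  by (simp add: sets_Rn_Lb)

lemma space_Rn: "space (Rn n) = {..<n} \<rightarrow>\<^sub>E UNIV"
  by (simp add: Rn_def space_PiM)

lemma space_gauss [simp]: "space (gauss n v) = space (Rn n)"
  by (rule sets_eq_imp_space_eq) simp

lemma space_Lb [simp]: "space (Lb n) = space (Rn n)"
  by (rule sets_eq_imp_space_eq) simp

lemma measurable_component_Rn [measurable (raw)]: "i < n \<Longrightarrow> (\<lambda>x. x i) \<in> borel_measurable (Rn n)"
  unfolding Rn_def by (rule measurable_component_singleton) auto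

lemma measurable_comp_Rn:
  "f \<in> M \<rightarrow>\<^sub>M Rn n \<Longrightarrow> i < n \<Longrightarrow> (\<lambda>x. f x i) \<in> borel_measurable M"
  using measurable_compose[OF _ measurable_component_Rn] by blast

lemma measurable_restrict_Rn:
  "(\<And>i. i < n \<Longrightarrow> (\<lambda>x. f x i) \<in> borel_measurable M) \<Longrightarrow> (\<lambda>x. restrict (f x) {..<n}) \<in> M \<rightarrow>\<^sub>M Rn n"
  unfolding Rn_def by (rule measurable_restrict) auto

lemma measurable_fst_Rn [measurable (raw)]: "i < n \<Longrightarrow> (\<lambda>x. fst x i) \<in> borel_measurable (Rn n \<Otimes>\<^sub>M N)"
  by (rule measurable_comp_Rn[OF measurable_fst])

lemma measurable_snd_Rn [measurable (raw)]: "i < n \<Longrightarrow> (\<lambda>x. snd x i) \<in> borel_measurable (N \<Otimes>\<^sub>M Rn n)"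
  by (rule measurable_comp_Rn[OF measurable_snd])

lemma measurable_dotp [measurable (raw)]:
  "(\<And>i. i < n \<Longrightarrow> (\<lambda>x. f x i) \<in> borel_measurable M) \<Longrightarrow> (\<And>i. i < n \<Longrightarrow> (\<lambda>x. g x i) \<in> borel_measurable M)
   \<Longrightarrow> (\<lambda>x. dotp n (f x) (g x)) \<in> borel_measurable M"
  unfolding dotp_def by (intro borel_measurable_sum borel_measurable_times) auto

lemma vnorm_dotp: "vnorm n x = sqrt (dotp n x x)"
  by (simp add: vnorm_def dotp_def power2_eq_square)

lemma dotp_self_nonneg [simp]: "0 \<le> dotp n x x"
  by (simp add: dotp_def sum_nonneg)

lemma vnorm_sq: "(vnorm n x)\<^sup>2 = dotp n x x"
  by (simp add: vnorm_dotp)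

lemma vnorm_nonneg [simp]: "0 \<le> vnorm n x"
  by (simp add: vnorm_dotp)

lemma dotp_commute: "dotp n x y = dotp n y x"
  by (simp add: dotp_def mult.commute)

lemma dotp_Cauchy_Schwarz: "\<bar>dotp n x y\<bar> \<le> vnorm n x * vnorm n y"
proof -
  have "(dotp n x y)\<^sup>2 \<le> dotp n x x * dotp n y y"
    using Cauchy_Schwarz_ineq_sum[of x y "{..<n}"] by (simp add: dotp_def power2_eq_square)
  then have "sqrt ((dotp n x y)\<^sup>2) \<le> sqrt (dotp n x x * dotp n y y)"
    by (rule real_sqrt_le_mono)
  then show ?thesis
    by (simp add: vnorm_dotp real_sqrt_mult)
qed

lemma measurable_vnorm [measurable (raw)]:
  "(\<And>i. i < n \<Longrightarrow> (\<lambda>x. f x i) \<in> borel_measurable M) \<Longrightarrow> (\<lambda>x. vnorm n (f x)) \<in> borel_measurable M"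
  unfolding vnorm_dotp by measurable

lemma measurable_affmap [measurable (raw)]:
  assumes [measurable]: "\<And>i. i < n \<Longrightarrow> (\<lambda>x. t x i) \<in> borel_measurable M" "\<And>i. i < n \<Longrightarrow> (\<lambda>x. g x i) \<in> borel_measurable M"
    "c \<in> borel_measurable M"
  shows "(\<lambda>x. affmap n (t x) (c x) (g x)) \<in> M \<rightarrow>\<^sub>M Rn n"
  unfolding affmap_def by (intro measurable_restrict_Rn) measurable

lemma measurable_vscale [measurable (raw)]:
  assumes [measurable]: "\<And>i. i < n \<Longrightarrow> (\<lambda>x. g x i) \<in> borel_measurable M" "c \<in> borel_measurable M"
  shows "(\<lambda>x. vscale n (c x) (g x)) \<in> M \<rightarrow>\<^sub>M Rn n"
  unfolding vscale_def by (intro measurable_restrict_Rn) measurable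

lemma measurable_affmap_comp [measurable (raw)]:
  assumes [measurable]: "(\<lambda>x. t x i) \<in> borel_measurable M" "(\<lambda>x. g x i) \<in> borel_measurable M"
    "c \<in> borel_measurable M"
  shows "i < n \<Longrightarrow> (\<lambda>x. affmap n (t x) (c x) (g x) i) \<in> borel_measurable M"
  unfolding affmap_def by simp

lemma measurable_vscale_comp [measurable (raw)]:
  assumes [measurable]: "(\<lambda>x. g x i) \<in> borel_measurable M" "c \<in> borel_measurable M"
  shows "i < n \<Longrightarrow> (\<lambda>x. vscale n (c x) (g x) i) \<in> borel_measurable M"
  unfolding vscale_def by simp

lemma dotp_vscale_left [simp]: "dotp n (vscale n c x) y = c * dotp n x y"
  by (simp add: dotp_def vscale_def sum_distrib_left mult.assoc)

lemma dotp_vscale_right [simp]: "dotp n x (vscale n c y) = c * dotp n x y"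
  by (simp add: dotp_def vscale_def sum_distrib_left mult_ac)

lemma dotp_affmap_right: "dotp n y (affmap n t c x) = dotp n y t + c * dotp n y x"
  by (simp add: dotp_def affmap_def sum_distrib_left sum.distrib algebra_simps)

lemma dotp_affmap_self:
  "dotp n (affmap n t c x) (affmap n t c x) = dotp n t t + 2 * c * dotp n t x + c\<^sup>2 * dotp n x x"
proof -
  have "dotp n (affmap n t c x) (affmap n t c x) = dotp n (affmap n t c x) t + c * dotp n (affmap n t c x) x"
    by (rule dotp_affmap_right)
  also have "\<dots> = (dotp n t t + c * dotp n t x) + c * (dotp n x t + c * dotp n x x)"
    by (simp add: dotp_commute[of n "affmap n t c x"] dotp_affmap_right)
  finally show ?thesis
    by (simp add: dotp_commute[of n x t] algebra_simps power2_eq_square)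
qed

section \<open>Affine changes of variables for Lebesgue and Gaussian measure\<close>

interpretation lb: product_sigma_finite "\<lambda>_::nat. lborel :: real measure"
  by standard

text \<open>Agreement on boxes suffices for product measures; there each coordinate contributes one
  factor \<open>|c|\<close> from the one-dimensional substitution.\<close>

lemma Lb_affine:
  assumes c: "c \<noteq> 0"
  shows "Lb n = density (distr (Lb n) (Rn n) (affmap n t c)) (\<lambda>_. ennreal (\<bar>c\<bar> ^ n))"
proof (rule lb.PiM_eqI[symmetric])
  fix A :: "nat \<Rightarrow> real set" assume A: "\<And>i. i \<in> {..<n} \<Longrightarrow> A i \<in> sets lborel"
  have PA: "Pi\<^sub>E {..<n} A \<in> sets (Rn n)"
    using A unfolding Rn_def by (intro sets_PiM_I_finite) auto
  have pre: "affmap n t c -` Pi\<^sub>E {..<n} A \<inter> space (Lb n) = Pi\<^sub>E {..<n} (\<lambda>i. (\<lambda>x. t i + c * x) -` A i)"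
    unfolding space_Lb space_Rn by (auto simp: affmap_def PiE_iff extensional_def)
  have m: "(\<lambda>x. t i + c * x) -` A i \<in> sets lborel" if "i < n" for i
    using measurable_sets[of "\<lambda>x. t i + c * x" borel borel "A i"] A[of i] that by auto
  have e: "emeasure lborel (A i) = ennreal \<bar>c\<bar> * emeasure lborel ((\<lambda>x. t i + c * x) -` A i)" if "i < n" for i
  proof -
    have "emeasure lborel (A i) = emeasure (density (distr lborel borel (\<lambda>x. t i + c * x)) (\<lambda>_. ennreal \<bar>c\<bar>)) (A i)"
      using lborel_real_affine[OF c, of "t i"] by simp
    then show ?thesis
      using A[of i] that by (simp add: emeasure_density emeasure_distr nn_integral_cmult)
  qed
  have "emeasure (density (distr (Lb n) (Rn n) (affmap n t c)) (\<lambda>_. ennreal (\<bar>c\<bar> ^ n))) (Pi\<^sub>E {..<n} A)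
      = ennreal (\<bar>c\<bar> ^ n) * emeasure (Lb n) (Pi\<^sub>E {..<n} (\<lambda>i. (\<lambda>x. t i + c * x) -` A i))"
    using PA by (simp add: emeasure_density emeasure_distr nn_integral_cmult flip: pre)
  also have "\<dots> = ennreal (\<bar>c\<bar> ^ n) * (\<Prod>i<n. emeasure lborel ((\<lambda>x. t i + c * x) -` A i))"
    using m by (subst lb.emeasure_PiM) auto
  also have "\<dots> = (\<Prod>i<n. ennreal \<bar>c\<bar> * emeasure lborel ((\<lambda>x. t i + c * x) -` A i))"
    by (simp add: prod.distrib ennreal_power)
  also have "\<dots> = (\<Prod>i<n. emeasure lborel (A i))"
    using e by (intro prod.cong) auto
  finally show "emeasure (density (distr (Lb n) (Rn n) (affmap n t c)) (\<lambda>_. ennreal (\<bar>c\<bar> ^ n))) (Pi\<^sub>E {..<n} A)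
      = (\<Prod>i<n. emeasure lborel (A i))" .
qed (rule finite_lessThan, unfold sets_density sets_distr, rule sets_Rn_Lb)

lemma nn_integral_Lb_affine:
  assumes "c \<noteq> 0" and [measurable]: "f \<in> borel_measurable (Rn n)"
  shows "(\<integral>\<^sup>+x. f x \<partial>Lb n) = ennreal (\<bar>c\<bar> ^ n) * (\<integral>\<^sup>+x. f (affmap n t c x) \<partial>Lb n)"
proof -
  have "(\<integral>\<^sup>+x. f x \<partial>Lb n) = (\<integral>\<^sup>+x. f x \<partial>density (distr (Lb n) (Rn n) (affmap n t c)) (\<lambda>_. ennreal (\<bar>c\<bar> ^ n)))"
    by (rule arg_cong[OF Lb_affine[OF assms(1)]])
  also have "\<dots> = (\<integral>\<^sup>+x. ennreal (\<bar>c\<bar> ^ n) * f x \<partial>distr (Lb n) (Rn n) (affmap n t c))"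
    by (rule nn_integral_density) auto
  also have "\<dots> = (\<integral>\<^sup>+x. ennreal (\<bar>c\<bar> ^ n) * f (affmap n t c x) \<partial>Lb n)"
    by (rule nn_integral_distr) auto
  also have "\<dots> = ennreal (\<bar>c\<bar> ^ n) * (\<integral>\<^sup>+x. f (affmap n t c x) \<partial>Lb n)"
    by (rule nn_integral_cmult) auto
  finally show ?thesis .
qed

definition gdens :: "nat \<Rightarrow> real \<Rightarrow> (nat \<Rightarrow> real) \<Rightarrow> real" where
  "gdens n v x = (1 / sqrt (2 * pi * v)) ^ n * exp (- dotp n x x / (2 * v))"

lemma gdens_nonneg [simp]: "v > 0 \<Longrightarrow> gdens n v x \<ge> 0"
  by (simp add: gdens_def)

lemma measurable_gdens [measurable (raw)]:
  "(\<And>i. i < n \<Longrightarrow> (\<lambda>x. f x i) \<in> borel_measurable M) \<Longrightarrow> (\<lambda>x. gdens n v (f x)) \<in> borel_measurable M"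
  unfolding gdens_def
  by (intro borel_measurable_times borel_measurable_divide
      borel_measurable_uminus measurable_dotp measurable_compose[OF _ borel_measurable_exp]) auto

lemma gdens_prod:
  assumes "v > 0"
  shows "gdens n v x = (\<Prod>i<n. normal_density 0 (sqrt v) (x i))"
proof -
  have "(\<Prod>i<n. normal_density 0 (sqrt v) (x i)) = (\<Prod>i<n. (1 / sqrt (2 * pi * v)) * exp (- (x i)\<^sup>2 / (2 * v)))"
    using assms by (intro prod.cong) (auto simp: normal_density_def)
  also have "\<dots> = (1 / sqrt (2 * pi * v)) ^ n * (\<Prod>i<n. exp (- (x i)\<^sup>2 / (2 * v)))"
    by (simp only: prod.distrib prod_constant card_lessThan)
  also have "(\<Prod>i<n. exp (- (x i)\<^sup>2 / (2 * v))) = exp (\<Sum>i<n. - (x i)\<^sup>2 / (2 * v))"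
    by (simp add: exp_sum)
  also have "(\<Sum>i<n. - (x i)\<^sup>2 / (2 * v)) = - dotp n x x / (2 * v)"
    by (simp add: dotp_def sum_negf sum_divide_distrib power2_eq_square)
  finally show ?thesis by (simp add: gdens_def)
qed

lemma gauss_density:
  assumes v: "v > 0"
  shows "gauss n v = density (Lb n) (\<lambda>x. ennreal (gdens n v x))"
proof -
  let ?N = "density lborel (\<lambda>x. ennreal (normal_density 0 (sqrt v) x))"
  interpret N: prob_space ?N
    using v by (intro prob_space_normal_density) auto
  interpret product_sigma_finite "\<lambda>_::nat. ?N"
    by standard
  show ?thesis unfolding gauss_def
  proof (rule PiM_eqI[symmetric])
    fix A :: "nat \<Rightarrow> real set" assume A: "\<And>i. i \<in> {..<n} \<Longrightarrow> A i \<in> sets ?N"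
    have A': "\<And>i. i < n \<Longrightarrow> A i \<in> sets borel" using A by auto
    have PA: "Pi\<^sub>E {..<n} A \<in> sets (Rn n)"
      using A unfolding Rn_def by (intro sets_PiM_I_finite) auto
    have "emeasure (density (Lb n) (\<lambda>x. ennreal (gdens n v x))) (Pi\<^sub>E {..<n} A)
        = (\<integral>\<^sup>+x. ennreal (gdens n v x) * indicator (Pi\<^sub>E {..<n} A) x \<partial>Lb n)"
      using PA by (simp add: emeasure_density)
    also have "\<dots> = (\<integral>\<^sup>+x. (\<Prod>i<n. ennreal (normal_density 0 (sqrt v) (x i)) * indicator (A i) (x i)) \<partial>Lb n)"
    proof (rule nn_integral_cong)
      fix x assume "x \<in> space (Lb n)"
      then have "(indicator (Pi\<^sub>E {..<n} A) x :: ennreal) = (\<Prod>i<n. indicator (A i) (x i))"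
        by (auto simp: indicator_def space_Rn PiE_iff extensional_def prod.neutral intro!: prod_zero[symmetric])
      then show "ennreal (gdens n v x) * indicator (Pi\<^sub>E {..<n} A) x
          = (\<Prod>i<n. ennreal (normal_density 0 (sqrt v) (x i)) * indicator (A i) (x i))"
        using v by (simp add: gdens_prod prod.distrib prod_ennreal)
    qed
    also have "\<dots> = (\<Prod>i<n. \<integral>\<^sup>+x. ennreal (normal_density 0 (sqrt v) x) * indicator (A i) x \<partial>lborel)"
      using A' by (intro lb.product_nn_integral_prod) auto
    also have "\<dots> = (\<Prod>i<n. emeasure ?N (A i))"
      using A' by (intro prod.cong) (auto simp: emeasure_density)
    finally show "emeasure (density (Lb n) (\<lambda>x. ennreal (gdens n v x))) (Pi\<^sub>E {..<n} A) = (\<Prod>i<n. emeasure ?N (A i))" .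
  qed (use sets_gauss[of n v] in \<open>auto simp: gauss_def\<close>)
qed

lemma prob_space_gauss: "v > 0 \<Longrightarrow> prob_space (gauss n v)"
  unfolding gauss_def by (intro prob_space_PiM prob_space_normal_density) auto

text \<open>Completing the square. One identity serves twice: \<open>c = 1\<close> gives the
  translation formula for the Gaussian, \<open>t = 0\<close> the scaling formula.\<close>

lemma gdens_affine:
  assumes "c > 0"
  shows "c ^ n * gdens n (c\<^sup>2) (affmap n t c x) = gdens n 1 x * exp (- dotp n t x / c - dotp n t t / (2 * c\<^sup>2))"
proof -
  have e: "- dotp n (affmap n t c x) (affmap n t c x) / (2 * c\<^sup>2)
     = - dotp n x x / 2 + (- dotp n t x / c - dotp n t t / (2 * c\<^sup>2))"
    using assms unfolding dotp_affmap_self by (simp add: field_simps power2_eq_square)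
  have k: "c ^ n * (1 / sqrt (2 * pi * c\<^sup>2)) ^ n = (1 / sqrt (2 * pi)) ^ n"
    using assms by (simp add: real_sqrt_mult power_divide field_simps power_mult_distrib)
  have "c ^ n * gdens n (c\<^sup>2) (affmap n t c x) =
     (c ^ n * (1 / sqrt (2 * pi * c\<^sup>2)) ^ n) * exp (- dotp n (affmap n t c x) (affmap n t c x) / (2 * c\<^sup>2))"
    by (simp add: gdens_def)
  also have "\<dots> = (1 / sqrt (2 * pi)) ^ n * exp (- dotp n x x / 2) * exp (- dotp n t x / c - dotp n t t / (2 * c\<^sup>2))"
    unfolding k e exp_add by simp
  finally show ?thesis by (simp add: gdens_def)
qed

text \<open>The Cameron-Martin formula. The exponential factor is the likelihood ratio of a shifted
  against a centred Gaussian; every channel density below comes from it.\<close>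

lemma gauss_translate:
  "distr (stdg n) (Rn n) (affmap n \<xi> 1) = density (stdg n) (\<lambda>z. ennreal (exp (dotp n \<xi> z - dotp n \<xi> \<xi> / 2)))"
proof (rule measure_eqI)
  fix A assume "A \<in> sets (distr (stdg n) (Rn n) (affmap n \<xi> 1))"
  then have A [measurable]: "A \<in> sets (Rn n)" by simp
  have g: "gdens n 1 x = gdens n 1 (affmap n \<xi> 1 x) * exp (dotp n \<xi> (affmap n \<xi> 1 x) - dotp n \<xi> \<xi> / 2)" for x
  proof -
    have "gdens n 1 (affmap n \<xi> 1 x) = gdens n 1 x * exp (- dotp n \<xi> x - dotp n \<xi> \<xi> / 2)"
      using gdens_affine[of 1 n \<xi> x] by simp
    moreover have "exp (- dotp n \<xi> x - dotp n \<xi> \<xi> / 2) * exp (dotp n \<xi> (affmap n \<xi> 1 x) - dotp n \<xi> \<xi> / 2) = 1"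
      unfolding dotp_affmap_right exp_add[symmetric] by simp
    ultimately show ?thesis by simp
  qed
  have "emeasure (distr (stdg n) (Rn n) (affmap n \<xi> 1)) A
      = (\<integral>\<^sup>+x. indicator A (affmap n \<xi> 1 x) \<partial>stdg n)"
    by (subst nn_integral_indicator[symmetric], simp) (subst nn_integral_distr, auto)
  also have "\<dots> = (\<integral>\<^sup>+x. ennreal (gdens n 1 x) * indicator A (affmap n \<xi> 1 x) \<partial>Lb n)"
    by (subst gauss_density) (simp_all add: nn_integral_density)
  also have "\<dots> = (\<integral>\<^sup>+x. ennreal (gdens n 1 (affmap n \<xi> 1 x) * exp (dotp n \<xi> (affmap n \<xi> 1 x) - dotp n \<xi> \<xi> / 2)) * indicator A (affmap n \<xi> 1 x) \<partial>Lb n)"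
    by (simp only: g[symmetric])
  also have "\<dots> = (\<integral>\<^sup>+x. ennreal (gdens n 1 x * exp (dotp n \<xi> x - dotp n \<xi> \<xi> / 2)) * indicator A x \<partial>Lb n)"
    by (subst nn_integral_Lb_affine[of 1 _ n \<xi>]) auto
  also have "\<dots> = (\<integral>\<^sup>+x. ennreal (exp (dotp n \<xi> x - dotp n \<xi> \<xi> / 2)) * indicator A x \<partial>stdg n)"
    by (subst gauss_density) (simp_all add: nn_integral_density ennreal_mult mult.assoc)
  also have "\<dots> = emeasure (density (stdg n) (\<lambda>z. ennreal (exp (dotp n \<xi> z - dotp n \<xi> \<xi> / 2)))) A"
    by (simp add: emeasure_density)
  finally show "emeasure (distr (stdg n) (Rn n) (affmap n \<xi> 1)) A = \<dots>" .
qed simp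

lemma gauss_scale:
  assumes c: "c > 0"
  shows "distr (stdg n) (Rn n) (vscale n c) = gauss n (c\<^sup>2)"
proof (rule measure_eqI)
  fix A assume "A \<in> sets (distr (stdg n) (Rn n) (vscale n c))"
  then have A [measurable]: "A \<in> sets (Rn n)" by simp
  have vs: "vscale n c = affmap n (\<lambda>_. 0) c"
    by (auto simp: vscale_def affmap_def)
  have "emeasure (gauss n (c\<^sup>2)) A = (\<integral>\<^sup>+x. ennreal (gdens n (c\<^sup>2) x) * indicator A x \<partial>Lb n)"
    using c by (simp add: gauss_density emeasure_density)
  also have "\<dots> = ennreal (c ^ n) * (\<integral>\<^sup>+x. ennreal (gdens n (c\<^sup>2) (vscale n c x)) * indicator A (vscale n c x) \<partial>Lb n)"
    using c by (subst nn_integral_Lb_affine[of c _ n "\<lambda>_. 0"]) (auto simp: vs)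
  also have "\<dots> = (\<integral>\<^sup>+x. ennreal (c ^ n) * (ennreal (gdens n (c\<^sup>2) (vscale n c x)) * indicator A (vscale n c x)) \<partial>Lb n)"
    by (rule nn_integral_cmult[symmetric]) measurable
  also have "\<dots> = (\<integral>\<^sup>+x. ennreal (gdens n 1 x) * indicator A (vscale n c x) \<partial>Lb n)"
  proof (rule nn_integral_cong)
    fix x
    have "c ^ n * gdens n (c\<^sup>2) (vscale n c x) = gdens n 1 x"
      using gdens_affine[OF c, of n "\<lambda>_. 0" x] by (simp add: vs dotp_def)
    then show "ennreal (c ^ n) * (ennreal (gdens n (c\<^sup>2) (vscale n c x)) * indicator A (vscale n c x))
        = ennreal (gdens n 1 x) * indicator A (vscale n c x)"
      using c by (metis ennreal_mult gdens_nonneg mult.assoc order_less_imp_le zero_le_power zero_less_power)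
  qed
  also have "\<dots> = (\<integral>\<^sup>+x. indicator A (vscale n c x) \<partial>stdg n)"
    by (simp add: gauss_density nn_integral_density)
  also have "\<dots> = emeasure (distr (stdg n) (Rn n) (vscale n c)) A"
    by (subst nn_integral_indicator[symmetric], simp) (subst nn_integral_distr, auto)
  finally show "emeasure (distr (stdg n) (Rn n) (vscale n c)) A = emeasure (gauss n (c\<^sup>2)) A" by simp
qed simp

section \<open>Stein's identity and polar decomposition\<close>

text \<open>Times the standard density, the integrand is \<open>sqrt 2 ^ n\<close> times the density
  of variance \<open>2\<close>, which has finite mass. This is the envelope behind the integrability
  arguments below.\<close>

lemma integrable_stdg_exp_quarter: "integrable (stdg n) (\<lambda>z. exp (dotp n z z / 4))"
proof -
  interpret G2: prob_space "gauss n 2" by (rule prob_space_gauss) simp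
  have "integrable (gauss n 2) (\<lambda>_. sqrt 2 ^ n :: real)" by simp
  then have i: "integrable (Lb n) (\<lambda>x. gdens n 2 x * sqrt 2 ^ n)"
    by (subst (asm) gauss_density) (simp_all add: integrable_density)
  have "gdens n 2 x * sqrt 2 ^ n = gdens n 1 x * exp (dotp n x x / 4)" for x
  proof -
    have "1 / sqrt (2 * pi * 2) * sqrt 2 = 1 / sqrt (2 * pi)"
      unfolding real_sqrt_mult[of "2 * pi" 2] by simp
    then have "(1 / sqrt (2 * pi * 2)) ^ n * sqrt 2 ^ n = (1 / sqrt (2 * pi)) ^ n"
      unfolding power_mult_distrib[symmetric] by simp
    moreover have "exp (- dotp n x x / 2) * exp (dotp n x x / 4) = exp (- dotp n x x / 4)"
      by (simp flip: exp_add)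
    ultimately have "((1 / sqrt (2 * pi * 2)) ^ n * sqrt 2 ^ n) * exp (- dotp n x x / 4)
        = (1 / sqrt (2 * pi)) ^ n * (exp (- dotp n x x / 2) * exp (dotp n x x / 4))" by simp
    then show ?thesis by (simp add: gdens_def mult_ac)
  qed
  then show ?thesis
    using i by (subst gauss_density) (simp_all add: integrable_density)
qed

lemma power_le_exp: "(0::real) \<le> x \<Longrightarrow> x ^ k \<le> fact k * exp x"
proof -
  assume x: "0 \<le> x"
  have "x ^ k / fact k \<le> exp x"
    using x exp_converges[of x] sum_le_suminf[of "\<lambda>i. x ^ i /\<^sub>R fact i" "{k}"]
    by (simp add: sums_iff field_simps)
  then show ?thesis by (simp add: field_simps)
qed

text \<open>The polynomial and the exponential factor are each dominated by a multiple of
  \<open>exp (|z|^2 / 8)\<close>; together they stay below a multiple of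
  \<open>exp (|z|^2 / 4)\<close>.\<close>

lemma integrable_stdg_bound:
  assumes f: "f \<in> borel_measurable (Rn n)"
    and b: "\<And>z. z \<in> space (Rn n) \<Longrightarrow> \<bar>f z\<bar> \<le> C * (1 + (vnorm n z)\<^sup>2) ^ k * exp (\<rho> * vnorm n z)"
  shows "integrable (stdg n) (f :: _ \<Rightarrow> real)"
proof (rule Bochner_Integration.integrable_bound)
  let ?K = "\<bar>C\<bar> * (8 ^ k * fact k * exp (1/8)) * exp (2 * \<rho>\<^sup>2)"
  show "integrable (stdg n) (\<lambda>z. ?K * exp (dotp n z z / 4))"
    using integrable_stdg_exp_quarter by simp
  show "AE z in stdg n. norm (f z) \<le> norm (?K * exp (dotp n z z / 4))"
  proof (rule AE_I2)
    fix z assume z: "z \<in> space (stdg n)"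
    define t where "t = vnorm n z"
    have t: "t \<ge> 0" by (simp add: t_def)
    have a: "(1 + t\<^sup>2) ^ k \<le> 8 ^ k * fact k * exp (1/8) * exp (t\<^sup>2 / 8)"
    proof -
      have "((1 + t\<^sup>2) / 8) ^ k \<le> fact k * exp ((1 + t\<^sup>2) / 8)"
        by (rule power_le_exp) simp
      then have "8 ^ k * ((1 + t\<^sup>2) / 8) ^ k \<le> 8 ^ k * (fact k * exp ((1 + t\<^sup>2) / 8))"
        by (intro mult_left_mono) auto
      moreover have "8 ^ k * ((1 + t\<^sup>2) / 8) ^ k = (1 + t\<^sup>2) ^ k" by (simp add: power_divide)
      moreover have "exp ((1 + t\<^sup>2) / 8) = exp (1/8) * exp (t\<^sup>2 / 8)" by (simp add: add_divide_distrib exp_add)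
      ultimately show ?thesis by (simp only: mult.assoc)
    qed
    have c: "exp (\<rho> * t) \<le> exp (2 * \<rho>\<^sup>2) * exp (t\<^sup>2 / 8)"
    proof -
      \<comment> \<open>The factor \<open>4\<close> is chosen so that the quadratic part of the
        bound for \<open>\<rho> * t\<close> is exactly \<open>t^2 / 8\<close>.\<close>
      have "0 \<le> (4 * \<rho> - t)\<^sup>2" by simp
      then have "\<rho> * t \<le> 2 * \<rho>\<^sup>2 + t\<^sup>2 / 8" by (simp add: power2_eq_square algebra_simps)
      then show ?thesis by (simp flip: exp_add)
    qed
    have "norm (f z) \<le> C * (1 + t\<^sup>2) ^ k * exp (\<rho> * t)"
      using b[of z] z by (simp add: t_def)
    also have "\<dots> \<le> \<bar>C\<bar> * (1 + t\<^sup>2) ^ k * exp (\<rho> * t)"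
      by (intro mult_right_mono) auto
    also have "\<dots> \<le> \<bar>C\<bar> * (8 ^ k * fact k * exp (1/8) * exp (t\<^sup>2 / 8)) * (exp (2 * \<rho>\<^sup>2) * exp (t\<^sup>2 / 8))"
      by (intro mult_mono a c) auto
    also have "\<dots> = ?K * (exp (t\<^sup>2 / 8) * exp (t\<^sup>2 / 8))" by (simp add: mult_ac)
    also have "exp (t\<^sup>2 / 8) * exp (t\<^sup>2 / 8) = exp (dotp n z z / 4)"
      by (simp flip: exp_add add: t_def vnorm_sq)
    finally show "norm (f z) \<le> norm (?K * exp (dotp n z z / 4))" by simp
  qed
qed (use f in simp)

text \<open>Difference quotients are bounded by \<open>G\<close> through the mean value inequality
  and converge pointwise, so dominated convergence applies. Derivatives are taken within a convex
  set \<open>S\<close>, which admits one-sided derivatives at the end of an interval.\<close>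

lemma has_real_derivative_integral:
  fixes f f' :: "real \<Rightarrow> 'a \<Rightarrow> real"
  assumes S: "convex S" "t0 \<in> S"
    and f: "\<And>t. t \<in> S \<Longrightarrow> integrable M (f t)"
    and f' [measurable]: "f' t0 \<in> borel_measurable M"
    and G: "integrable M G"
    and D: "AE x in M. \<forall>t\<in>S. ((\<lambda>t. f t x) has_real_derivative f' t x) (at t within S)"
    and B: "AE x in M. \<forall>t\<in>S. \<bar>f' t x\<bar> \<le> G x"
  shows "((\<lambda>t. \<integral>x. f t x \<partial>M) has_real_derivative (\<integral>x. f' t0 x \<partial>M)) (at t0 within S)"
  unfolding has_field_derivative_iff tendsto_at_iff_sequentially
proof (intro allI impI)
  fix X :: "nat \<Rightarrow> real" assume X: "\<forall>i. X i \<in> S - {t0}" "X \<longlonglongrightarrow> t0"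
  have "(\<lambda>i. \<integral>x. (f (X i) x - f t0 x) / (X i - t0) \<partial>M) \<longlonglongrightarrow> (\<integral>x. f' t0 x \<partial>M)"
  proof (rule integral_dominated_convergence[where w=G])
    show "(\<lambda>x. (f (X i) x - f t0 x) / (X i - t0)) \<in> borel_measurable M" for i
      using f[of "X i"] f[of t0] X(1) S(2) by (intro borel_measurable_divide borel_measurable_diff) auto
    show "AE x in M. (\<lambda>i. (f (X i) x - f t0 x) / (X i - t0)) \<longlonglongrightarrow> f' t0 x"
      using D
    proof eventually_elim
      case (elim x)
      then have "((\<lambda>t. (f t x - f t0 x) / (t - t0)) \<longlongrightarrow> f' t0 x) (at t0 within S)"
        using S(2) by (simp add: has_field_derivative_iff)
      then show ?case using X by (auto simp: tendsto_at_iff_sequentially comp_def)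
    qed
    show "AE x in M. norm ((f (X i) x - f t0 x) / (X i - t0)) \<le> G x" for i
      using D B
    proof eventually_elim
      case (elim x)
      have "norm (f (X i) x - f t0 x) \<le> G x * norm (X i - t0)"
        using elim S X(1) by (intro field_differentiable_bound[where f'="\<lambda>t. f' t x" and S=S]) auto
      moreover have "X i \<noteq> t0" using X(1) by auto
      ultimately show ?case by (simp add: divide_simps)
    qed
  qed (use G in auto)
  moreover have "X i \<noteq> t0" for i using X(1) by auto
  moreover have "(\<integral>x. (f (X i) x - f t0 x) / (X i - t0) \<partial>M)
      = ((\<integral>x. f (X i) x \<partial>M) - (\<integral>x. f t0 x \<partial>M)) / (X i - t0)" for i
    using Bochner_Integration.integral_diff[OF f[of "X i"] f[of t0]] X(1) S(2) by simp
  ultimately show "((\<lambda>t. ((\<integral>x. f t x \<partial>M) - (\<integral>x. f t0 x \<partial>M)) / (t - t0)) \<circ> X) \<longlonglongrightarrow> (\<integral>x. f' t0 x \<partial>M)"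
    by (simp add: comp_def)
qed

text \<open>The scaling is moved from the argument of \<open>F\<close> into the density, as the
  ratio of the Gaussian densities of variance \<open>c^2\<close> and \<open>1\<close>.\<close>

lemma integral_gauss_scale:
  assumes "c > 0" and [measurable]: "F \<in> borel_measurable (Rn n)"
  shows "(\<integral>z. F (vscale n c z) \<partial>stdg n) = (\<integral>z. F z * ((1 / c ^ n) * exp (- (1 / c\<^sup>2 - 1) * dotp n z z / 2)) \<partial>stdg n :: real)"
proof -
  have e: "gdens n (c\<^sup>2) z = gdens n 1 z * ((1 / c ^ n) * exp (- (1 / c\<^sup>2 - 1) * dotp n z z / 2))" for z
  proof -
    have "- dotp n z z / (2 * c\<^sup>2) = - dotp n z z / 2 + - (1 / c\<^sup>2 - 1) * dotp n z z / 2"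
      using assms(1) by (simp add: field_simps)
    then have "exp (- dotp n z z / (2 * c\<^sup>2)) = exp (- dotp n z z / 2) * exp (- (1 / c\<^sup>2 - 1) * dotp n z z / 2)"
      by (metis exp_add)
    moreover have "(1 / sqrt (2 * pi * c\<^sup>2)) ^ n = (1 / sqrt (2 * pi)) ^ n * (1 / c ^ n)"
      using assms(1) by (simp add: real_sqrt_mult power_divide power_mult_distrib)
    ultimately show ?thesis by (simp add: gdens_def)
  qed
  have "(\<integral>z. F (vscale n c z) \<partial>stdg n) = (\<integral>z. F z \<partial>gauss n (c\<^sup>2))"
    by (subst gauss_scale[OF assms(1), symmetric]) (simp add: integral_distr)
  also have "\<dots> = (\<integral>z. gdens n (c\<^sup>2) z * F z \<partial>Lb n)"
    using assms(1) by (subst gauss_density) (simp_all add: integral_density)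
  also have "\<dots> = (\<integral>z. gdens n 1 z * (F z * ((1 / c ^ n) * exp (- (1 / c\<^sup>2 - 1) * dotp n z z / 2))) \<partial>Lb n)"
    by (simp only: e mult_ac)
  also have "\<dots> = (\<integral>z. F z * ((1 / c ^ n) * exp (- (1 / c\<^sup>2 - 1) * dotp n z z / 2)) \<partial>stdg n)"
    by (subst gauss_density) (simp_all add: integral_density)
  finally show ?thesis .
qed

text \<open>Both sides are the derivative at \<open>c = 1\<close> of the expectation of \<open>F (c\<^sup>2 W)\<close>, \<open>W\<close> the squared
  norm, computed in two ways: under the integral sign, and after moving the scaling into the density.\<close>

lemma stein_chi_square:
  fixes F F' :: "real \<Rightarrow> real"
  assumes F: "F \<in> borel_measurable borel" "F' \<in> borel_measurable borel"
    and D: "\<And>w. w \<ge> 0 \<Longrightarrow> (F has_real_derivative F' w) (at w within {0..})"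
    and B: "\<And>w. w \<ge> 0 \<Longrightarrow> \<bar>F w\<bar> \<le> C * (1 + w) ^ k" "\<And>w. w \<ge> 0 \<Longrightarrow> \<bar>F' w\<bar> \<le> C * (1 + w) ^ k"
  shows "(\<integral>z. 2 * dotp n z z * F' (dotp n z z) \<partial>stdg n) = (\<integral>z. (dotp n z z - n) * F (dotp n z z) \<partial>stdg n)"
proof -
  note [measurable] = F
  let ?S = "{1/2..1::real}"
  let ?h = "\<lambda>c z. F (c\<^sup>2 * dotp n z z)"
  let ?h' = "\<lambda>c z. (2 * c * dotp n z z) * F' (c\<^sup>2 * dotp n z z)"
  let ?g = "\<lambda>c z. F (dotp n z z) * (1 / c ^ n * exp (- (1 / c\<^sup>2 - 1) * dotp n z z / 2))"
  let ?g' = "\<lambda>c z. F (dotp n z z) * (((dotp n z z) / c ^ 3 - n / c) * (1 / c ^ n * exp (- (1 / c\<^sup>2 - 1) * dotp n z z / 2)))"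
  have C0: "C \<ge> 0" using B(1)[of 0] by simp
  have le1: "c\<^sup>2 * w \<le> w" if "c \<in> ?S" "w \<ge> 0" for c w :: real
    using that mult_right_mono[of "c\<^sup>2" 1 w] by (simp add: power_le_one)
  have gt: "1 / c ^ m \<le> 2 ^ m" if "c \<in> ?S" for c m
  proof -
    have "(1/2::real) ^ m \<le> c ^ m" using that by (intro power_mono) auto
    moreover have "c ^ m > 0" using that by (intro zero_less_power) auto
    ultimately show ?thesis by (simp add: field_simps)
  qed
  have e1: "exp (- (1 / c\<^sup>2 - 1) * w / 2) \<le> 1" if "c \<in> ?S" "w \<ge> 0" for c w :: real
  proof -
    have "c\<^sup>2 \<le> 1" "c\<^sup>2 > 0" using that by (auto intro: power_le_one)
    then have "1 / c\<^sup>2 \<ge> 1" by simp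
    then have "- (1 / c\<^sup>2 - 1) * w / 2 \<le> 0"
      using that by (intro divide_nonpos_pos mult_nonpos_nonneg) auto
    then show ?thesis by simp
  qed
  have eq: "(\<integral>z. ?h c z \<partial>stdg n) = (\<integral>z. ?g c z \<partial>stdg n)" if "c \<in> ?S" for c
    using integral_gauss_scale[of c "\<lambda>z. F (dotp n z z)" n] that
    by (simp add: power2_eq_square mult.assoc)
  have h: "((\<lambda>c. \<integral>z. ?h c z \<partial>stdg n) has_real_derivative (\<integral>z. ?h' 1 z \<partial>stdg n)) (at 1 within ?S)"
  proof (rule has_real_derivative_integral[where G="\<lambda>z. (2 * C) * (1 + dotp n z z) ^ Suc k"])
    show "integrable (stdg n) (?h c)" if c: "c \<in> ?S" for c
    proof (rule integrable_stdg_bound[where C=C and k=k and \<rho>=0])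
      fix z
      have "\<bar>?h c z\<bar> \<le> C * (1 + c\<^sup>2 * dotp n z z) ^ k" using B(1) by simp
      also have "\<dots> \<le> C * (1 + dotp n z z) ^ k"
        using le1[OF c] C0 by (intro mult_left_mono power_mono) auto
      finally show "\<bar>?h c z\<bar> \<le> C * (1 + (vnorm n z)\<^sup>2) ^ k * exp (0 * vnorm n z)"
        by (simp add: vnorm_sq)
    qed measurable
    show "integrable (stdg n) (\<lambda>z. (2 * C) * (1 + dotp n z z) ^ Suc k)"
      using C0 by (intro integrable_stdg_bound[where C="2 * C" and k="Suc k" and \<rho>=0]) (simp_all add: vnorm_sq abs_mult)
    show "AE z in stdg n. \<forall>c\<in>?S. ((\<lambda>c. ?h c z) has_real_derivative ?h' c z) (at c within ?S)"
    proof (intro AE_I2 ballI)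
      fix z c assume "c \<in> ?S"
      have "((\<lambda>c. F (c\<^sup>2 * dotp n z z)) has_real_derivative F' (c\<^sup>2 * dotp n z z) * (2 * c * dotp n z z)) (at c within ?S)"
      proof (rule DERIV_image_chain[where f=F and s="?S", unfolded comp_def])
        show "(F has_real_derivative F' (c\<^sup>2 * dotp n z z)) (at (c\<^sup>2 * dotp n z z) within (\<lambda>c. c\<^sup>2 * dotp n z z) ` ?S)"
          by (rule DERIV_subset[OF D]) auto
        show "((\<lambda>c. c\<^sup>2 * dotp n z z) has_real_derivative 2 * c * dotp n z z) (at c within ?S)"
          by (auto intro!: derivative_eq_intros)
      qed
      then show "((\<lambda>c. ?h c z) has_real_derivative ?h' c z) (at c within ?S)" by (simp add: mult.commute)
    qed
    show "AE z in stdg n. \<forall>c\<in>?S. \<bar>?h' c z\<bar> \<le> (2 * C) * (1 + dotp n z z) ^ Suc k"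
    proof (intro AE_I2 ballI)
      fix z c assume c: "c \<in> ?S"
      have "\<bar>F' (c\<^sup>2 * dotp n z z)\<bar> \<le> C * (1 + c\<^sup>2 * dotp n z z) ^ k" using B(2) by simp
      also have "\<dots> \<le> C * (1 + dotp n z z) ^ k"
        using le1[OF c] C0 by (intro mult_left_mono power_mono) auto
      finally have "\<bar>F' (c\<^sup>2 * dotp n z z)\<bar> \<le> C * (1 + dotp n z z) ^ k" .
      moreover have "\<bar>2 * c * dotp n z z\<bar> \<le> 2 * (1 + dotp n z z)"
        using c mult_right_mono[of c 1 "dotp n z z"] by (simp add: abs_mult)
      ultimately have "\<bar>?h' c z\<bar> \<le> (2 * (1 + dotp n z z)) * (C * (1 + dotp n z z) ^ k)"
        unfolding abs_mult[of _ "F' _"] by (intro mult_mono) auto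
      also have "\<dots> = (2 * C) * (1 + dotp n z z) ^ Suc k" by (simp only: power_Suc mult_ac)
      finally show "\<bar>?h' c z\<bar> \<le> (2 * C) * (1 + dotp n z z) ^ Suc k" .
    qed
  qed auto
  have g: "((\<lambda>c. \<integral>z. ?g c z \<partial>stdg n) has_real_derivative (\<integral>z. ?g' 1 z \<partial>stdg n)) (at 1 within ?S)"
  proof (rule has_real_derivative_integral[where f="?g" and f'="?g'" and G="\<lambda>z. (C * (8 + 2 * n) * 2 ^ n) * (1 + dotp n z z) ^ Suc k"])
    show "integrable (stdg n) (?g c)" if c: "c \<in> ?S" for c
    proof (rule integrable_stdg_bound[where C="C * 2 ^ n" and k=k and \<rho>=0])
      fix z
      have "\<bar>?g c z\<bar> = \<bar>F (dotp n z z)\<bar> * ((1 / c ^ n) * exp (- (1 / c\<^sup>2 - 1) * dotp n z z / 2))"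
        using c by (simp add: abs_mult)
      also have "\<dots> \<le> (C * (1 + dotp n z z) ^ k) * (2 ^ n * 1)"
        using c C0 B(1) gt[OF c, of n] e1[OF c, of "dotp n z z"] by (intro mult_mono) auto
      finally show "\<bar>?g c z\<bar> \<le> C * 2 ^ n * (1 + (vnorm n z)\<^sup>2) ^ k * exp (0 * vnorm n z)"
        by (simp add: vnorm_sq mult_ac)
    qed measurable
    show "integrable (stdg n) (\<lambda>z. (C * (8 + 2 * n) * 2 ^ n) * (1 + dotp n z z) ^ Suc k)"
      using C0 by (intro integrable_stdg_bound[where C="(C * (8 + 2 * n) * 2 ^ n)" and k="Suc k" and \<rho>=0]) (simp_all add: vnorm_sq abs_mult)
    show "AE z in stdg n. \<forall>c\<in>?S. ((\<lambda>c. ?g c z) has_real_derivative ?g' c z) (at c within ?S)"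
    proof (intro AE_I2 ballI)
      fix z and c :: real assume "c \<in> ?S"
      then have c: "c > 0" by auto
      define w where "w = dotp n z z"
      have inv: "1 / x ^ m = inverse x ^ m" "- (1 / x\<^sup>2 - 1) * w / 2 = - ((inverse x)\<^sup>2 - 1) * w / 2"
        "w / x ^ 3 - n / x = w * inverse x ^ 3 - n * inverse x" for x :: real and m
        by (simp_all add: inverse_eq_divide power_one_over)
      let ?E = "\<lambda>c. exp (- ((inverse c)\<^sup>2 - 1) * w / 2)"
      have "((\<lambda>c. inverse c ^ n) has_real_derivative n * inverse c ^ (n - 1) * (- (inverse c * 1 * inverse c))) (at c within ?S)"
        using c by (auto intro!: derivative_eq_intros)
      moreover have "n * inverse c ^ (n - 1) * (- (inverse c * 1 * inverse c)) = - (n * inverse c) * inverse c ^ n"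
        by (cases n) auto
      ultimately have 1: "((\<lambda>c. inverse c ^ n) has_real_derivative - (n * inverse c) * inverse c ^ n) (at c within ?S)"
        by (simp only:)
      have "((\<lambda>c. - ((inverse c)\<^sup>2 - 1) * w / 2) has_real_derivative (w * inverse c ^ 3)) (at c within ?S)"
        using c by (auto intro!: derivative_eq_intros simp: power2_eq_square power3_eq_cube)
      from DERIV_chain2[OF DERIV_exp this]
      have 2: "(?E has_real_derivative ?E c * (w * inverse c ^ 3)) (at c within ?S)" .
      have "((\<lambda>c. F w * (inverse c ^ n * ?E c)) has_real_derivative
          F w * (- (n * inverse c) * inverse c ^ n * ?E c + ?E c * (w * inverse c ^ 3) * inverse c ^ n)) (at c within ?S)"
        by (rule DERIV_cmult[OF DERIV_mult[OF 1 2]])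
      moreover have "F w * (- (n * inverse c) * inverse c ^ n * ?E c + ?E c * (w * inverse c ^ 3) * inverse c ^ n)
          = F w * ((w * inverse c ^ 3 - n * inverse c) * (inverse c ^ n * ?E c))"
        by (simp add: left_diff_distrib)
      ultimately show "((\<lambda>c. ?g c z) has_real_derivative ?g' c z) (at c within ?S)"
        unfolding w_def[symmetric] inv by (simp only:)
    qed
    show "AE z in stdg n. \<forall>c\<in>?S. \<bar>?g' c z\<bar> \<le> (C * (8 + 2 * n) * 2 ^ n) * (1 + dotp n z z) ^ Suc k"
    proof (intro AE_I2 ballI)
      fix z c assume c: "c \<in> ?S"
      have a: "1 / c ^ 3 \<le> 8" "1 / c \<le> 2" using gt[OF c, of 3] gt[OF c, of 1] by simp_all
      have "\<bar>dotp n z z / c ^ 3 - n / c\<bar> \<le> dotp n z z * (1 / c ^ 3) + n * (1 / c)"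
        using c by (intro order_trans[OF abs_triangle_ineq4]) (simp add: abs_mult)
      also have "\<dots> \<le> dotp n z z * 8 + real n * 2"
        by (rule add_mono[OF mult_left_mono[OF a(1)] mult_left_mono[OF a(2)]]) auto
      also have "\<dots> \<le> (8 + 2 * n) * (1 + dotp n z z)" by (simp add: algebra_simps)
      finally have "\<bar>dotp n z z / c ^ 3 - n / c\<bar> \<le> (8 + 2 * n) * (1 + dotp n z z)" .
      moreover have "\<bar>1 / c ^ n * exp (- (1 / c\<^sup>2 - 1) * dotp n z z / 2)\<bar> \<le> 2 ^ n * 1"
        using c gt[OF c, of n] e1[OF c, of "dotp n z z"] unfolding abs_mult by (intro mult_mono) auto
      ultimately have "\<bar>?g' c z\<bar> \<le> (C * (1 + dotp n z z) ^ k) * (((8 + 2 * n) * (1 + dotp n z z)) * (2 ^ n * 1))"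
        unfolding abs_mult[of "F _"] abs_mult[of "dotp n z z / c ^ 3 - n / c"] using B(1)[of "dotp n z z"] C0
        by (intro mult_mono) auto
      also have "\<dots> = (C * (8 + 2 * n) * 2 ^ n) * (1 + dotp n z z) ^ Suc k"
        by (simp only: power_Suc mult_ac mult_1_right)
      finally show "\<bar>?g' c z\<bar> \<le> (C * (8 + 2 * n) * 2 ^ n) * (1 + dotp n z z) ^ Suc k" .
    qed
  qed auto
  have "((\<lambda>c. \<integral>z. ?g c z \<partial>stdg n) has_real_derivative (\<integral>z. ?h' 1 z \<partial>stdg n)) (at 1 within ?S)"
    using has_field_derivative_transform_within[OF h zero_less_one] eq by simp
  moreover have "at (1::real) within ?S \<noteq> bot"
    by (simp add: at_within_Icc_at_left)
  ultimately have "(\<integral>z. ?h' 1 z \<partial>stdg n) = (\<integral>z. ?g' 1 z \<partial>stdg n)"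
    using g tendsto_unique unfolding has_field_derivative_iff by blast
  then show ?thesis by (simp add: mult.commute)
qed

section \<open>Moments of the chi-square law\<close>

definition mom :: "nat \<Rightarrow> nat \<Rightarrow> real" where
  "mom n k = (\<integral>z. (dotp n z z) ^ k \<partial>stdg n)"

lemma integrable_pow: "integrable (stdg n) (\<lambda>z. (dotp n z z) ^ k)"
  by (rule integrable_stdg_bound[where C=1 and k=k and \<rho>=0])
     (auto simp: vnorm_sq intro!: power_mono)

lemma mom_0 [simp]: "mom n 0 = 1"
  using prob_space.prob_space[OF prob_space_gauss, of 1 n] by (simp add: mom_def)

text \<open>Stein's identity for \<open>F w = w ^ k\<close>. Hence \<open>mom n k\<close> is the
  product \<open>n (n + 2) ... (n + 2 k - 2)\<close>.\<close>

lemma mom_Suc: "mom n (Suc k) = (n + 2 * k) * mom n k"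
proof -
  have "(\<integral>z. 2 * dotp n z z * (k * (dotp n z z) ^ (k - 1)) \<partial>stdg n) = (\<integral>z. (dotp n z z - n) * (dotp n z z) ^ k \<partial>stdg n)"
  proof (rule stein_chi_square[where C="real (Suc k)" and k=k])
    fix w :: real assume w: "w \<ge> 0"
    show "((\<lambda>w. w ^ k) has_real_derivative k * w ^ (k - 1)) (at w within {0..})"
      by (auto intro!: derivative_eq_intros)
    have "w ^ k \<le> (1 + w) ^ k" using w by (intro power_mono) auto
    then show "\<bar>w ^ k\<bar> \<le> real (Suc k) * (1 + w) ^ k"
      using w order_trans[OF _ mult_right_mono[of 1 "real (Suc k)" "(1 + w) ^ k"], of "w ^ k"] by simp
    have "w ^ (k - 1) \<le> (1 + w) ^ (k - 1)" using w by (intro power_mono) auto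
    also have "\<dots> \<le> (1 + w) ^ k" using w by (intro power_increasing) auto
    finally show "\<bar>real k * w ^ (k - 1)\<bar> \<le> real (Suc k) * (1 + w) ^ k"
      using w by (auto simp: abs_mult intro!: mult_mono)
  qed auto
  moreover have "(\<integral>z. 2 * dotp n z z * (k * (dotp n z z) ^ (k - 1)) \<partial>stdg n) = 2 * k * mom n k"
    unfolding mom_def by (cases k) (auto simp: mult_ac)
  moreover have "(\<integral>z. (dotp n z z - n) * (dotp n z z) ^ k \<partial>stdg n) = mom n (Suc k) - n * mom n k"
    using integrable_pow[of n k] integrable_pow[of n "Suc k"] by (simp add: mom_def left_diff_distrib)
  ultimately show ?thesis by (simp add: algebra_simps)
qed

lemma mom_pos: "n \<ge> 1 \<Longrightarrow> mom n k > 0"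
  by (induction k) (auto simp: mom_Suc)

section \<open>Polar decomposition: length and direction of a Gaussian vector\<close>

definition sphmap :: "nat \<Rightarrow> real \<Rightarrow> (nat \<Rightarrow> real) \<Rightarrow> (nat \<Rightarrow> real)" where
  "sphmap n R x = vscale n (R / vnorm n x) x"

lemma measurable_sphmap [measurable]: "sphmap n R \<in> Rn n \<rightarrow>\<^sub>M Rn n"
  unfolding sphmap_def by measurable

lemma vnorm_vscale [simp]: "vnorm n (vscale n c x) = \<bar>c\<bar> * vnorm n x"
  by (simp add: vnorm_dotp real_sqrt_mult mult.assoc[symmetric])

lemma vscale_vscale [simp]: "vscale n a (vscale n b x) = vscale n (a * b) x"
  by (auto simp: vscale_def fun_eq_iff)

lemma sphmap_vscale: "c > 0 \<Longrightarrow> sphmap n R (vscale n c x) = sphmap n R x"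
  by (simp add: sphmap_def)

lemma nn_integral_unit_ball:
  "(\<integral>\<^sup>+x. indicator {..<1} (vnorm n x) \<partial>Lb n) = emeasure (Lb n) {x \<in> space (Rn n). vnorm n x < 1}"
proof -
  let ?B = "{x \<in> space (Rn n). vnorm n x < 1}"
  have "emeasure (Lb n) ?B = (\<integral>\<^sup>+x. indicator ?B x \<partial>Lb n)"
    by (rule nn_integral_indicator[symmetric]) measurable
  also have "\<dots> = (\<integral>\<^sup>+x. indicator {..<1} (vnorm n x) \<partial>Lb n)"
    by (rule nn_integral_cong) (auto simp: indicator_def)
  finally show ?thesis by simp
qed

text \<open>On the unit ball the standard Gaussian density is at least the constant
  \<open>k\<close>, and its total mass is one.\<close>

lemma Lb_ball_finite: "emeasure (Lb n) {x \<in> space (Rn n). vnorm n x < 1} < \<infinity>"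
proof -
  interpret prob_space "stdg n" by (rule prob_space_gauss) simp
  define k where "k = (1 / sqrt (2 * pi)) ^ n * exp (- 1 / 2)"
  have k: "k > 0" by (simp add: k_def)
  let ?B = "{x \<in> space (Rn n). vnorm n x < 1}"
  have "ennreal k * emeasure (Lb n) ?B = (\<integral>\<^sup>+x. ennreal k * indicator ?B x \<partial>Lb n)"
    by (subst nn_integral_cmult) auto
  also have "\<dots> \<le> (\<integral>\<^sup>+x. ennreal (gdens n 1 x) \<partial>Lb n)"
  proof (intro nn_integral_mono)
    fix x
    have "k \<le> gdens n 1 x" if "vnorm n x < 1"
    proof -
      have "(vnorm n x)\<^sup>2 \<le> 1" using that by (simp add: power_le_one)
      then have "exp (- 1 / 2) \<le> exp (- dotp n x x / 2)" by (simp add: vnorm_sq)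
      then show ?thesis by (auto simp: k_def gdens_def intro!: mult_left_mono)
    qed
    then show "ennreal k * indicator ?B x \<le> ennreal (gdens n 1 x)"
      by (auto simp: indicator_def intro!: ennreal_leI)
  qed
  also have "\<dots> = emeasure (stdg n) (space (stdg n))"
    by (subst gauss_density) (auto simp: emeasure_density indicator_def intro!: nn_integral_cong)
  also have "\<dots> = 1" by (rule emeasure_space_1)
  finally have "ennreal k * emeasure (Lb n) ?B \<le> 1" .
  moreover have "ennreal k * \<top> = \<top>"
    using k by (simp add: ennreal_mult_top)
  ultimately have "emeasure (Lb n) ?B \<noteq> \<top>"
    by (metis ennreal_one_less_top not_le)
  then show ?thesis by (simp add: less_top)
qed

text \<open>The substitution \<open>x = t x'\<close> leaves \<open>\<phi>\<close> alone and turns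
  the ball of radius \<open>t\<close> into the unit ball, at the cost of the Jacobian
  \<open>t ^ n\<close>. For \<open>t \<le> 0\<close> the ball is empty; the case occurs because
  half-lines \<open>{..<t}\<close> are tested for every real \<open>t\<close>.\<close>

lemma homogeneous_radial:
  fixes \<phi> :: "(nat \<Rightarrow> real) \<Rightarrow> ennreal"
  assumes [measurable]: "\<phi> \<in> borel_measurable (Rn n)"
    and hom: "\<And>c x. c > 0 \<Longrightarrow> x \<in> space (Rn n) \<Longrightarrow> \<phi> (vscale n c x) = \<phi> x"
  shows "(\<integral>\<^sup>+x. \<phi> x * indicator {..<t} (vnorm n x) \<partial>Lb n)
    = (if t \<le> 0 then 0 else ennreal (t ^ n) * (\<integral>\<^sup>+x. \<phi> x * indicator {..<1} (vnorm n x) \<partial>Lb n))"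
proof (cases "t \<le> 0")
  case True
  then have "(\<integral>\<^sup>+x. \<phi> x * indicator {..<t} (vnorm n x) \<partial>Lb n) = (\<integral>\<^sup>+x. 0 \<partial>Lb n)"
    by (intro nn_integral_cong) (auto simp: indicator_def not_less intro: order_trans)
  then show ?thesis using True by simp
next
  case False
  then have t: "t > 0" by simp
  have vs: "affmap n (\<lambda>_. 0) t = vscale n t"
    by (auto simp: vscale_def affmap_def)
  have "(\<integral>\<^sup>+x. \<phi> x * indicator {..<t} (vnorm n x) \<partial>Lb n)
     = ennreal (t ^ n) * (\<integral>\<^sup>+x. \<phi> (vscale n t x) * indicator {..<t} (vnorm n (vscale n t x)) \<partial>Lb n)"
    using t by (subst nn_integral_Lb_affine[of t _ n "\<lambda>_. 0"]) (auto simp: vs)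
  also have "(\<integral>\<^sup>+x. \<phi> (vscale n t x) * indicator {..<t} (vnorm n (vscale n t x)) \<partial>Lb n)
     = (\<integral>\<^sup>+x. \<phi> x * indicator {..<1} (vnorm n x) \<partial>Lb n)"
    using t hom by (intro nn_integral_cong) (auto simp: indicator_def)
  finally show ?thesis using t by simp
qed

text \<open>If the unit ball were null, then by scaling every ball and hence the whole space would
  be, and the Gaussian measure would vanish.\<close>

lemma Lb_ball_pos: "emeasure (Lb n) {x \<in> space (Rn n). vnorm n x < 1} > 0"
proof (rule ccontr)
  let ?B = "{x \<in> space (Rn n). vnorm n x < 1}"
  interpret prob_space "stdg n" by (rule prob_space_gauss) simp
  assume "\<not> ?thesis"
  then have "emeasure (Lb n) ?B = 0" by simp
  moreover have "(\<integral>\<^sup>+x. 1 * indicator {..<1} (vnorm n x) \<partial>Lb n) = emeasure (Lb n) ?B"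
    by (simp add: nn_integral_unit_ball)
  ultimately have z: "(\<integral>\<^sup>+x. indicator {..<t} (vnorm n x) \<partial>Lb n) = 0" for t
    using homogeneous_radial[of "\<lambda>_. 1" n t] by simp
  have "AE x in Lb n. \<forall>m::nat. \<not> vnorm n x < real m"
    unfolding AE_all_countable
  proof
    fix m :: nat
    have "AE x in Lb n. indicator {..<real m} (vnorm n x) = (0::ennreal)"
      using z[of "real m"] by (subst (asm) nn_integral_0_iff_AE) auto
    then show "AE x in Lb n. \<not> vnorm n x < real m"
      by eventually_elim (auto simp: indicator_def split: if_splits)
  qed
  then have "AE x in Lb n. False"
    by eventually_elim (metis reals_Archimedean2)
  then have "AE x in stdg n. False"
    by (subst gauss_density) (auto simp: AE_density elim: eventually_mono)
  then show False by simp
qed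

text \<open>Radial and angular part are independent: the measures \<open>A \<mapsto> \<integral> \<phi> 1\<^sub>A(\<bar>x\<bar>)\<close> and
  \<open>A \<mapsto> \<integral> 1\<^sub>A(\<bar>x\<bar>)\<close> are proportional on the half-lines \<open>{..<t}\<close>, both scaling like \<open>t\<^sup>n\<close>.\<close>

lemma Lb_radial_proportional:
  fixes \<phi> :: "(nat \<Rightarrow> real) \<Rightarrow> real"
  assumes [measurable]: "\<phi> \<in> borel_measurable (Rn n)"
    and hom: "\<And>c x. c > 0 \<Longrightarrow> x \<in> space (Rn n) \<Longrightarrow> \<phi> (vscale n c x) = \<phi> x"
    and bd: "\<And>x. x \<in> space (Rn n) \<Longrightarrow> 0 \<le> \<phi> x \<and> \<phi> x \<le> C"
  obtains \<kappa> :: real where "\<kappa> \<ge> 0"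
    "(\<integral>\<^sup>+x. ennreal (\<phi> x) * indicator {..<1} (vnorm n x) \<partial>Lb n) = ennreal \<kappa> * emeasure (Lb n) {x \<in> space (Rn n). vnorm n x < 1}"
    "distr (density (Lb n) \<phi>) borel (vnorm n) = density (distr (Lb n) borel (vnorm n)) (\<lambda>_. ennreal \<kappa>)"
proof -
  let ?B = "{x \<in> space (Rn n). vnorm n x < 1}"
  let ?I = "\<integral>\<^sup>+x. ennreal (\<phi> x) * indicator {..<1} (vnorm n x) \<partial>Lb n"
  have vB: "(\<integral>\<^sup>+x. 1 * indicator {..<1} (vnorm n x) \<partial>Lb n) = emeasure (Lb n) ?B"
    by (simp add: nn_integral_unit_ball)
  have "?I \<le> (\<integral>\<^sup>+x. ennreal C * indicator {..<1} (vnorm n x) \<partial>Lb n)"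
    using bd by (intro nn_integral_mono mult_right_mono ennreal_leI) auto
  also have "\<dots> = ennreal C * emeasure (Lb n) ?B"
    using vB by (subst nn_integral_cmult) auto
  also have "\<dots> < \<infinity>"
    using Lb_ball_finite[of n] by (simp add: ennreal_mult_less_top)
  finally have If: "?I < \<infinity>" .
  define \<kappa> where "\<kappa> = enn2real ?I / measure (Lb n) ?B"
  have mB: "emeasure (Lb n) ?B = ennreal (measure (Lb n) ?B)"
    using Lb_ball_finite[of n] by (intro emeasure_eq_ennreal_measure) auto
  then have mpos: "measure (Lb n) ?B > 0"
    using Lb_ball_pos[of n] by simp
  have \<kappa>0: "\<kappa> \<ge> 0" by (simp add: \<kappa>_def)
  have Ik: "?I = ennreal \<kappa> * emeasure (Lb n) ?B"
    using If mpos unfolding mB by (simp add: \<kappa>_def ennreal_mult[symmetric] less_top)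
  have "distr (density (Lb n) \<phi>) borel (vnorm n) = density (distr (Lb n) borel (vnorm n)) (\<lambda>_. ennreal \<kappa>)"
    (is "?M = ?N")
  proof (rule measure_eqI_generator_eq[where E="range lessThan" and \<Omega>=UNIV and A="\<lambda>i. {..<real i}"])
    have E: "emeasure ?M {..<t} = (\<integral>\<^sup>+x. ennreal (\<phi> x) * indicator {..<t} (vnorm n x) \<partial>Lb n)" for t
    proof -
      have "emeasure ?M {..<t} = (\<integral>\<^sup>+x. indicator {..<t} (vnorm n x) \<partial>density (Lb n) \<phi>)"
        by (subst nn_integral_indicator[symmetric], simp) (subst nn_integral_distr, auto)
      then show ?thesis by (simp add: nn_integral_density)
    qed
    have D: "emeasure (distr (Lb n) borel (vnorm n)) {..<t} = (\<integral>\<^sup>+x. indicator {..<t} (vnorm n x) \<partial>Lb n)" for t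
      by (subst nn_integral_indicator[symmetric], simp) (subst nn_integral_distr, auto)
    have E': "emeasure ?N {..<t} = ennreal \<kappa> * (\<integral>\<^sup>+x. 1 * indicator {..<t} (vnorm n x) \<partial>Lb n)" for t
      by (simp add: emeasure_density nn_integral_cmult D)
    show "emeasure ?M X = emeasure ?N X" if XE: "X \<in> range lessThan" for X
    proof -
      obtain t where X: "X = {..<t}" using XE by (rule rangeE)
      show ?thesis
        unfolding X E E' using homogeneous_radial[of "\<lambda>x. ennreal (\<phi> x)" n t] homogeneous_radial[of "\<lambda>x. 1" n t] hom
        by (simp add: Ik vB[simplified] mult_ac)
    qed
    show "emeasure ?M {..<real i} \<noteq> \<infinity>" for i
      unfolding E using homogeneous_radial[of "\<lambda>x. ennreal (\<phi> x)" n "real i"] hom If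
      by (auto simp: ennreal_mult_eq_top_iff)
    show "Int_stable (range lessThan :: real set set)"
      unfolding Int_stable_def
    proof (intro ballI)
      fix a b :: "real set" assume "a \<in> range lessThan" "b \<in> range lessThan"
      then obtain s t where "a = {..<s}" "b = {..<t}" by (metis rangeE)
      then have "a \<inter> b = lessThan (min s t)" by auto
      then show "a \<inter> b \<in> range lessThan" by blast
    qed
    show "sets ?M = sigma_sets UNIV (range lessThan)" "sets ?N = sigma_sets UNIV (range lessThan)"
      by (simp_all add: borel_Iio)
    show "(\<Union>i. {..<real i}) = UNIV"
      using reals_Archimedean2 by auto
  qed auto
  with that[OF \<kappa>0 Ik] show ?thesis by blast
qed

text \<open>The Gaussian density is a function of the norm, so the proportionality carries over from
  Lebesgue measure; \<open>F = 1\<close> identifies the factor as the Gaussian mean of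
  \<open>\<phi>\<close>. The second claim is the independence of direction and length.\<close>

lemma stdg_radial_proportional:
  fixes \<phi> :: "(nat \<Rightarrow> real) \<Rightarrow> real"
  assumes [measurable]: "\<phi> \<in> borel_measurable (Rn n)"
    and hom: "\<And>c x. c > 0 \<Longrightarrow> x \<in> space (Rn n) \<Longrightarrow> \<phi> (vscale n c x) = \<phi> x"
    and bd: "\<And>x. x \<in> space (Rn n) \<Longrightarrow> 0 \<le> \<phi> x \<and> \<phi> x \<le> C"
  shows "(\<integral>\<^sup>+x. ennreal (\<phi> x) * indicator {..<1} (vnorm n x) \<partial>Lb n)
      = ennreal (\<integral>z. \<phi> z \<partial>stdg n) * emeasure (Lb n) {x \<in> space (Rn n). vnorm n x < 1}"
    and "\<And>F :: real \<Rightarrow> real. F \<in> borel_measurable borel \<Longrightarrow>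
      (\<integral>z. \<phi> z * F (vnorm n z) \<partial>stdg n) = (\<integral>z. \<phi> z \<partial>stdg n) * (\<integral>z. F (vnorm n z) \<partial>stdg n)"
proof -
  interpret prob_space "stdg n" by (rule prob_space_gauss) simp
  obtain \<kappa> :: real where \<kappa>: "\<kappa> \<ge> 0"
    and ball: "(\<integral>\<^sup>+x. ennreal (\<phi> x) * indicator {..<1} (vnorm n x) \<partial>Lb n) = ennreal \<kappa> * emeasure (Lb n) {x \<in> space (Rn n). vnorm n x < 1}"
    and eq: "distr (density (Lb n) \<phi>) borel (vnorm n) = density (distr (Lb n) borel (vnorm n)) (\<lambda>_. ennreal \<kappa>)"
    using Lb_radial_proportional[OF assms] by blast
  have main: "(\<integral>z. \<phi> z * F (vnorm n z) \<partial>stdg n) = \<kappa> * (\<integral>z. F (vnorm n z) \<partial>stdg n)"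
    if [measurable]: "F \<in> borel_measurable borel" for F :: "real \<Rightarrow> real"
  proof -
    define G where "G t = (1 / sqrt (2 * pi)) ^ n * exp (- t\<^sup>2 / 2) * F t" for t
    have [measurable]: "G \<in> borel_measurable borel" unfolding G_def by measurable
    have G: "gdens n 1 z * F (vnorm n z) = G (vnorm n z)" for z
      by (simp add: G_def gdens_def vnorm_sq)
    have "(\<integral>z. \<phi> z * F (vnorm n z) \<partial>stdg n) = (\<integral>z. \<phi> z * G (vnorm n z) \<partial>Lb n)"
      by (subst gauss_density) (simp_all add: integral_density G[symmetric] mult_ac)
    also have "\<dots> = (\<integral>t. G t \<partial>distr (density (Lb n) \<phi>) borel (vnorm n))"
      using bd by (subst integral_distr, simp, simp, subst integral_density) auto
    also have "\<dots> = \<kappa> * (\<integral>z. G (vnorm n z) \<partial>Lb n)"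
      unfolding eq using \<kappa> by (simp add: integral_density integral_distr)
    also have "(\<integral>z. G (vnorm n z) \<partial>Lb n) = (\<integral>z. F (vnorm n z) \<partial>stdg n)"
      by (subst gauss_density) (simp_all add: integral_density G[symmetric])
    finally show ?thesis .
  qed
  have k: "(\<integral>z. \<phi> z \<partial>stdg n) = \<kappa>"
    using main[of "\<lambda>_. 1"] prob_space by simp
  show "(\<integral>\<^sup>+x. ennreal (\<phi> x) * indicator {..<1} (vnorm n x) \<partial>Lb n)
      = ennreal (\<integral>z. \<phi> z \<partial>stdg n) * emeasure (Lb n) {x \<in> space (Rn n). vnorm n x < 1}"
    unfolding k by (rule ball)
  show "\<And>F :: real \<Rightarrow> real. F \<in> borel_measurable borel \<Longrightarrow>
      (\<integral>z. \<phi> z * F (vnorm n z) \<partial>stdg n) = (\<integral>z. \<phi> z \<partial>stdg n) * (\<integral>z. F (vnorm n z) \<partial>stdg n)"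
    unfolding k by (rule main)
qed

text \<open>Whether the projected point lies in \<open>A\<close> does not change under scaling, so
  this event has the same probability under the uniform law of the ball and under the Gaussian.
  Sphere averages thereby become Gaussian integrals.\<close>

lemma sphere_unif_eq_distr: "sphere_unif n R = distr (stdg n) (Rn n) (sphmap n R)"
proof (rule measure_eqI)
  let ?B = "{x \<in> space (Rn n). vnorm n x < 1}"
  fix A assume "A \<in> sets (sphere_unif n R)"
  then have A [measurable]: "A \<in> sets (Rn n)" by (simp add: sphere_unif_def)
  define \<phi> :: "(nat \<Rightarrow> real) \<Rightarrow> real" where "\<phi> x = indicator A (sphmap n R x)" for x
  have [measurable]: "\<phi> \<in> borel_measurable (Rn n)" unfolding \<phi>_def by measurable
  have B [measurable]: "?B \<in> sets (Rn n)" by measurable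
  have "emeasure (sphere_unif n R) A = emeasure (uniform_measure (Lb n) ?B) (sphmap n R -` A \<inter> space (Rn n))"
    unfolding sphere_unif_def by (subst emeasure_distr) (auto simp: sphmap_def[abs_def])
  also have "\<dots> = emeasure (Lb n) (?B \<inter> (sphmap n R -` A \<inter> space (Rn n))) / emeasure (Lb n) ?B"
    using measurable_sets[OF measurable_sphmap A] by (intro emeasure_uniform_measure) auto
  also have "emeasure (Lb n) (?B \<inter> (sphmap n R -` A \<inter> space (Rn n))) = (\<integral>\<^sup>+x. indicator (?B \<inter> (sphmap n R -` A \<inter> space (Rn n))) x \<partial>Lb n)"
    using measurable_sets[OF measurable_sphmap A] by (intro nn_integral_indicator[symmetric]) auto
  also have "\<dots> = (\<integral>\<^sup>+x. ennreal (\<phi> x) * indicator {..<1} (vnorm n x) \<partial>Lb n)"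
    by (intro nn_integral_cong) (auto simp: indicator_def \<phi>_def)
  also have "\<dots> = ennreal (\<integral>z. \<phi> z \<partial>stdg n) * emeasure (Lb n) ?B"
    by (rule stdg_radial_proportional[where C=1]) (auto simp: \<phi>_def sphmap_vscale)
  also have "\<dots> / emeasure (Lb n) ?B = ennreal (\<integral>z. \<phi> z \<partial>stdg n)"
    using Lb_ball_pos[of n] Lb_ball_finite[of n] by (simp add: ennreal_mult_divide_eq)
  also have "\<dots> = (\<integral>\<^sup>+z. ennreal (\<phi> z) \<partial>stdg n)"
    by (intro nn_integral_eq_integral[symmetric] integrable_stdg_bound[where C=1 and k=0 and \<rho>=0])
       (auto simp: \<phi>_def indicator_def)
  also have "\<dots> = (\<integral>\<^sup>+z. indicator A (sphmap n R z) \<partial>stdg n)"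
    by (intro nn_integral_cong) (auto simp: indicator_def \<phi>_def)
  also have "\<dots> = emeasure (distr (stdg n) (Rn n) (sphmap n R)) A"
    by (subst nn_integral_indicator[symmetric], simp) (subst nn_integral_distr, auto)
  finally show "emeasure (sphere_unif n R) A = emeasure (distr (stdg n) (Rn n) (sphmap n R)) A" .
qed (simp add: sphere_unif_def)

section \<open>The squared Bessel quotient\<close>

lemma mom_ge_1: "n \<ge> 1 \<Longrightarrow> mom n k \<ge> 1"
proof (induction k)
  case (Suc k)
  then have "1 * 1 \<le> real (n + 2 * k) * mom n k" by (intro mult_mono) auto
  then show ?case by (simp add: mom_Suc)
qed simp

text \<open>Coefficients of the hypergeometric series 0F1 with parameter \<open>n / 2\<close> at
  \<open>t / 4\<close>: \<open>mom n k\<close> is \<open>2 ^ k\<close> times the rising factorial of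
  \<open>n / 2\<close>.\<close>

definition bco :: "nat \<Rightarrow> nat \<Rightarrow> real" where
  "bco n k = 1 / (2 ^ k * fact k * mom n k)"

text \<open>As a function of \<open>t = \<bar>y\<bar>\<^sup>2\<close>, \<open>Bs n t\<close> is the moment generating function at \<open>y\<close> of a uniform point of
  the unit sphere. The Bessel quotient is \<open>bessel_h (n / 2) x = x * qf n (x\<^sup>2)\<close>, with derivative
  \<open>df n (x\<^sup>2)\<close> and square \<open>Hf n (x\<^sup>2)\<close>.\<close>

definition Bs :: "nat \<Rightarrow> real \<Rightarrow> real" where "Bs n t = (\<Sum>k. bco n k * t ^ k)"
definition Bs1 :: "nat \<Rightarrow> real \<Rightarrow> real" where "Bs1 n t = (\<Sum>k. diffs (bco n) k * t ^ k)"
definition Bs2 :: "nat \<Rightarrow> real \<Rightarrow> real" where "Bs2 n t = (\<Sum>k. diffs (diffs (bco n)) k * t ^ k)"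

definition qf :: "nat \<Rightarrow> real \<Rightarrow> real" where "qf n t = 2 * Bs1 n t / Bs n t"
definition qd :: "nat \<Rightarrow> real \<Rightarrow> real" where "qd n t = 2 * Bs2 n t / Bs n t - (qf n t)\<^sup>2 / 2"
definition df :: "nat \<Rightarrow> real \<Rightarrow> real" where "df n t = 1 - (real n - 1) * qf n t - t * (qf n t)\<^sup>2"
definition pf :: "nat \<Rightarrow> real \<Rightarrow> real" where "pf n t = t * qf n t"
definition Hf :: "nat \<Rightarrow> real \<Rightarrow> real" where "Hf n t = t * (qf n t)\<^sup>2"

lemma times_half_inverse: "(x::real) / (2 * t) = x * inverse (2 * t)"
  by (rule divide_inverse)

text \<open>A comparison principle for \<open>e' = S - c e\<close>: to the right of the last point
  where \<open>e\<close> is nonnegative, \<open>e\<close> would be negative with nonnegative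
  derivative. No integrating factor appears, because the coefficients \<open>c\<close> in the
  applications may blow up like \<open>1 / t\<close> at \<open>0\<close>.\<close>

lemma nonneg_comparison:
  fixes e S c :: "real \<Rightarrow> real"
  assumes cont: "continuous_on {0..} e" and e0: "e 0 \<ge> 0"
    and D: "\<And>t. t > 0 \<Longrightarrow> (e has_real_derivative S t - c t * e t) (at t)"
    and S: "\<And>t. t > 0 \<Longrightarrow> S t \<ge> 0" and c: "\<And>t. t > 0 \<Longrightarrow> c t \<ge> 0"
    and t: "t \<ge> 0"
  shows "e t \<ge> 0"
proof (rule ccontr)
  assume neg: "\<not> e t \<ge> 0"
  define A where "A = {u \<in> {0..t}. e u \<ge> 0}"
  have c0t: "continuous_on {0..t} e" by (rule continuous_on_subset[OF cont]) auto
  have "closed A"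
    using continuous_closed_preimage[OF c0t, of "{0..}"] by (simp add: A_def vimage_def Int_def)
  moreover have "A \<noteq> {}" using e0 t by (auto simp: A_def)
  moreover have bdd: "bdd_above A" by (auto simp: A_def)
  ultimately have s: "Sup A \<in> A" by (rule closed_contains_Sup[rotated 2])
  define s where "s = Sup A"
  have s': "0 \<le> s" "s \<le> t" "e s \<ge> 0" using s by (auto simp: A_def s_def)
  then have st: "s < t" using neg by (cases "s = t") auto
  obtain z where z: "s < z" "z < t" "e t - e s = (t - s) * (S z - c z * e z)"
  proof -
    have "\<exists>l z. s < z \<and> z < t \<and> (e has_real_derivative l) (at z) \<and> e t - e s = (t - s) * l"
    proof (rule MVT[OF st])
      show "continuous_on {s..t} e" by (rule continuous_on_subset[OF c0t]) (use s' in auto)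
      fix x assume "s < x" "x < t"
      then show "e differentiable (at x)" using D[of x] s' by (auto simp: real_differentiable_def)
    qed
    then obtain l z where z: "s < z" "z < t" "(e has_real_derivative l) (at z)" "e t - e s = (t - s) * l" by blast
    then have "l = S z - c z * e z" using D[of z] s' by (intro DERIV_unique) auto
    then show thesis using z that by blast
  qed
  have "e z < 0"
  proof (rule ccontr)
    assume "\<not> e z < 0"
    then have "z \<in> A" using z s' by (auto simp: A_def)
    then have "z \<le> s" unfolding s_def using bdd by (rule cSup_upper)
    then show False using z by simp
  qed
  then have "c z * e z \<le> 0" using c[of z] z s' by (simp add: mult_nonneg_nonpos)
  then have "(t - s) * (S z - c z * e z) \<ge> 0" using S[of z] z s' by (intro mult_nonneg_nonneg) auto
  then show False using z s' neg by simp
qed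

context
  fixes n :: nat assumes n: "n \<ge> 1"
begin

section \<open>The power series, its linear equation and the Riccati equation of the
  quotient\<close>

lemma bco_pos: "bco n k > 0"
  using mom_pos[OF n] by (simp add: bco_def)

lemma bco_0 [simp]: "bco n 0 = 1"
  by (simp add: bco_def)

lemma bco_Suc: "2 * (real k + 1) * (n + 2 * k) * bco n (Suc k) = bco n k"
  using mom_pos[OF n, of k] n by (simp add: bco_def mom_Suc divide_simps)

lemma summable_bco: "summable (\<lambda>k. bco n k * t ^ k)"
proof (rule summable_comparison_test')
  show "summable (\<lambda>k. inverse (fact k) * \<bar>t\<bar> ^ k)" by (rule summable_exp)
  fix k
  have "fact k * 1 \<le> (2 ^ k * mom n k) * fact k"
    using mult_mono[of 1 "2 ^ k" 1 "mom n k"] mom_ge_1[OF n, of k] by simp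
  then have "bco n k \<le> inverse (fact k)"
    using mom_pos[OF n, of k] by (simp add: bco_def divide_simps mult_ac)
  then have "bco n k * \<bar>t\<bar> ^ k \<le> inverse (fact k) * \<bar>t\<bar> ^ k" by (rule mult_right_mono) simp
  then show "norm (bco n k * t ^ k) \<le> inverse (fact k) * \<bar>t\<bar> ^ k"
    using bco_pos[of k] by (simp add: abs_mult power_abs)
qed

lemma summable_bco1: "summable (\<lambda>k. diffs (bco n) k * t ^ k)"
  by (rule termdiff_converges_all[OF summable_bco])

lemma summable_bco2: "summable (\<lambda>k. diffs (diffs (bco n)) k * t ^ k)"
  by (rule termdiff_converges_all[OF summable_bco1])

lemma DERIV_Bs: "(Bs n has_real_derivative Bs1 n t) (at t)"
  unfolding Bs_def[abs_def] Bs1_def by (rule termdiffs_strong_converges_everywhere[OF summable_bco])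

lemma DERIV_Bs1: "(Bs1 n has_real_derivative Bs2 n t) (at t)"
  unfolding Bs1_def[abs_def] Bs2_def by (rule termdiffs_strong_converges_everywhere[OF summable_bco1])

text \<open>The modified Bessel equation in the variable \<open>t = x^2\<close>, read off from the
  recursion \<open>bco_Suc\<close>.\<close>

lemma Bs_ode: "4 * t * Bs2 n t + 2 * n * Bs1 n t = Bs n t"
proof -
  have s1: "(\<lambda>k. diffs (bco n) k * t ^ k) sums Bs1 n t"
    unfolding Bs1_def by (rule summable_sums[OF summable_bco1])
  have "(\<lambda>k. diffs (diffs (bco n)) k * t ^ k) sums Bs2 n t"
    unfolding Bs2_def by (rule summable_sums[OF summable_bco2])
  then have "(\<lambda>k. t * (diffs (diffs (bco n)) k * t ^ k)) sums (t * Bs2 n t)"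
    by (rule sums_mult)
  moreover have "(\<lambda>k. t * (diffs (diffs (bco n)) k * t ^ k)) = (\<lambda>k. real (Suc k) * diffs (bco n) (Suc k) * t ^ Suc k)"
    by (simp add: diffs_def fun_eq_iff)
  ultimately have "(\<lambda>k. real (Suc k) * diffs (bco n) (Suc k) * t ^ Suc k) sums (t * Bs2 n t)" by simp
  then have s2: "(\<lambda>k. real k * diffs (bco n) k * t ^ k) sums (t * Bs2 n t)"
    by (subst (asm) sums_Suc_iff) simp
  have "(\<lambda>k. 4 * (real k * diffs (bco n) k * t ^ k) + 2 * n * (diffs (bco n) k * t ^ k)) sums (4 * (t * Bs2 n t) + 2 * n * Bs1 n t)"
    by (intro sums_add sums_mult s1 s2)
  moreover have "4 * (real k * diffs (bco n) k * t ^ k) + 2 * n * (diffs (bco n) k * t ^ k) = bco n k * t ^ k" for k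
    unfolding bco_Suc[of k, symmetric] by (simp add: diffs_def algebra_simps)
  ultimately have "(\<lambda>k. bco n k * t ^ k) sums (4 * (t * Bs2 n t) + 2 * n * Bs1 n t)" by simp
  then show ?thesis by (simp add: Bs_def sums_iff mult.assoc)
qed

lemma Bs_ge_1: "t \<ge> 0 \<Longrightarrow> Bs n t \<ge> 1"
  using sum_le_suminf[OF summable_bco, of "{0}" t] bco_pos by (simp add: Bs_def less_imp_le)

lemma Bs_0 [simp]: "Bs n 0 = 1"
  by (simp add: Bs_def)

lemma Bs1_pos: "t \<ge> 0 \<Longrightarrow> Bs1 n t > 0"
  using sum_le_suminf[OF summable_bco1, of "{0}" t] bco_pos
  by (simp add: Bs1_def diffs_def less_imp_le) (metis less_le_trans)

lemma qf_pos: "t \<ge> 0 \<Longrightarrow> qf n t > 0"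
  using Bs1_pos[of t] Bs_ge_1[of t] by (simp add: qf_def)

lemma qf_0: "qf n 0 = 1 / n"
proof -
  have "Bs1 n 0 = diffs (bco n) 0" unfolding Bs1_def by (rule powser_zero)
  then show ?thesis using bco_Suc[of 0] n by (simp add: qf_def diffs_def field_simps)
qed

lemma DERIV_qf: assumes "t \<ge> 0" shows "(qf n has_real_derivative qd n t) (at t)"
proof -
  have B: "Bs n t \<noteq> 0" using Bs_ge_1[OF assms] by auto
  show ?thesis unfolding qf_def[abs_def] qd_def
    by (rule derivative_eq_intros DERIV_Bs DERIV_Bs1 B refl)+
       (use B in \<open>simp add: qf_def field_simps power2_eq_square\<close>)
qed

text \<open>The Riccati equation \<open>2 t q' = 1 - n q - t q^2\<close>, written through
  \<open>df\<close>. The factor \<open>t\<close> stays on the left so that the equation also holds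
  at \<open>t = 0\<close>.\<close>

lemma qd_eq: assumes "t \<ge> 0" shows "2 * t * qd n t = df n t - qf n t"
proof -
  have B: "Bs n t \<noteq> 0" using Bs_ge_1[OF assms] by auto
  have "2 * t * qd n t = 4 * t * Bs2 n t / Bs n t - t * (qf n t)\<^sup>2"
    by (simp add: qd_def algebra_simps)
  also have "4 * t * Bs2 n t / Bs n t = 1 - n * qf n t"
  proof -
    have "4 * t * Bs2 n t = Bs n t - 2 * n * Bs1 n t" using Bs_ode[of t] by simp
    then show ?thesis using B by (simp add: qf_def diff_divide_distrib)
  qed
  finally show ?thesis by (simp add: df_def algebra_simps)
qed

lemma cont_qf: "continuous_on {0..} (qf n)"
  by (rule DERIV_continuous_on[OF DERIV_subset[OF DERIV_qf]]) auto

lemma cont_df: "continuous_on {0..} (df n)"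
  unfolding df_def by (intro continuous_intros cont_qf)

lemma DERIV_df: assumes t: "t > 0"
  shows "(df n has_real_derivative (real n - 1) * (qf n t - df n t) / (2 * t) - qf n t * df n t) (at t)"
proof -
  have q: "qd n t = (df n t - qf n t) / (2 * t)" using qd_eq[of t] t by (simp add: field_simps)
  have "((\<lambda>t. 1 - (real n - 1) * qf n t - t * (qf n t)\<^sup>2) has_real_derivative
      - ((real n - 1) * qd n t) - ((qf n t)\<^sup>2 + t * (2 * qf n t * qd n t))) (at t)"
    using t by (auto intro!: derivative_eq_intros DERIV_qf)
  moreover have "- ((real n - 1) * qd n t) - ((qf n t)\<^sup>2 + t * (2 * qf n t * qd n t))
     = (real n - 1) * (qf n t - df n t) / (2 * t) - qf n t * df n t"
  proof -
    have "t * (2 * qf n t * qd n t) = qf n t * (2 * t * qd n t)" by simp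
    also have "\<dots> = qf n t * (df n t - qf n t)" using qd_eq[of t] t by simp
    finally show ?thesis unfolding q times_half_inverse by (simp add: power2_eq_square algebra_simps del: inverse_mult_distrib)
  qed
  ultimately show ?thesis by (simp add: df_def[abs_def])
qed

lemma df_0: "df n 0 = 1 / n"
  using n by (simp add: df_def qf_0 field_simps)

text \<open>In \<open>df' = (n - 1) (qf - df) / (2 t) - qf df\<close> the part free of
  \<open>df\<close> and the coefficient of \<open>- df\<close> are both nonnegative, so the
  comparison principle applies. It says that the Bessel quotient is nondecreasing.\<close>

lemma df_nonneg: "t \<ge> 0 \<Longrightarrow> df n t \<ge> 0"
proof (rule nonneg_comparison[where e="df n" and S="\<lambda>t. (real n - 1) * qf n t / (2 * t)" and c="\<lambda>t. (real n - 1) / (2 * t) + qf n t"])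
  fix t :: real assume t: "t > 0"
  have "(real n - 1) * (qf n t - df n t) / (2 * t) - qf n t * df n t
      = (real n - 1) * qf n t / (2 * t) - ((real n - 1) / (2 * t) + qf n t) * df n t"
    unfolding times_half_inverse by (simp add: algebra_simps del: inverse_mult_distrib)
  then show "(df n has_real_derivative (real n - 1) * qf n t / (2 * t) - ((real n - 1) / (2 * t) + qf n t) * df n t) (at t)"
    using DERIV_df[OF t] by simp
  show "(real n - 1) * qf n t / (2 * t) \<ge> 0" "(real n - 1) / (2 * t) + qf n t \<ge> 0"
    using t n qf_pos[of t] by (auto intro!: divide_nonneg_pos mult_nonneg_nonneg add_nonneg_nonneg)
qed (use cont_df df_0 in auto)

text \<open>This is the decrease of \<open>h x / x\<close>, because
  \<open>2 t qf' = df - qf\<close>. The gap \<open>qf - df\<close> obeys a linear equation with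
  source \<open>qf df\<close> and starts at \<open>0\<close>.\<close>

lemma df_le_qf: "t \<ge> 0 \<Longrightarrow> df n t \<le> qf n t"
proof -
  assume t: "t \<ge> 0"
  have "qf n t - df n t \<ge> 0"
  proof (rule nonneg_comparison[where e="\<lambda>t. qf n t - df n t" and S="\<lambda>t. qf n t * df n t" and c="\<lambda>t. n / (2 * t)"])
    fix t :: real assume t: "t > 0"
    have "qd n t = (df n t - qf n t) / (2 * t)" using qd_eq[of t] t by (simp add: field_simps)
    then have eq: "qd n t - ((real n - 1) * (qf n t - df n t) / (2 * t) - qf n t * df n t)
        = qf n t * df n t - n / (2 * t) * (qf n t - df n t)"
      unfolding times_half_inverse by (simp add: algebra_simps del: inverse_mult_distrib)
    show "((\<lambda>t. qf n t - df n t) has_real_derivative qf n t * df n t - n / (2 * t) * (qf n t - df n t)) (at t)"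
      using DERIV_cong[OF DERIV_diff[OF DERIV_qf[of t] DERIV_df[OF t]] eq] t by simp
    show "qf n t * df n t \<ge> 0" using qf_pos[of t] df_nonneg[of t] t by simp
  qed (use t in \<open>auto simp: qf_0 df_0 intro!: continuous_intros cont_qf cont_df\<close>)
  then show ?thesis by simp
qed

text \<open>For \<open>t > 0\<close> the expression equals \<open>- 2 t df'\<close>, so this is the
  monotonicity of \<open>df\<close> in a form regular at \<open>0\<close>. Its own derivative is
  again a nonnegative source minus a nonnegative multiple of the expression.\<close>

lemma df_decreasing_aux:
  assumes "t \<ge> 0" shows "2 * t * qf n t * df n t - (real n - 1) * (qf n t - df n t) \<ge> 0"
proof (rule nonneg_comparison[where e="\<lambda>t. 2 * t * qf n t * df n t - (real n - 1) * (qf n t - df n t)" and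
    S="\<lambda>t. qf n t * df n t + (df n t)\<^sup>2 + (real n - 1) * (qf n t - df n t) / (2 * t)" and
    c="\<lambda>t. qf n t + (real n - 1) / (2 * t)"])
  fix t :: real assume t: "t > 0"
  define q d d' e where "q = qf n t" "d = df n t" "d' = (real n - 1) * (q - d) / (2 * t) - q * d"
    "e = 2 * t * q * d - (real n - 1) * (q - d)"
  note defs = this
  have q': "qd n t = (d - q) / (2 * t)" using qd_eq[of t] t by (simp add: field_simps defs)
  have Dd: "(df n has_real_derivative d') (at t)" using DERIV_df[OF t] by (simp only: defs)
  have D: "((\<lambda>t. 2 * t * qf n t * df n t - (real n - 1) * (qf n t - df n t)) has_real_derivative
     2 * q * d + 2 * t * qd n t * d + 2 * t * q * d' - (real n - 1) * (qd n t - d')) (at t)"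
    using t by (auto intro!: derivative_eq_intros DERIV_qf Dd simp: defs(1,2) algebra_simps)
  have d': "2 * t * d' = - e" using t by (simp add: defs field_simps)
  have qq: "2 * t * qd n t = d - q" using t by (simp add: q')
  have dd: "qd n t - d' = (d - q) / (2 * t) + e / (2 * t)" using d' t by (simp add: q' field_simps)
  have "2 * q * d + 2 * t * qd n t * d + 2 * t * q * d' - (real n - 1) * (qd n t - d')
     = 2 * q * d + (2 * t * qd n t) * d + q * (2 * t * d') - (real n - 1) * (qd n t - d')"
    by simp
  also have "\<dots> = q * d + d\<^sup>2 + (real n - 1) * (q - d) / (2 * t) - (q + (real n - 1) / (2 * t)) * e"
    unfolding qq d' dd times_half_inverse by (simp add: algebra_simps power2_eq_square del: inverse_mult_distrib)
  finally have eq: "2 * q * d + 2 * t * qd n t * d + 2 * t * q * d' - (real n - 1) * (qd n t - d')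
     = q * d + d\<^sup>2 + (real n - 1) * (q - d) / (2 * t) - (q + (real n - 1) / (2 * t)) * e" .
  show "((\<lambda>t. 2 * t * qf n t * df n t - (real n - 1) * (qf n t - df n t)) has_real_derivative
    qf n t * df n t + (df n t)\<^sup>2 + (real n - 1) * (qf n t - df n t) / (2 * t) - (qf n t + (real n - 1) / (2 * t)) *
    (2 * t * qf n t * df n t - (real n - 1) * (qf n t - df n t))) (at t)"
    using DERIV_cong[OF D eq] unfolding defs .
  show "qf n t * df n t + (df n t)\<^sup>2 + (real n - 1) * (qf n t - df n t) / (2 * t) \<ge> 0"
    "qf n t + (real n - 1) / (2 * t) \<ge> 0"
    using t n qf_pos[of t] df_nonneg[of t] df_le_qf[of t]
    by (auto intro!: divide_nonneg_pos mult_nonneg_nonneg add_nonneg_nonneg)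
qed (use assms in \<open>auto simp: qf_0 df_0 intro!: continuous_intros cont_qf cont_df\<close>)

text \<open>For \<open>n \<ge> 2\<close> the preceding inequality bounds a positive multiple of
  \<open>df\<close> from below by \<open>(n - 1) qf\<close>. For \<open>n = 1\<close> that lower
  bound is zero; there the quotient is tanh, and \<open>df * Bs^2\<close> is constant because sech
  and cosh are reciprocal.\<close>

lemma df_pos: assumes t: "t \<ge> 0" shows "df n t > 0"
proof (cases "n = 1")
  case False
  then have n2: "real n - 1 > 0" using n by simp
  have "df n t * (2 * t * qf n t + (real n - 1)) \<ge> (real n - 1) * qf n t"
    using df_decreasing_aux[OF t] by (simp add: algebra_simps)
  moreover have "(real n - 1) * qf n t > 0" using n2 qf_pos[OF t] by simp
  ultimately have "df n t * (2 * t * qf n t + (real n - 1)) > 0" by simp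
  then show ?thesis using df_nonneg[OF t] by (cases "df n t = 0") auto
next
  case True
  have "df n t * (Bs n t)\<^sup>2 = df n 0 * (Bs n 0)\<^sup>2"
  proof (cases "t = 0")
    case False
    then have t0: "t > 0" using t by simp
    show ?thesis
    proof (rule DERIV_isconst2[OF t0])
      show "continuous_on {0..t} (\<lambda>t. df n t * (Bs n t)\<^sup>2)"
        by (intro continuous_intros continuous_on_subset[OF cont_df] DERIV_continuous_on[OF DERIV_subset[OF DERIV_Bs]]) auto
      fix x :: real assume x: "0 < x" "x < t"
      have B: "Bs n x \<noteq> 0" using Bs_ge_1[of x] x by auto
      show "((\<lambda>t. df n t * (Bs n t)\<^sup>2) has_real_derivative 0) (at x)"
        by (rule derivative_eq_intros DERIV_df DERIV_Bs x refl)+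
           (use B in \<open>simp add: True qf_def field_simps power2_eq_square\<close>)
    qed (use t0 in auto)
  qed simp
  then have "df n t * (Bs n t)\<^sup>2 = 1" using df_0 Bs_0 by (simp add: True)
  then show ?thesis using df_nonneg[OF t] by (cases "df n t = 0") auto
qed

lemma qf_antimono: "0 \<le> s \<Longrightarrow> s \<le> t \<Longrightarrow> qf n t \<le> qf n s"
proof (cases "s = t")
  case False
  assume s: "0 \<le> s" "s \<le> t"
  show ?thesis
  proof (rule DERIV_nonpos_imp_decreasing_open[of s t])
    fix x assume x: "s < x" "x < t"
    have "2 * x * qd n x \<le> 0" using qd_eq[of x] df_le_qf[of x] x s by simp
    then have "qd n x \<le> 0" using x s by (simp add: mult_le_0_iff)
    then show "\<exists>y. (qf n has_real_derivative y) (at x) \<and> y \<le> 0" using DERIV_qf[of x] x s by auto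
  qed (use s in \<open>auto intro: continuous_on_subset[OF cont_qf]\<close>)
qed simp

lemma df_antimono: "0 \<le> s \<Longrightarrow> s \<le> t \<Longrightarrow> df n t \<le> df n s"
proof (cases "s = t")
  case False
  assume s: "0 \<le> s" "s \<le> t"
  show ?thesis
  proof (rule DERIV_nonpos_imp_decreasing_open[of s t])
    fix x assume x: "s < x" "x < t"
    then have "(real n - 1) * (qf n x - df n x) / (2 * x) - qf n x * df n x \<le> 0"
      using df_decreasing_aux[of x] s by (simp add: field_simps)
    then show "\<exists>y. (df n has_real_derivative y) (at x) \<and> y \<le> 0" using DERIV_df[of x] x s by auto
  qed (use s in \<open>auto intro: continuous_on_subset[OF cont_df]\<close>)
qed simp

lemma DERIV_pf: assumes "t \<ge> 0" shows "(pf n has_real_derivative (qf n t + df n t) / 2) (at t)"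
proof -
  have "((\<lambda>t. t * qf n t) has_real_derivative qf n t + t * qd n t) (at t)"
    using assms by (auto intro!: derivative_eq_intros DERIV_qf)
  moreover have "qf n t + t * qd n t = (qf n t + df n t) / 2" using qd_eq[OF assms] by simp
  ultimately show ?thesis by (simp add: pf_def[abs_def])
qed

lemma DERIV_Hf: assumes "t \<ge> 0" shows "(Hf n has_real_derivative qf n t * df n t) (at t)"
proof -
  have "((\<lambda>t. t * (qf n t)\<^sup>2) has_real_derivative (qf n t)\<^sup>2 + qf n t * (2 * t * qd n t)) (at t)"
    using assms by (auto intro!: derivative_eq_intros DERIV_qf)
  then show ?thesis unfolding qd_eq[OF assms] by (simp add: Hf_def[abs_def] power2_eq_square algebra_simps)
qed

lemma convex_pf: "convex_on {0..} (\<lambda>t. - pf n t)"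
proof (rule convex_on_realI[where f'="\<lambda>t. - ((qf n t + df n t) / 2)"])
  fix x y :: real assume "x \<in> {0..}" "y \<in> {0..}" "x \<le> y"
  then show "- ((qf n x + df n x) / 2) \<le> - ((qf n y + df n y) / 2)"
    using qf_antimono[of x y] df_antimono[of x y] by simp
qed (auto intro!: derivative_eq_intros DERIV_pf)

text \<open>The derivative \<open>qf * df\<close> of \<open>Hf\<close> is a product of nonnegative
  decreasing functions, hence decreasing; so the squared Bessel quotient is concave in
  \<open>t\<close>.\<close>

lemma convex_Hf: "convex_on {0..} (\<lambda>t. - Hf n t)"
proof (rule convex_on_realI[where f'="\<lambda>t. - (qf n t * df n t)"])
  fix x y :: real assume "x \<in> {0..}" "y \<in> {0..}" "x \<le> y"
  then show "- (qf n x * df n x) \<le> - (qf n y * df n y)"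
    using qf_antimono[of x y] df_antimono[of x y] df_nonneg[of y] qf_pos[of x] by (simp add: mult_mono)
qed (auto intro!: derivative_eq_intros DERIV_Hf)

lemma Hf_strict_mono: assumes "0 \<le> s" "s < t" shows "Hf n s < Hf n t"
  using assms(2)
proof (rule DERIV_pos_imp_increasing)
  fix x assume "s \<le> x" "x \<le> t"
  then show "\<exists>y. (Hf n has_real_derivative y) (at x) \<and> 0 < y"
    using DERIV_Hf[of x] qf_pos[of x] df_pos[of x] assms by auto
qed

lemma Hf_eq: "Hf n t = 1 - (real n - 1) * qf n t - df n t"
  by (simp add: Hf_def df_def)

lemma Hf_nonneg: "t \<ge> 0 \<Longrightarrow> Hf n t \<ge> 0"
  by (simp add: Hf_def)

lemma Hf_le_1: "t \<ge> 0 \<Longrightarrow> Hf n t \<le> 1"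
proof -
  assume t: "t \<ge> 0"
  have "(real n - 1) * qf n t \<ge> 0" using qf_pos[OF t] n by simp
  then show ?thesis using df_nonneg[OF t] by (simp add: Hf_eq)
qed

text \<open>From \<open>t qf^2 \<le> 1\<close> follows \<open>qf \<le> 1 / sqrt t\<close>, and
  \<open>1 - Hf = (n - 1) qf + df \<le> n qf\<close>. It supplies the limit \<open>1\<close> at
  infinity.\<close>

lemma Hf_ge: assumes "t > 0" shows "Hf n t \<ge> 1 - n / sqrt t"
proof -
  have "(sqrt t * qf n t)\<^sup>2 \<le> 1"
    using Hf_le_1[of t] assms by (simp add: Hf_def power_mult_distrib)
  then have "sqrt t * qf n t \<le> 1"
    by (simp add: power2_le_iff_abs_le abs_square_le_1)
  then have "qf n t \<le> 1 / sqrt t" using assms by (simp add: field_simps)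
  then have "n * qf n t \<le> n * (1 / sqrt t)" by (rule mult_left_mono) simp
  then show ?thesis using df_le_qf[of t] assms by (simp add: Hf_eq left_diff_distrib)
qed

lemma cont_Hf: "continuous_on {0..} (Hf n)"
  unfolding Hf_def by (intro continuous_intros cont_qf)

section \<open>Identification with the quotient of Bessel series\<close>

lemma Gamma_mom: "Gamma (real m + n / 2) = Gamma (real n / 2) * mom n m / 2 ^ m"
proof (induction m)
  case (Suc m)
  have "real m + n / 2 > 0" using n by (simp add: add_nonneg_pos)
  then have "real m + n / 2 \<notin> \<int>\<^sub>\<le>\<^sub>0" by (auto dest: nonpos_Ints_nonpos)
  then have "Gamma (real (Suc m) + n / 2) = (real m + n / 2) * Gamma (real m + n / 2)"
    using Gamma_plus1[of "real m + n / 2"] by (simp add: add_ac)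
  then show ?case unfolding Suc by (simp add: mom_Suc field_simps)
qed simp

text \<open>Up to powers of \<open>x / 2\<close> and the factor \<open>Gamma (n / 2)\<close>, the
  two Bessel series are \<open>Bs\<close> and its derivative at \<open>x^2\<close>.\<close>

lemma bessel_h_eq: assumes x: "x \<ge> 0" shows "bessel_h (real n / 2) x = x * qf n (x\<^sup>2)"
proof (cases "x = 0")
  case True
  \<comment> \<open>At \<open>0\<close> all \<open>powr\<close> terms vanish, by convention also
    \<open>0 powr 0\<close>, and \<open>0 / 0 = 0\<close> agrees with the right-hand side.\<close>
  then show ?thesis by (simp add: bessel_h_def bessel_I_def)
next
  case False
  then have x0: "x > 0" using x by simp
  define g where "g = Gamma (real n / 2)"
  have g: "g > 0" unfolding g_def using n by (intro Gamma_real_pos) auto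
  have pw: "(x / 2) powr (2 * real m + v) = (x / 2) powr v * ((x\<^sup>2) ^ m / 4 ^ m)" for m v
  proof -
    have "(x / 2) powr (2 * real m + v) = (x / 2) powr v * (x / 2) powr (real (2 * m))"
      by (simp add: powr_add)
    also have "(x / 2) powr (real (2 * m)) = ((x / 2)\<^sup>2) ^ m"
      using x0 by (subst powr_realpow) (simp_all add: power_mult)
    also have "\<dots> = (x\<^sup>2) ^ m / 4 ^ m" by (simp add: power_divide)
    finally show ?thesis .
  qed
  have "bessel_I (real n / 2 - 1) x = (\<Sum>m. (x / 2) powr (real n / 2 - 1) / g * (bco n m * (x\<^sup>2) ^ m))"
    unfolding bessel_I_def
  proof (rule suminf_cong)
    fix m
    have G: "Gamma (real m + (real n / 2 - 1) + 1) = g * mom n m / 2 ^ m" using Gamma_mom[of m] by (simp add: g_def)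
    have "(4::real) ^ m = 2 ^ m * 2 ^ m" by (simp flip: power_mult_distrib)
    then show "(x / 2) powr (2 * real m + (real n / 2 - 1)) / (fact m * Gamma (real m + (real n / 2 - 1) + 1))
       = (x / 2) powr (real n / 2 - 1) / g * (bco n m * (x\<^sup>2) ^ m)"
      using g mom_pos[OF n, of m] unfolding pw G by (simp add: bco_def)
  qed
  also have "\<dots> = (x / 2) powr (real n / 2 - 1) / g * Bs n (x\<^sup>2)"
    unfolding Bs_def by (rule suminf_mult[OF summable_bco])
  finally have I1: "bessel_I (real n / 2 - 1) x = (x / 2) powr (real n / 2 - 1) / g * Bs n (x\<^sup>2)" .
  have "bessel_I (real n / 2) x = (\<Sum>m. 4 * (x / 2) powr (real n / 2) / g * (diffs (bco n) m * (x\<^sup>2) ^ m))"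
    unfolding bessel_I_def
  proof (rule suminf_cong)
    fix m
    have G: "Gamma (real m + real n / 2 + 1) = g * mom n (Suc m) / 2 ^ Suc m" using Gamma_mom[of "Suc m"] by (simp add: g_def add_ac)
    have "(4::real) ^ m = 2 ^ m * 2 ^ m" by (simp flip: power_mult_distrib)
    moreover have "diffs (bco n) m = 1 / (2 ^ Suc m * fact m * mom n (Suc m))"
      by (simp add: diffs_def bco_def fact_Suc del: of_nat_Suc)
    ultimately show "(x / 2) powr (2 * real m + real n / 2) / (fact m * Gamma (real m + real n / 2 + 1))
       = 4 * (x / 2) powr (real n / 2) / g * (diffs (bco n) m * (x\<^sup>2) ^ m)"
      using g mom_pos[OF n, of "Suc m"] unfolding pw G by (simp add: field_simps)
  qed
  also have "\<dots> = 4 * (x / 2) powr (real n / 2) / g * Bs1 n (x\<^sup>2)"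
    unfolding Bs1_def by (rule suminf_mult[OF summable_bco1])
  finally have I2: "bessel_I (real n / 2) x = 4 * (x / 2) powr (real n / 2) / g * Bs1 n (x\<^sup>2)" .
  have "(x / 2) powr (real n / 2) = (x / 2) powr (real n / 2 - 1) * (x / 2)"
    using x0 by (simp add: powr_diff)
  moreover have "(x / 2) powr (real n / 2 - 1) > 0" using x0 by simp
  moreover have "Bs n (x\<^sup>2) > 0" using Bs_ge_1[of "x\<^sup>2"] by simp
  ultimately show ?thesis unfolding bessel_h_def I1 I2 qf_def using g by (simp add: field_simps)
qed

lemma bessel_h_sq: "x \<ge> 0 \<Longrightarrow> (bessel_h (real n / 2) x)\<^sup>2 = Hf n (x\<^sup>2)"
  by (simp add: bessel_h_eq Hf_def power_mult_distrib)

end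

section \<open>Exponential integrals of radial functions\<close>

text \<open>The constant term is read off at \<open>t = 0\<close>; the others follow by
  differentiating the series.\<close>

lemma powser_eq_0:
  fixes a :: "nat \<Rightarrow> real"
  assumes "\<And>t. (\<lambda>j. a j * t ^ j) sums 0"
  shows "a j = 0"
  using assms
proof (induction j arbitrary: a)
  case 0
  show ?case using 0[of 0] by (simp add: sums_iff)
next
  case (Suc j)
  have "(\<lambda>k. diffs a k * t ^ k) sums 0" for t
    by (rule termdiffs_sums_strong[where K="norm t + 1" and f="\<lambda>_. 0"]) (use Suc.prems in auto)
  then have "diffs a j = 0" by (rule Suc.IH)
  then show ?case by (simp add: diffs_def)
qed

lemma sums_even_iff:
  fixes f :: "nat \<Rightarrow> real"
  assumes "\<And>j. odd j \<Longrightarrow> f j = 0"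
  shows "(\<lambda>k. f (2 * k)) sums c \<longleftrightarrow> f sums c"
proof (rule sums_mono_reindex)
  fix j :: nat assume "j \<notin> range ((*) 2)"
  then have "odd j" by (auto elim!: evenE)
  then show "f j = 0" by (rule assms)
qed (simp add: strict_mono_def)

lemma integral_stdg_translate:
  assumes [measurable]: "f \<in> borel_measurable (Rn n)"
  shows "(\<integral>z. f (affmap n \<xi> 1 z) \<partial>stdg n) = (\<integral>z. f z * exp (dotp n \<xi> z - dotp n \<xi> \<xi> / 2) \<partial>stdg n :: real)"
proof -
  have "(\<integral>z. f (affmap n \<xi> 1 z) \<partial>stdg n) = (\<integral>z. f z \<partial>distr (stdg n) (Rn n) (affmap n \<xi> 1))"
    by (simp add: integral_distr)
  also have "\<dots> = (\<integral>z. f z * exp (dotp n \<xi> z - dotp n \<xi> \<xi> / 2) \<partial>stdg n)"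
    unfolding gauss_translate by (simp add: integral_density mult.commute)
  finally show ?thesis .
qed

lemma stdg_symmetric: "distr (stdg n) (Rn n) (vscale n (- 1)) = stdg n"
proof (rule measure_eqI)
  fix A assume "A \<in> sets (distr (stdg n) (Rn n) (vscale n (- 1)))"
  then have A [measurable]: "A \<in> sets (Rn n)" by simp
  have vs: "affmap n (\<lambda>_. 0) (- 1) = vscale n (- 1)" by (auto simp: vscale_def affmap_def)
  have g: "gdens n 1 (vscale n (- 1) x) = gdens n 1 x" for x by (simp add: gdens_def)
  have "emeasure (stdg n) A = (\<integral>\<^sup>+x. ennreal (gdens n 1 x) * indicator A x \<partial>Lb n)"
    by (simp add: gauss_density emeasure_density)
  also have "\<dots> = (\<integral>\<^sup>+x. ennreal (gdens n 1 x) * indicator A (vscale n (- 1) x) \<partial>Lb n)"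
    by (subst nn_integral_Lb_affine[of "- 1" _ n "\<lambda>_. 0"]) (auto simp: vs g)
  also have "\<dots> = (\<integral>\<^sup>+x. indicator A (vscale n (- 1) x) \<partial>stdg n)"
    by (simp add: gauss_density nn_integral_density)
  also have "\<dots> = emeasure (distr (stdg n) (Rn n) (vscale n (- 1))) A"
    by (subst nn_integral_indicator[symmetric], simp) (subst nn_integral_distr, auto)
  finally show "emeasure (distr (stdg n) (Rn n) (vscale n (- 1))) A = emeasure (stdg n) A" by simp
qed simp

lemma integral_stdg_odd:
  assumes [measurable]: "f \<in> borel_measurable (Rn n)" and odd: "\<And>z. f (vscale n (- 1) z) = - f z"
  shows "(\<integral>z. f z \<partial>stdg n) = (0::real)"
proof -
  have "(\<integral>z. f z \<partial>stdg n) = (\<integral>z. f z \<partial>distr (stdg n) (Rn n) (vscale n (- 1)))"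
    by (simp only: stdg_symmetric)
  also have "\<dots> = (\<integral>z. f (vscale n (- 1) z) \<partial>stdg n)" by (simp add: integral_distr)
  finally show ?thesis by (simp add: odd)
qed

lemma exp_real_sums: "(\<lambda>j. x ^ j / fact j) sums exp (x::real)"
  using exp_converges[of x] by (simp add: divide_inverse scaleR_conv_of_real mult.commute)

lemma abs_exp_partial_sum_le: "\<bar>\<Sum>j<N. x ^ j / fact j\<bar> \<le> exp \<bar>x::real\<bar>"
proof -
  have "\<bar>\<Sum>j<N. x ^ j / fact j\<bar> \<le> (\<Sum>j<N. \<bar>x\<bar> ^ j / fact j)"
    by (rule order_trans[OF sum_abs]) (simp add: abs_divide power_abs)
  also have "\<dots> \<le> exp \<bar>x\<bar>"
    using sum_le_suminf[of "\<lambda>j. \<bar>x\<bar> ^ j / fact j" "{..<N}"] exp_real_sums[of "\<bar>x\<bar>"]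
    by (auto simp: sums_iff)
  finally show ?thesis .
qed

text \<open>The partial sums of the exponential series are dominated by \<open>exp |u|\<close>,
  integrable against \<open>f\<close> since \<open>u\<close> grows at most linearly. It is applied
  both to linear forms and to the bounded quotient of a linear form by the norm.\<close>

lemma gauss_exp_expansion:
  assumes [measurable]: "f \<in> borel_measurable (Rn n)"
    and u [measurable]: "u \<in> borel_measurable (Rn n)"
    and ub: "\<And>z. z \<in> space (Rn n) \<Longrightarrow> \<bar>u z\<bar> \<le> \<rho> * (1 + vnorm n z)"
    and b: "\<And>z. z \<in> space (Rn n) \<Longrightarrow> \<bar>f z\<bar> \<le> C * (1 + (vnorm n z)\<^sup>2) ^ k"
  shows "(\<lambda>j. (\<integral>z. f z * (u z) ^ j \<partial>stdg n) / fact j) sums (\<integral>z. f z * exp (u z) \<partial>stdg n)"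
proof -
  have int: "integrable (stdg n) (\<lambda>z. \<bar>f z\<bar> * exp \<bar>u z\<bar>)"
  proof (rule integrable_stdg_bound[where C="C * exp \<rho>" and k=k and \<rho>=\<rho>])
    fix z assume z: "z \<in> space (Rn n)"
    have "\<bar>f z\<bar> * exp \<bar>u z\<bar> \<le> (C * (1 + (vnorm n z)\<^sup>2) ^ k) * exp (\<rho> * (1 + vnorm n z))"
      using b[OF z] ub[OF z] order_trans[OF abs_ge_zero b[OF z]] by (intro mult_mono) auto
    then show "\<bar>\<bar>f z\<bar> * exp \<bar>u z\<bar>\<bar> \<le> C * exp \<rho> * (1 + (vnorm n z)\<^sup>2) ^ k * exp (\<rho> * vnorm n z)"
      by (simp add: abs_mult distrib_left exp_add mult_ac)
  qed measurable
  have intj: "integrable (stdg n) (\<lambda>z. f z * (u z ^ j / fact j))" for j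
  proof (rule Bochner_Integration.integrable_bound[OF int])
    show "AE z in stdg n. norm (f z * (u z ^ j / fact j)) \<le> norm (\<bar>f z\<bar> * exp \<bar>u z\<bar>)"
    proof (rule AE_I2)
      fix z
      have "\<bar>u z\<bar> ^ j / fact j \<le> exp \<bar>u z\<bar>"
        using power_le_exp[of "\<bar>u z\<bar>" j] by (simp add: field_simps)
      then have "\<bar>f z\<bar> * (\<bar>u z\<bar> ^ j / fact j) \<le> \<bar>f z\<bar> * exp \<bar>u z\<bar>"
        by (rule mult_left_mono) simp
      then show "norm (f z * (u z ^ j / fact j)) \<le> norm (\<bar>f z\<bar> * exp \<bar>u z\<bar>)"
        by (simp add: abs_mult power_abs)
    qed
  qed measurable
  have "(\<lambda>N. \<integral>z. f z * (\<Sum>j<N. u z ^ j / fact j) \<partial>stdg n) \<longlonglongrightarrow> (\<integral>z. f z * exp (u z) \<partial>stdg n)"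
  proof (rule integral_dominated_convergence[OF _ _ int])
    show "AE z in stdg n. (\<lambda>N. f z * (\<Sum>j<N. u z ^ j / fact j)) \<longlonglongrightarrow> f z * exp (u z)"
      using exp_real_sums by (intro AE_I2 tendsto_mult_left) (simp add: sums_def)
    show "AE z in stdg n. norm (f z * (\<Sum>j<N. u z ^ j / fact j)) \<le> \<bar>f z\<bar> * exp \<bar>u z\<bar>" for N
      using abs_exp_partial_sum_le by (intro AE_I2) (simp add: abs_mult mult_left_mono)
  qed measurable
  moreover have "(\<integral>z. f z * (\<Sum>j<N. u z ^ j / fact j) \<partial>stdg n) = (\<Sum>j<N. (\<integral>z. f z * (u z) ^ j \<partial>stdg n) / fact j)" for N
    using intj by (simp add: sum_distrib_left)
  ultimately show ?thesis by (simp add: sums_def)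
qed

lemma abs_dotp_le: "\<bar>dotp n \<xi> z\<bar> \<le> vnorm n \<xi> * (1 + vnorm n z)"
  by (rule order_trans[OF dotp_Cauchy_Schwarz]) (simp add: distrib_left)

lemma exp_dotp_integral: "(\<integral>z. exp (dotp n \<xi> z) \<partial>stdg n) = exp (dotp n \<xi> \<xi> / 2)"
proof -
  have "1 = (\<integral>z. exp (dotp n \<xi> z - dotp n \<xi> \<xi> / 2) \<partial>stdg n)"
    using integral_stdg_translate[of "\<lambda>_. 1" n \<xi>] prob_space.prob_space[OF prob_space_gauss, of 1 n] by simp
  also have "\<dots> = (\<integral>z. exp (dotp n \<xi> z) \<partial>stdg n) / exp (dotp n \<xi> \<xi> / 2)"
    by (simp add: exp_diff)
  finally show ?thesis by (simp add: field_simps)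
qed

text \<open>Both \<open>a\<close> and \<open>b\<close> are the coefficients, as power series in
  \<open>t\<close>, of the moment generating function \<open>exp (q t^2)\<close> of the linear form;
  such coefficients are unique.\<close>

lemma dotp_moment_even:
  "(\<integral>z. (dotp n \<xi> z) ^ (2 * k) \<partial>stdg n) = fact (2 * k) * (dotp n \<xi> \<xi> / 2) ^ k / fact k"
proof -
  define q where "q = dotp n \<xi> \<xi> / 2"
  define a where "a j = (\<integral>z. (dotp n \<xi> z) ^ j \<partial>stdg n) / fact j" for j
  define b where "b j = (if even j then q ^ (j div 2) / fact (j div 2) else 0)" for j
  have A: "(\<lambda>j. a j * t ^ j) sums exp (q * t\<^sup>2)" for t
  proof -
    have "(\<lambda>j. (\<integral>z. 1 * (t * dotp n \<xi> z) ^ j \<partial>stdg n) / fact j) sums (\<integral>z. 1 * exp (t * dotp n \<xi> z) \<partial>stdg n)"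
    proof (rule gauss_exp_expansion[where \<rho>="vnorm n (vscale n t \<xi>)" and C=1 and k=0])
      show "\<bar>t * dotp n \<xi> z\<bar> \<le> vnorm n (vscale n t \<xi>) * (1 + vnorm n z)" for z
        using abs_dotp_le[of n "vscale n t \<xi>" z] by simp
    qed auto
    moreover have "(\<integral>z. 1 * exp (t * dotp n \<xi> z) \<partial>stdg n) = exp (q * t\<^sup>2)"
      using exp_dotp_integral[of n "vscale n t \<xi>"] by (simp add: q_def power2_eq_square mult_ac)
    moreover have "(\<integral>z. 1 * (t * dotp n \<xi> z) ^ j \<partial>stdg n) / fact j = a j * t ^ j" for j
      by (simp add: a_def power_mult_distrib)
    ultimately show ?thesis by simp
  qed
  have B: "(\<lambda>j. b j * t ^ j) sums exp (q * t\<^sup>2)" for t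
  proof -
    have "(\<lambda>k. b (2 * k) * t ^ (2 * k)) sums exp (q * t\<^sup>2)"
      using exp_real_sums[of "q * t\<^sup>2"] by (simp add: b_def power_mult_distrib power_mult)
    then show ?thesis
      by (subst (asm) sums_even_iff) (simp_all add: b_def)
  qed
  have "a (2 * k) - b (2 * k) = 0"
  proof (rule powser_eq_0)
    fix t show "(\<lambda>j. (a j - b j) * t ^ j) sums 0"
      using sums_diff[OF A[of t] B[of t]] by (simp add: left_diff_distrib)
  qed
  then show ?thesis by (simp add: a_def b_def q_def field_simps)
qed

text \<open>The mean of \<open>F\<close> under a chi-square law with \<open>n + 2 k\<close> degrees of freedom. The law of \<open>\<bar>\<xi> + Z\<bar>\<^sup>2\<close> is the
  mixture of these over a Poisson variable \<open>k\<close> of mean \<open>\<bar>\<xi>\<bar>\<^sup>2 / 2\<close>.\<close>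

definition ck :: "nat \<Rightarrow> (real \<Rightarrow> real) \<Rightarrow> nat \<Rightarrow> real" where
  "ck n F k = (\<integral>z. F (dotp n z z) * (dotp n z z) ^ k \<partial>stdg n) / mom n k"

lemma homogeneous_power:
  assumes "j > 0"
  shows "(dotp n \<xi> z / vnorm n z) ^ j * (vnorm n z) ^ j = (dotp n \<xi> z) ^ j"
proof (cases "vnorm n z = 0")
  case True
  then have "dotp n \<xi> z = 0" using dotp_Cauchy_Schwarz[of n \<xi> z] by simp
  then show ?thesis using True assms by simp
next
  case False
  then show ?thesis by (simp add: power_divide)
qed

lemma dotp_quotient_le: "\<bar>dotp n \<xi> z / vnorm n z\<bar> \<le> vnorm n \<xi>"
proof (cases "vnorm n z = 0")
  case False
  then have "vnorm n z > 0" using vnorm_nonneg[of n z] by linarith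
  then show ?thesis using dotp_Cauchy_Schwarz[of n \<xi> z] by (simp add: divide_simps abs_mult)
qed simp

text \<open>A linear form is the norm times a function of the direction, and the two factors are
  independent under the Gaussian law.\<close>

lemma even_radial_moment:
  fixes F :: "real \<Rightarrow> real"
  assumes [measurable]: "F \<in> borel_measurable borel"
  shows "(\<integral>z. F (dotp n z z) * (dotp n \<xi> z) ^ (2 * k) \<partial>stdg n)
     = (\<integral>z. (dotp n \<xi> z / vnorm n z) ^ (2 * k) \<partial>stdg n) * (\<integral>z. F (dotp n z z) * (dotp n z z) ^ k \<partial>stdg n)"
proof (cases "k = 0")
  case True
  then show ?thesis using prob_space.prob_space[OF prob_space_gauss, of 1 n] by simp
next
  case False
  define \<phi> where "\<phi> z = (dotp n \<xi> z / vnorm n z) ^ (2 * k)" for z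
  have [measurable]: "\<phi> \<in> borel_measurable (Rn n)" unfolding \<phi>_def by measurable
  have "(\<integral>z. \<phi> z * (F ((vnorm n z)\<^sup>2) * (vnorm n z) ^ (2 * k)) \<partial>stdg n)
     = (\<integral>z. \<phi> z \<partial>stdg n) * (\<integral>z. F ((vnorm n z)\<^sup>2) * (vnorm n z) ^ (2 * k) \<partial>stdg n)"
  proof (rule stdg_radial_proportional(2)[where F="\<lambda>t. F (t\<^sup>2) * t ^ (2 * k)" and C="(vnorm n \<xi>) ^ (2 * k)"])
    show "0 \<le> \<phi> z \<and> \<phi> z \<le> vnorm n \<xi> ^ (2 * k)" for z
    proof -
      have "\<phi> z = \<bar>dotp n \<xi> z / vnorm n z\<bar> ^ (2 * k)"
        unfolding \<phi>_def by (rule power_even_abs[symmetric]) simp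
      also have "\<dots> \<le> vnorm n \<xi> ^ (2 * k)" by (rule power_mono[OF dotp_quotient_le]) simp
      finally show ?thesis by (simp add: \<phi>_def)
    qed
    show "\<phi> (vscale n c z) = \<phi> z" if "c > 0" for c z using that by (simp add: \<phi>_def)
  qed measurable
  moreover have "\<phi> z * (F ((vnorm n z)\<^sup>2) * (vnorm n z) ^ (2 * k)) = F (dotp n z z) * (dotp n \<xi> z) ^ (2 * k)" for z
  proof -
    have "\<phi> z * (vnorm n z) ^ (2 * k) = (dotp n \<xi> z) ^ (2 * k)"
      unfolding \<phi>_def using False by (intro homogeneous_power) simp
    then show ?thesis by (simp add: vnorm_sq)
  qed
  moreover have "F ((vnorm n z)\<^sup>2) * (vnorm n z) ^ (2 * k) = F (dotp n z z) * (dotp n z z) ^ k" for z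
    by (simp add: power_mult vnorm_sq)
  ultimately show ?thesis by (simp only: \<phi>_def)
qed

lemma quotient_moment_even:
  assumes n: "n \<ge> 1"
  shows "(\<integral>z. (dotp n \<xi> z / vnorm n z) ^ (2 * k) \<partial>stdg n) = fact (2 * k) * (dotp n \<xi> \<xi> / 2) ^ k / fact k / mom n k"
  using even_radial_moment[of "\<lambda>_. 1" n \<xi> k] mom_pos[OF n, of k]
  by (simp add: dotp_moment_even flip: mom_def)

lemma radial_dotp_moment_even:
  assumes n: "n \<ge> 1" and "F \<in> borel_measurable borel"
  shows "(\<integral>z. F (dotp n z z) * (dotp n \<xi> z) ^ (2 * k) \<partial>stdg n) = ck n F k * (fact (2 * k) * (dotp n \<xi> \<xi> / 2) ^ k / fact k)"
  unfolding even_radial_moment[OF assms(2)] quotient_moment_even[OF n] ck_def by (simp add: mult_ac)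

lemma radial_dotp_moment_odd:
  assumes [measurable]: "F \<in> borel_measurable borel" and "odd j"
  shows "(\<integral>z. F (dotp n z z) * (dotp n \<xi> z) ^ j \<partial>stdg n) = 0"
  by (rule integral_stdg_odd) (use assms in \<open>auto simp: power_minus_odd\<close>)

text \<open>Odd moments vanish by symmetry. In the even ones \<open>fact (2 * k)\<close> cancels
  against the exponential series and leaves unnormalised Poisson weights of mean
  \<open>dotp n \<xi> \<xi> / 2\<close>.\<close>

lemma radial_exp_sums:
  assumes n: "n \<ge> 1" and F [measurable]: "F \<in> borel_measurable borel"
    and b: "\<And>w. w \<ge> 0 \<Longrightarrow> \<bar>F w\<bar> \<le> C * (1 + w)"
  shows "(\<lambda>k. ck n F k * (dotp n \<xi> \<xi> / 2) ^ k / fact k) sums (\<integral>z. F (dotp n z z) * exp (dotp n \<xi> z) \<partial>stdg n)"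
proof -
  let ?a = "\<lambda>j. (\<integral>z. F (dotp n z z) * (dotp n \<xi> z) ^ j \<partial>stdg n) / fact j"
  have "?a sums (\<integral>z. F (dotp n z z) * exp (dotp n \<xi> z) \<partial>stdg n)"
    by (rule gauss_exp_expansion[where \<rho>="vnorm n \<xi>" and C=C and k=1])
       (use b abs_dotp_le in \<open>auto simp: vnorm_sq\<close>)
  then have "(\<lambda>k. ?a (2 * k)) sums (\<integral>z. F (dotp n z z) * exp (dotp n \<xi> z) \<partial>stdg n)"
    by (subst sums_even_iff) (simp_all add: radial_dotp_moment_odd)
  then show ?thesis by (simp add: radial_dotp_moment_even[OF n F])
qed

text \<open>The extra linear form shifts the exponential series by one index; multiplying each term
  by its index restores the even moments and produces the factor \<open>2 k\<close>.\<close>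

lemma radial_dotp_exp_sums:
  assumes n: "n \<ge> 1" and F [measurable]: "F \<in> borel_measurable borel"
    and b: "\<And>w. w \<ge> 0 \<Longrightarrow> \<bar>F w\<bar> \<le> C"
  shows "(\<lambda>k. 2 * k * ck n F k * (dotp n \<xi> \<xi> / 2) ^ k / fact k) sums (\<integral>z. F (dotp n z z) * dotp n \<xi> z * exp (dotp n \<xi> z) \<partial>stdg n)"
proof -
  define a where "a j = (\<integral>z. F (dotp n z z) * (dotp n \<xi> z) ^ j \<partial>stdg n)" for j
  let ?I = "\<integral>z. F (dotp n z z) * dotp n \<xi> z * exp (dotp n \<xi> z) \<partial>stdg n"
  have "(\<lambda>j. (\<integral>z. (F (dotp n z z) * dotp n \<xi> z) * (dotp n \<xi> z) ^ j \<partial>stdg n) / fact j) sums ?I"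
  proof (rule gauss_exp_expansion[where \<rho>="vnorm n \<xi>" and C="C * (vnorm n \<xi> * 2)" and k=1])
    fix z
    have "1 + v \<le> 2 * (1 + v\<^sup>2)" for v :: real
      using zero_le_power2[of "v - 1 / 4"] zero_le_power2[of v] by (simp add: power2_eq_square algebra_simps)
    then have "\<bar>dotp n \<xi> z\<bar> \<le> vnorm n \<xi> * (2 * (1 + (vnorm n z)\<^sup>2))"
      using order_trans[OF abs_dotp_le mult_left_mono[OF _ vnorm_nonneg]] by blast
    then have "\<bar>F (dotp n z z)\<bar> * \<bar>dotp n \<xi> z\<bar> \<le> C * (vnorm n \<xi> * (2 * (1 + (vnorm n z)\<^sup>2)))"
      using b[of "dotp n z z"] order_trans[OF abs_ge_zero b[of 0]] by (intro mult_mono) auto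
    then show "\<bar>F (dotp n z z) * dotp n \<xi> z\<bar> \<le> C * (vnorm n \<xi> * 2) * (1 + (vnorm n z)\<^sup>2) ^ 1"
      by (simp add: abs_mult mult_ac)
  qed (use abs_dotp_le in auto)
  then have "(\<lambda>j. a (Suc j) / fact j) sums ?I" by (simp add: a_def mult_ac)
  then have "(\<lambda>j. Suc j * (a (Suc j) / fact (Suc j))) sums ?I"
    by (simp add: fact_Suc del: of_nat_Suc)
  then have "(\<lambda>j. real j * (a j / fact j)) sums ?I"
    by (subst (asm) sums_Suc_iff) simp
  then have "(\<lambda>k. real (2 * k) * (a (2 * k) / fact (2 * k))) sums ?I"
    by (subst sums_even_iff) (simp_all add: a_def radial_dotp_moment_odd)
  then show ?thesis by (simp add: a_def radial_dotp_moment_even[OF n F] mult.assoc)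
qed

text \<open>The direction \<open>z / |z|\<close> has the even moments of
  \<open>quotient_moment_even\<close>; divided by \<open>fact (2 * k)\<close> they are exactly the
  terms of \<open>Bs\<close>.\<close>

lemma sphere_mgf:
  assumes n: "n \<ge> 1"
  shows "(\<integral>z. exp (dotp n y (sphmap n 1 z)) \<partial>stdg n) = Bs n (dotp n y y)"
proof -
  have sp: "dotp n y (sphmap n 1 z) = dotp n y z / vnorm n z" for z by (simp add: sphmap_def)
  let ?a = "\<lambda>j. (\<integral>z. (dotp n y z / vnorm n z) ^ j \<partial>stdg n) / fact j"
  have "(\<lambda>j. (\<integral>z. 1 * (dotp n y z / vnorm n z) ^ j \<partial>stdg n) / fact j) sums (\<integral>z. 1 * exp (dotp n y z / vnorm n z) \<partial>stdg n)"
  proof (rule gauss_exp_expansion[where \<rho>="vnorm n y" and C=1 and k=0])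
    show "\<bar>dotp n y z / vnorm n z\<bar> \<le> vnorm n y * (1 + vnorm n z)" for z
      by (rule order_trans[OF dotp_quotient_le]) (simp add: distrib_left)
  qed auto
  then have "?a sums (\<integral>z. exp (dotp n y z / vnorm n z) \<partial>stdg n)" by simp
  moreover have "?a j = 0" if "odd j" for j
  proof -
    have "(\<integral>z. (dotp n y z / vnorm n z) ^ j \<partial>stdg n) = 0"
      by (rule integral_stdg_odd) (use that in \<open>auto simp: power_minus_odd\<close>)
    then show ?thesis by simp
  qed
  ultimately have "(\<lambda>k. ?a (2 * k)) sums (\<integral>z. exp (dotp n y z / vnorm n z) \<partial>stdg n)"
    by (subst sums_even_iff) simp_all
  moreover have "?a (2 * k) = bco n k * (dotp n y y) ^ k" for k
    unfolding quotient_moment_even[OF n] by (simp add: bco_def power_divide)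
  ultimately show ?thesis by (simp add: sp Bs_def sums_iff)
qed

section \<open>Gradient of the moment generating function of the sphere\<close>

definition unitv :: "nat \<Rightarrow> nat \<Rightarrow> real" where "unitv i j = (if j = i then 1 else 0)"

lemma dotp_unitv: "i < n \<Longrightarrow> dotp n (unitv i) x = x i"
  by (simp add: dotp_def unitv_def if_distrib[of "\<lambda>c. c * _"] cong: if_cong)

lemma abs_component_le: "i < n \<Longrightarrow> \<bar>x i\<bar> \<le> vnorm n x"
  using dotp_Cauchy_Schwarz[of n "unitv i" x] dotp_unitv[of i n x] dotp_unitv[of i n "unitv i"]
  by (simp add: vnorm_dotp unitv_def)

lemma vnorm_sphmap: "R \<ge> 0 \<Longrightarrow> vnorm n (sphmap n R z) \<le> R"
  by (simp add: sphmap_def)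

text \<open>The derivative of \<open>sphere_mgf\<close> at \<open>y\<close> along the coordinate
  vector \<open>i\<close>, computed under the integral sign on one side and by the chain rule for
  \<open>Bs\<close> on the other.\<close>

lemma sphere_mgf_deriv:
  assumes n: "n \<ge> 1" and i: "i < n"
  shows "(\<integral>z. sphmap n 1 z i * exp (dotp n y (sphmap n 1 z)) \<partial>stdg n) = 2 * y i * Bs1 n (dotp n y y)"
proof -
  let ?S = "{-1..1::real}"
  have lin: "dotp n (affmap n y t (unitv i)) x = dotp n y x + t * x i" for t x
    using dotp_affmap_right[of n x y t "unitv i"] dotp_unitv[OF i, of x]
    by (simp add: dotp_commute[of n _ x])
  have sq: "dotp n (affmap n y t (unitv i)) (affmap n y t (unitv i)) = dotp n y y + 2 * t * y i + t\<^sup>2" for t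
    using dotp_unitv[OF i, of y] dotp_unitv[OF i, of "unitv i"]
    by (simp add: dotp_affmap_self dotp_commute[of n y "unitv i"] unitv_def[of i i])
  have [measurable]: "(\<lambda>z. sphmap n 1 z i) \<in> borel_measurable (Rn n)"
    by (rule measurable_comp_Rn[OF measurable_sphmap i])
  have [measurable]: "(\<lambda>z. dotp n y (sphmap n 1 z)) \<in> borel_measurable (Rn n)"
    by (intro measurable_dotp measurable_comp_Rn[OF measurable_sphmap]) auto
  let ?f = "\<lambda>t z. exp (dotp n y (sphmap n 1 z) + t * sphmap n 1 z i)"
  let ?f' = "\<lambda>t z. sphmap n 1 z i * exp (dotp n y (sphmap n 1 z) + t * sphmap n 1 z i)"
  have si: "\<bar>sphmap n 1 z i\<bar> \<le> 1" for z
    using abs_component_le[OF i, of "sphmap n 1 z"] vnorm_sphmap[of 1 n z] by simp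
  have b: "dotp n y (sphmap n 1 z) + t * sphmap n 1 z i \<le> vnorm n y + 1" if "t \<in> ?S" for t z
  proof -
    have "\<bar>dotp n y (sphmap n 1 z)\<bar> \<le> vnorm n y * 1"
      by (rule order_trans[OF dotp_Cauchy_Schwarz mult_left_mono]) (use vnorm_sphmap[of 1 n z] in auto)
    moreover have "\<bar>t * sphmap n 1 z i\<bar> \<le> 1 * 1" unfolding abs_mult using that si[of z] by (intro mult_mono) auto
    ultimately show ?thesis by linarith
  qed
  have "((\<lambda>t. \<integral>z. ?f t z \<partial>stdg n) has_real_derivative (\<integral>z. ?f' 0 z \<partial>stdg n)) (at 0 within ?S)"
  proof (rule has_real_derivative_integral[where f="?f" and f'="?f'" and G="\<lambda>_. exp (vnorm n y + 1)"])
    interpret prob_space "stdg n" by (rule prob_space_gauss) simp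
    show "integrable (stdg n) (?f t)" if "t \<in> ?S" for t
      by (rule integrable_const_bound[where B="exp (vnorm n y + 1)"]) (use b[OF that] in auto)
    show "integrable (stdg n) (\<lambda>_. exp (vnorm n y + 1))" by simp
    show "AE z in stdg n. \<forall>t\<in>?S. ((\<lambda>t. ?f t z) has_real_derivative ?f' t z) (at t within ?S)"
    proof (intro AE_I2 ballI)
      fix z and t :: real
      have "((\<lambda>t. dotp n y (sphmap n 1 z) + t * sphmap n 1 z i) has_real_derivative sphmap n 1 z i) (at t within ?S)"
        by (auto intro!: derivative_eq_intros)
      from DERIV_chain2[OF DERIV_exp this]
      show "((\<lambda>t. ?f t z) has_real_derivative ?f' t z) (at t within ?S)" by (simp only: mult.commute)
    qed
    show "AE z in stdg n. \<forall>t\<in>?S. \<bar>?f' t z\<bar> \<le> exp (vnorm n y + 1)"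
    proof (intro AE_I2 ballI)
      fix z t assume "t \<in> ?S"
      then have "\<bar>?f' t z\<bar> \<le> 1 * exp (vnorm n y + 1)"
        unfolding abs_mult using b[of t z] si[of z] by (intro mult_mono) auto
      then show "\<bar>?f' t z\<bar> \<le> exp (vnorm n y + 1)" by simp
    qed
  qed auto
  moreover have "(\<integral>z. ?f t z \<partial>stdg n) = Bs n (dotp n y y + 2 * t * y i + t\<^sup>2)" for t
    using sphere_mgf[OF n, of "affmap n y t (unitv i)", unfolded sq] by (simp only: lin)
  ultimately have D: "((\<lambda>t. Bs n (dotp n y y + 2 * t * y i + t\<^sup>2)) has_real_derivative (\<integral>z. ?f' 0 z \<partial>stdg n)) (at 0 within ?S)"
    by simp
  have inner: "((\<lambda>t. dotp n y y + 2 * t * y i + t\<^sup>2) has_real_derivative 2 * y i) (at 0 within ?S)"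
    by (auto intro!: derivative_eq_intros)
  have "((\<lambda>t. Bs n (dotp n y y + 2 * t * y i + t\<^sup>2)) has_real_derivative Bs1 n (dotp n y y + 2 * 0 * y i + 0\<^sup>2) * (2 * y i)) (at 0 within ?S)"
    by (rule DERIV_chain2[OF DERIV_Bs[OF n] inner])
  moreover have "at (0::real) within ?S \<noteq> bot"
    by (simp add: at_within_interior[of 0 ?S])
  ultimately have "(\<integral>z. ?f' 0 z \<partial>stdg n) = Bs1 n (dotp n y y + 2 * 0 * y i + 0\<^sup>2) * (2 * y i)"
    using D tendsto_unique unfolding has_field_derivative_iff by blast
  then show ?thesis by simp
qed

section \<open>Poisson mixtures\<close>

lemma measurable_Bs [measurable]: "Bs n \<in> borel_measurable borel" "Bs1 n \<in> borel_measurable borel" "Bs2 n \<in> borel_measurable borel"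
  unfolding Bs_def[abs_def] Bs1_def[abs_def] Bs2_def[abs_def] by measurable

lemma measurable_qf [measurable]: "qf n \<in> borel_measurable borel"
  unfolding qf_def[abs_def] by measurable

lemma measurable_qf_derived [measurable]: "qd n \<in> borel_measurable borel"
  "df n \<in> borel_measurable borel" "pf n \<in> borel_measurable borel" "Hf n \<in> borel_measurable borel"
  unfolding df_def[abs_def] pf_def[abs_def] Hf_def[abs_def] qd_def[abs_def] by measurable

lemma qf_le_1: assumes "n \<ge> 1" "t \<ge> 0" shows "qf n t \<le> 1"
  using qf_antimono[OF assms(1), of 0 t] qf_0[OF assms(1)] assms by (auto intro: order_trans)

text \<open>The coefficients of \<open>Bs2\<close> are at most a quarter of those of
  \<open>Bs\<close>, so \<open>Bs2 / Bs \<le> 1 / 4\<close>. This crude bound supplies an envelope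
  for Stein's identity.\<close>

lemma abs_qd_le_1: assumes n: "n \<ge> 1" and t: "t \<ge> 0" shows "\<bar>qd n t\<bar> \<le> 1"
proof -
  have half: "(real k + 1) * bco n (Suc k) \<le> bco n k / 2" for k
  proof -
    have "1 * (2 * (real k + 1) * bco n (Suc k)) \<le> real (n + 2 * k) * (2 * (real k + 1) * bco n (Suc k))"
      using n bco_pos[OF n, of "Suc k"] by (intro mult_right_mono) auto
    also have "\<dots> = bco n k" using bco_Suc[OF n, of k] by (simp add: mult_ac)
    finally show ?thesis by (simp add: field_simps)
  qed
  have c1: "diffs (diffs (bco n)) k \<le> bco n k / 4" for k
  proof -
    have "real (Suc k) * ((real (Suc k) + 1) * bco n (Suc (Suc k))) \<le> real (Suc k) * (bco n (Suc k) / 2)"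
      by (intro mult_left_mono half) simp
    also have "\<dots> = ((real k + 1) * bco n (Suc k)) / 2" by simp
    also have "\<dots> \<le> bco n k / 4" using half[of k] by simp
    finally show ?thesis by (simp add: diffs_def)
  qed
  have "Bs2 n t \<le> (\<Sum>k. bco n k / 4 * t ^ k)"
    unfolding Bs2_def
  proof (rule suminf_le[OF _ summable_bco2[OF n]])
    show "diffs (diffs (bco n)) k * t ^ k \<le> bco n k / 4 * t ^ k" for k
      using t c1 by (intro mult_right_mono) auto
    show "summable (\<lambda>k. bco n k / 4 * t ^ k)"
      using summable_mult[OF summable_bco[OF n, of t], of "1/4"] by simp
  qed
  also have "\<dots> = Bs n t / 4"
    using suminf_mult[OF summable_bco[OF n, of t], of "1/4"] by (simp add: Bs_def)
  finally have 1: "Bs2 n t \<le> Bs n t / 4" .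
  have 2: "Bs2 n t \<ge> 0"
    unfolding Bs2_def using t bco_pos[OF n]
    by (intro suminf_nonneg summable_bco2[OF n]) (auto simp: diffs_def less_imp_le)
  have B: "Bs n t \<ge> 1" by (rule Bs_ge_1[OF n t])
  have "2 * Bs2 n t / Bs n t \<le> 1 / 2" "2 * Bs2 n t / Bs n t \<ge> 0"
    using 1 2 B by (auto simp: divide_simps)
  moreover have "(qf n t)\<^sup>2 \<le> 1" "(qf n t)\<^sup>2 \<ge> 0"
    using qf_le_1[OF n t] qf_pos[OF n t] by (auto simp: power_le_one)
  ultimately show ?thesis unfolding qd_def abs_le_iff by linarith
qed

lemma integrable_radial:
  assumes F [measurable]: "F \<in> borel_measurable borel"
    and b: "\<And>w. w \<ge> 0 \<Longrightarrow> \<bar>F w\<bar> \<le> C * (1 + w) ^ l"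
  shows "integrable (stdg n) (\<lambda>z. F (dotp n z z) * (dotp n z z) ^ k)"
proof (rule integrable_stdg_bound[where C=C and k="l + k" and \<rho>=0])
  fix z
  have "\<bar>F (dotp n z z)\<bar> * (dotp n z z) ^ k \<le> (C * (1 + dotp n z z) ^ l) * (1 + dotp n z z) ^ k"
    using b[of "dotp n z z"] order_trans[OF abs_ge_zero b[of "dotp n z z"]] by (intro mult_mono power_mono) auto
  then show "\<bar>F (dotp n z z) * dotp n z z ^ k\<bar> \<le> C * (1 + (vnorm n z)\<^sup>2) ^ (l + k) * exp (0 * vnorm n z)"
    by (simp add: abs_mult vnorm_sq power_add mult.assoc)
qed measurable

lemma ck_abs_le:
  assumes n: "n \<ge> 1" and F [measurable]: "F \<in> borel_measurable borel" and b: "\<And>w. w \<ge> 0 \<Longrightarrow> \<bar>F w\<bar> \<le> C"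
  shows "\<bar>ck n F k\<bar> \<le> C"
proof -
  have "\<bar>\<integral>z. F (dotp n z z) * (dotp n z z) ^ k \<partial>stdg n\<bar> \<le> (\<integral>z. \<bar>F (dotp n z z) * (dotp n z z) ^ k\<bar> \<partial>stdg n)"
    by (rule integral_abs_bound)
  also have "\<dots> \<le> (\<integral>z. C * (dotp n z z) ^ k \<partial>stdg n)"
    using order_trans[OF abs_ge_zero b[of 0]] by (intro integral_mono integrable_abs integrable_radial[where C=C and l=0])
       (use b integrable_pow in \<open>auto simp: abs_mult mult_right_mono\<close>)
  also have "\<dots> = C * mom n k" by (simp add: mom_def)
  finally show ?thesis using mom_pos[OF n, of k] by (simp add: ck_def divide_simps)
qed

lemma ck_add:
  assumes [measurable]: "F \<in> borel_measurable borel" "G \<in> borel_measurable borel"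
    and "\<And>w. w \<ge> 0 \<Longrightarrow> \<bar>F w\<bar> \<le> C * (1 + w) ^ l" "\<And>w. w \<ge> 0 \<Longrightarrow> \<bar>G w\<bar> \<le> D * (1 + w) ^ m"
  shows "ck n (\<lambda>w. F w + G w) k = ck n F k + ck n G k"
  unfolding ck_def distrib_right
  by (subst Bochner_Integration.integral_add[OF integrable_radial[OF assms(1,3)] integrable_radial[OF assms(2,4)]])
     (auto simp: add_divide_distrib)

lemma ck_mono_fun:
  assumes n: "n \<ge> 1" and [measurable]: "F \<in> borel_measurable borel" "G \<in> borel_measurable borel"
    and "\<And>w. w \<ge> 0 \<Longrightarrow> \<bar>F w\<bar> \<le> C * (1 + w) ^ l" "\<And>w. w \<ge> 0 \<Longrightarrow> \<bar>G w\<bar> \<le> D * (1 + w) ^ m"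
    and le: "\<And>w. w \<ge> 0 \<Longrightarrow> F w \<le> G w"
  shows "ck n F k \<le> ck n G k"
  unfolding ck_def using mom_pos[OF n, of k]
  by (intro divide_right_mono integral_mono integrable_radial[OF assms(2,4)] integrable_radial[OF assms(3,5)] mult_right_mono le) auto

text \<open>The law with weight \<open>w ^ (k + 1)\<close> is the one with weight
  \<open>w ^ k\<close> reweighted by \<open>w / m\<close>, where \<open>m\<close> is the mean of the
  latter. The inequality \<open>(F w - F m) (w - m) \<ge> 0\<close> then gives a positive
  correlation.\<close>

lemma ck_mono:
  assumes n: "n \<ge> 1" and F [measurable]: "F \<in> borel_measurable borel"
    and b: "\<And>w. w \<ge> 0 \<Longrightarrow> \<bar>F w\<bar> \<le> C * (1 + w) ^ l"
    and mono: "\<And>v w. 0 \<le> v \<Longrightarrow> v \<le> w \<Longrightarrow> F v \<le> F w"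
  shows "ck n F k \<le> ck n F (Suc k)"
proof -
  define m where "m = real n + 2 * k"
  have m: "m > 0" using n by (simp add: m_def)
  let ?W = "\<lambda>z. dotp n z z"
  have i: "integrable (stdg n) (\<lambda>z. F (?W z) * ?W z ^ j)" for j by (rule integrable_radial[OF F b])
  have "0 \<le> (\<integral>z. (F (?W z) - F m) * ((?W z - m) * ?W z ^ k) \<partial>stdg n)"
  proof (intro Bochner_Integration.integral_nonneg)
    fix z
    have "(F (?W z) - F m) * (?W z - m) \<ge> 0"
    proof (cases "?W z \<le> m")
      case True
      then show ?thesis using mono[of "?W z" m] by (intro mult_nonpos_nonpos) auto
    next
      case False
      then show ?thesis using mono[of m "?W z"] m by (intro mult_nonneg_nonneg) auto
    qed
    then have "(F (?W z) - F m) * (?W z - m) * ?W z ^ k \<ge> 0" by (rule mult_nonneg_nonneg) simp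
    then show "0 \<le> (F (?W z) - F m) * ((?W z - m) * ?W z ^ k)" by (simp add: mult.assoc)
  qed
  also have "\<dots> = (\<integral>z. F (?W z) * ?W z ^ Suc k - m * (F (?W z) * ?W z ^ k) - F m * (?W z ^ Suc k) + F m * m * (?W z ^ k) \<partial>stdg n)"
    by (simp add: algebra_simps)
  also have "\<dots> = (\<integral>z. F (?W z) * ?W z ^ Suc k \<partial>stdg n) - m * (\<integral>z. F (?W z) * ?W z ^ k \<partial>stdg n) - F m * mom n (Suc k) + F m * m * mom n k"
    unfolding mom_def using i integrable_pow[of n]
    by (simp del: power_Suc)
  also have "\<dots> = (\<integral>z. F (?W z) * ?W z ^ Suc k \<partial>stdg n) - m * (\<integral>z. F (?W z) * ?W z ^ k \<partial>stdg n)"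
    by (simp add: mom_Suc m_def)
  finally have "m * (\<integral>z. F (?W z) * ?W z ^ k \<partial>stdg n) \<le> (\<integral>z. F (?W z) * ?W z ^ Suc k \<partial>stdg n)" by simp
  then have "(\<integral>z. F (?W z) * ?W z ^ k \<partial>stdg n) / mom n k \<le> (\<integral>z. F (?W z) * ?W z ^ Suc k \<partial>stdg n) / (m * mom n k)"
    using m mom_pos[OF n, of k] by (simp add: field_simps)
  then show ?thesis by (simp add: ck_def mom_Suc m_def)
qed

text \<open>A convex function lies below its chord between \<open>a\<close> and \<open>b\<close> and
  above the extended chord outside, exactly where \<open>(w - a) (w - b)\<close> is negative and
  positive. The factor \<open>b - a\<close> clears denominators.\<close>

lemma convex_on_chord_sign:
  fixes F :: "real \<Rightarrow> real"
  assumes F: "convex_on S F" and S: "a \<in> S" "b \<in> S" "w \<in> S" and ab: "a < b"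
  shows "((b - a) * F w - (b - w) * F a - (w - a) * F b) * ((w - a) * (w - b)) \<ge> 0"
proof -
  have conv3: "(z - x) * F y \<le> (z - y) * F x + (y - x) * F z" if "x \<in> S" "z \<in> S" "x < y" "y < z" for x y z
  proof -
    define t where "t = (y - x) / (z - x)"
    have t: "0 \<le> t" "t \<le> 1" using that by (auto simp: t_def)
    have t': "(z - x) * t = y - x" using that by (simp add: t_def)
    have y: "(1 - t) *\<^sub>R x + t *\<^sub>R z = y" using t' by (simp add: algebra_simps)
    have "F y \<le> (1 - t) * F x + t * F z" using convex_onD[OF F t that(1,2)] unfolding y .
    then have "(z - x) * F y \<le> (z - x) * ((1 - t) * F x + t * F z)" using that by (intro mult_left_mono) auto
    also have "\<dots> = ((z - x) - (z - x) * t) * F x + ((z - x) * t) * F z" by (simp add: algebra_simps)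
    finally show ?thesis unfolding t' by simp
  qed
  define D where "D = (b - a) * F w - (b - w) * F a - (w - a) * F b"
  consider "w < a" | "w = a \<or> w = b" | "a < w" "w < b" | "b < w" using ab by linarith
  then show ?thesis unfolding D_def[symmetric]
  proof cases
    case 1
    have "D \<ge> 0" using conv3[of w b a] 1 S ab by (simp add: D_def algebra_simps)
    moreover have "(w - a) * (w - b) \<ge> 0" using 1 ab by (simp add: mult_nonpos_nonpos)
    ultimately show "0 \<le> D * ((w - a) * (w - b))" by simp
  next
    case 3
    have "D \<le> 0" using conv3[of a b w] 3 S ab by (simp add: D_def algebra_simps)
    moreover have "(w - a) * (w - b) \<le> 0" using 3 by (simp add: mult_nonneg_nonpos)
    ultimately show "0 \<le> D * ((w - a) * (w - b))" by (rule mult_nonpos_nonpos)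
  next
    case 4
    have "D \<ge> 0" using conv3[of a w b] 4 S ab by (simp add: D_def algebra_simps)
    moreover have "(w - a) * (w - b) \<ge> 0" using 4 ab by simp
    ultimately show "0 \<le> D * ((w - a) * (w - b))" by simp
  qed auto
qed

text \<open>The second difference integrates \<open>F\<close> against \<open>w\<^sup>k (w - w\<^sub>1) (w - w\<^sub>2)\<close>, a weight orthogonal to
  affine functions; so \<open>F\<close> may be replaced by its distance to the chord through \<open>w\<^sub>1, w\<^sub>2\<close>,
  which has the sign of the weight.\<close>

lemma ck_convex:
  assumes n: "n \<ge> 1" and F [measurable]: "F \<in> borel_measurable borel"
    and b: "\<And>w. w \<ge> 0 \<Longrightarrow> \<bar>F w\<bar> \<le> C * (1 + w) ^ l"
    and conv: "convex_on {0..} F"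
  shows "2 * ck n F (Suc k) \<le> ck n F k + ck n F (Suc (Suc k))"
proof -
  define m where "m = real n + 2 * k"
  \<comment> \<open>Relative to the law with weight \<open>w ^ k\<close>, the second difference has
    a kernel proportional to \<open>w^2 - 2 (m + 2) w + m (m + 2)\<close>, a Laguerre polynomial;
    \<open>w1\<close> and \<open>w2\<close> are its roots.\<close>
  define w1 w2 where "w1 = (m + 2) - sqrt (2 * (m + 2))" and "w2 = (m + 2) + sqrt (2 * (m + 2))"
  have m: "m > 0" using n by (simp add: m_def)
  have sq: "sqrt (2 * (m + 2)) * sqrt (2 * (m + 2)) = 2 * (m + 2)" using m by simp
  \<comment> \<open>This keeps the smaller root in the half-line on which \<open>F\<close> is
    convex.\<close>
  have "sqrt (2 * (m + 2)) \<le> m + 2"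
    using m by (intro real_le_lsqrt) (auto simp: power2_eq_square algebra_simps)
  then have w: "0 \<le> w1" "0 \<le> w2" "w1 < w2" using m by (auto simp: w1_def w2_def add_nonneg_nonneg)
  have prd: "w1 * w2 = m * (m + 2)"
    using sq unfolding w1_def w2_def by (simp add: algebra_simps)
  have sm: "w1 + w2 = 2 * (m + 2)" by (simp add: w1_def w2_def)
  have qu: "(x - w1) * (x - w2) = x\<^sup>2 - 2 * (m + 2) * x + m * (m + 2)" for x
    unfolding sm[symmetric] prd[symmetric] by (simp add: power2_eq_square algebra_simps)
  define \<alpha> \<beta> where "\<alpha> = w2 * F w1 - w1 * F w2" and "\<beta> = F w2 - F w1"
  let ?W = "\<lambda>z. dotp n z z"
  let ?I = "\<lambda>j. \<integral>z. F (?W z) * ?W z ^ j \<partial>stdg n"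
  define A where "A j z = F (?W z) * ?W z ^ j" for j z
  define M where "M j z = ?W z ^ j" for j z
  have iA: "integrable (stdg n) (A j)" and iM: "integrable (stdg n) (M j)" for j
    unfolding A_def[abs_def] M_def[abs_def] by (rule integrable_radial[OF F b], assumption, rule integrable_pow)
  have IA: "?I j = (\<integral>z. A j z \<partial>stdg n)" and IM: "mom n j = (\<integral>z. M j z \<partial>stdg n)" for j
    by (simp_all add: A_def M_def mom_def)
  have alg: "(x - 2 * (m + 2) * y + m * (m + 2) * u) / (m * (m + 2) * M) = x / ((m + 2) * (m * M)) - 2 * (y / (m * M)) + u / M"
    if "m > 0" "M > 0" for x y u m M :: real
    using that by (simp add: divide_simps)
  have "0 \<le> (\<integral>z. ((w2 - w1) * F (?W z) - \<alpha> - \<beta> * ?W z) * ((?W z)\<^sup>2 - 2 * (m + 2) * ?W z + m * (m + 2)) * ?W z ^ k \<partial>stdg n)"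
  proof (intro Bochner_Integration.integral_nonneg)
    fix z
    have e: "(w2 - w1) * F (?W z) - \<alpha> - \<beta> * ?W z = (w2 - w1) * F (?W z) - (w2 - ?W z) * F w1 - (?W z - w1) * F w2"
      by (simp add: \<alpha>_def \<beta>_def algebra_simps)
    have "((w2 - w1) * F (?W z) - \<alpha> - \<beta> * ?W z) * ((?W z)\<^sup>2 - 2 * (m + 2) * ?W z + m * (m + 2)) \<ge> 0"
      unfolding e qu[symmetric] by (rule convex_on_chord_sign[OF conv]) (use w in auto)
    then show "0 \<le> ((w2 - w1) * F (?W z) - \<alpha> - \<beta> * ?W z) * ((?W z)\<^sup>2 - 2 * (m + 2) * ?W z + m * (m + 2)) * ?W z ^ k"
      by simp
  qed
  also have "\<dots> = (\<integral>z. (w2 - w1) * (A (k + 2) z - 2 * (m + 2) * A (k + 1) z + m * (m + 2) * A k z)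
      - \<alpha> * (M (k + 2) z - 2 * (m + 2) * M (k + 1) z + m * (m + 2) * M k z)
      - \<beta> * (M (k + 3) z - 2 * (m + 2) * M (k + 2) z + m * (m + 2) * M (k + 1) z) \<partial>stdg n)"
    unfolding A_def M_def
    by (intro Bochner_Integration.integral_cong refl) (simp add: algebra_simps power_add power2_eq_square power3_eq_cube)
  also have "\<dots> = (w2 - w1) * (?I (k + 2) - 2 * (m + 2) * ?I (k + 1) + m * (m + 2) * ?I k)
      - \<alpha> * (mom n (k + 2) - 2 * (m + 2) * mom n (k + 1) + m * (m + 2) * mom n k)
      - \<beta> * (mom n (k + 3) - 2 * (m + 2) * mom n (k + 2) + m * (m + 2) * mom n (k + 1))"
    unfolding IA IM using iA iM by (simp del: distrib_left_numeral)
  also have "mom n (k + 1) = m * mom n k" by (simp add: mom_Suc m_def)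
  also have "mom n (k + 2) = (m + 2) * (m * mom n k)" by (simp add: mom_Suc m_def numeral_2_eq_2)
  also have "mom n (k + 3) = (m + 4) * ((m + 2) * (m * mom n k))" by (simp add: mom_Suc m_def numeral_3_eq_3 algebra_simps)
  also have "(m + 2) * (m * mom n k) - 2 * (m + 2) * (m * mom n k) + m * (m + 2) * mom n k = 0" by (simp add: algebra_simps)
  also have "(m + 4) * ((m + 2) * (m * mom n k)) - 2 * (m + 2) * ((m + 2) * (m * mom n k)) + m * (m + 2) * (m * mom n k) = 0"
    by (simp add: algebra_simps)
  finally have "0 \<le> (w2 - w1) * (?I (k + 2) - 2 * (m + 2) * ?I (k + 1) + m * (m + 2) * ?I k)" by simp
  then have "0 \<le> ?I (k + 2) - 2 * (m + 2) * ?I (k + 1) + m * (m + 2) * ?I k"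
    using w by (simp add: zero_le_mult_iff)
  then have "0 \<le> (?I (k + 2) - 2 * (m + 2) * ?I (k + 1) + m * (m + 2) * ?I k) / (m * (m + 2) * mom n k)"
    using m mom_pos[OF n, of k] by (intro divide_nonneg_pos) auto
  also have "\<dots> = ?I (k + 2) / ((m + 2) * (m * mom n k)) - 2 * (?I (k + 1) / (m * mom n k)) + ?I k / mom n k"
    using m mom_pos[OF n, of k] by (intro alg) auto
  also have "\<dots> = ck n F (Suc (Suc k)) - 2 * ck n F (Suc k) + ck n F k"
    by (simp add: ck_def mom_Suc m_def add_ac)
  finally show ?thesis by simp
qed

text \<open>Convexity makes the increments nondecreasing, so the mean slope from \<open>0\<close>
  grows with the endpoint. The factor \<open>k\<close> replaces a division and lets the statement
  cover \<open>k = 0\<close>.\<close>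

lemma convex_seq_chord:
  fixes b :: "nat \<Rightarrow> real"
  assumes conv: "\<And>k. 2 * b (Suc k) \<le> b k + b (Suc (Suc k))" and j: "j \<le> k"
  shows "real k * b j \<le> (real k - real j) * b 0 + real j * b k"
proof -
  have mono: "b (Suc i) - b i \<le> b (Suc l) - b l" if "i \<le> l" for i l
    using that
  proof (induction l rule: dec_induct)
    case (step l)
    then show ?case using conv[of l] by linarith
  qed simp
  have A: "b l - b 0 \<le> real l * (b (Suc l) - b l)" for l
  proof -
    have "b l - b 0 = (\<Sum>i<l. b (Suc i) - b i)" by (simp add: sum_lessThan_telescope)
    also have "\<dots> \<le> (\<Sum>i<l. b (Suc l) - b l)" by (intro sum_mono mono) auto
    finally show ?thesis by simp
  qed
  have "real k * (b j - b 0) \<le> real j * (b k - b 0)" using j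
  proof (induction k rule: dec_induct)
    case (step l)
    show ?case
    proof (cases "l = 0")
      case True
      then show ?thesis using step by simp
    next
      case False
      have "real l * (real (Suc l) * (b j - b 0)) \<le> real (Suc l) * (real j * (b l - b 0))"
        using mult_left_mono[OF step.IH, of "real (Suc l)"] by (simp add: mult_ac)
      also have "\<dots> = real j * (real (Suc l) * (b l - b 0))" by (simp add: mult_ac)
      also have "\<dots> \<le> real j * (real l * (b (Suc l) - b 0))"
        using A[of l] by (intro mult_left_mono) (auto simp: algebra_simps)
      finally have "real l * (real (Suc l) * (b j - b 0)) \<le> real l * (real j * (b (Suc l) - b 0))" by (simp add: mult_ac)
      then show ?thesis using False by simp
    qed
  qed simp
  then show ?thesis by (simp add: algebra_simps)
qed

text \<open>Bernstein polynomials are binomial weights with total mass one and mean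
  \<open>k \<theta>\<close>; averaging the chord bound therefore evaluates the chord at
  \<open>k \<theta>\<close>.\<close>

lemma Bernstein_convex_le:
  fixes b :: "nat \<Rightarrow> real"
  assumes conv: "\<And>k. 2 * b (Suc k) \<le> b k + b (Suc (Suc k))" and \<theta>: "0 \<le> \<theta>" "\<theta> \<le> 1"
  shows "(\<Sum>j\<le>k. Bernstein k j \<theta> * b j) \<le> (1 - \<theta>) * b 0 + \<theta> * b k"
proof (cases "k = 0")
  case True
  then show ?thesis by (simp add: Bernstein_def algebra_simps)
next
  case False
  have "real k * (\<Sum>j\<le>k. Bernstein k j \<theta> * b j) = (\<Sum>j\<le>k. Bernstein k j \<theta> * (real k * b j))"
    by (simp add: sum_distrib_left mult_ac)
  also have "\<dots> \<le> (\<Sum>j\<le>k. Bernstein k j \<theta> * ((real k - real j) * b 0 + real j * b k))"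
    using \<theta> by (intro sum_mono mult_left_mono convex_seq_chord[of b, OF conv] Bernstein_nonneg) auto
  also have "\<dots> = (\<Sum>j\<le>k. (real k * b 0) * Bernstein k j \<theta> + (b k - b 0) * (real j * Bernstein k j \<theta>))"
    by (intro sum.cong refl) (simp add: algebra_simps)
  also have "\<dots> = real k * b 0 * (\<Sum>j\<le>k. Bernstein k j \<theta>) + (b k - b 0) * (\<Sum>j\<le>k. real j * Bernstein k j \<theta>)"
    by (simp only: sum.distrib sum_distrib_left)
  also have "\<dots> = real k * ((1 - \<theta>) * b 0 + \<theta> * b k)" by (simp add: algebra_simps)
  finally show ?thesis using False by simp
qed

lemma Bernstein_mono_le:
  fixes b :: "nat \<Rightarrow> real"
  assumes mono: "\<And>k. b k \<le> b (Suc k)" and \<theta>: "0 \<le> \<theta>" "\<theta> \<le> 1"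
  shows "(\<Sum>j\<le>k. Bernstein k j \<theta> * b j) \<le> b k"
proof -
  have le: "b j \<le> b k" if "j \<le> k" for j
    by (rule lift_Suc_mono_le[of b, OF mono that])
  have "(\<Sum>j\<le>k. Bernstein k j \<theta> * b j) \<le> (\<Sum>j\<le>k. Bernstein k j \<theta> * b k)"
    using \<theta> by (intro sum_mono mult_left_mono le Bernstein_nonneg) auto
  also have "\<dots> = b k" by (simp add: sum_distrib_right[symmetric])
  finally show ?thesis .
qed

section \<open>Chord and monotonicity inequalities for Poisson means\<close>

definition poisson_mean :: "(nat \<Rightarrow> real) \<Rightarrow> real \<Rightarrow> real" where
  "poisson_mean b \<mu> = exp (- \<mu>) * (\<Sum>k. b k * \<mu> ^ k / fact k)"

text \<open>A Poisson variable of mean \<open>\<theta> \<mu>\<close> is a binomial thinning of one of mean \<open>\<mu>\<close>.\<close>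

lemma poisson_thinning:
  assumes s: "\<And>\<mu>. summable (\<lambda>k. \<bar>b k\<bar> * \<bar>\<mu>\<bar> ^ k / fact k)"
  shows "(\<lambda>k. (\<Sum>j\<le>k. Bernstein k j \<theta> * b j) * \<mu> ^ k / fact k) sums (exp \<mu> * poisson_mean b (\<theta> * \<mu>))"
proof -
  let ?a = "\<lambda>j. b j * (\<theta> * \<mu>) ^ j / fact j" and ?c = "\<lambda>i. ((1 - \<theta>) * \<mu>) ^ i / fact i"
  have "summable (\<lambda>j. norm (?a j))"
    using s[of "\<theta> * \<mu>"] by (simp add: abs_mult power_abs power_mult_distrib)
  moreover have "summable (\<lambda>i. norm (?c i))"
    using exp_real_sums[of "\<bar>(1 - \<theta>) * \<mu>\<bar>"] by (simp add: sums_iff abs_mult power_abs)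
  ultimately have "(\<lambda>k. \<Sum>j\<le>k. ?a j * ?c (k - j)) sums ((\<Sum>j. ?a j) * (\<Sum>i. ?c i))"
    by (rule Cauchy_product_sums)
  moreover have "(\<Sum>i. ?c i) = exp ((1 - \<theta>) * \<mu>)"
    using exp_real_sums[of "(1 - \<theta>) * \<mu>"] by (simp add: sums_iff)
  moreover have "(\<Sum>j\<le>k. ?a j * ?c (k - j)) = (\<Sum>j\<le>k. Bernstein k j \<theta> * b j) * \<mu> ^ k / fact k" for k
    unfolding sum_distrib_right sum_divide_distrib
  proof (intro sum.cong refl)
    fix j assume "j \<in> {..k}"
    then have j: "j \<le> k" by simp
    have p: "\<mu> ^ j * \<mu> ^ (k - j) = \<mu> ^ k" using j by (simp flip: power_add)
    have "?a j * ?c (k - j) = b j * (\<theta> ^ j * (1 - \<theta>) ^ (k - j)) * (\<mu> ^ j * \<mu> ^ (k - j)) / (fact j * fact (k - j))"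
      by (simp only: power_mult_distrib times_divide_times_eq mult_ac)
    also have "\<dots> = Bernstein k j \<theta> * b j * \<mu> ^ k / fact k"
      unfolding p using j by (simp add: Bernstein_def binomial_fact)
    finally show "?a j * ?c (k - j) = Bernstein k j \<theta> * b j * \<mu> ^ k / fact k" .
  qed
  moreover have "(\<Sum>j. ?a j) * exp ((1 - \<theta>) * \<mu>) = exp \<mu> * poisson_mean b (\<theta> * \<mu>)"
  proof -
    have "exp ((1 - \<theta>) * \<mu>) = exp \<mu> * exp (- (\<theta> * \<mu>))"
      unfolding mult_exp_exp by (simp add: left_diff_distrib)
    then show ?thesis by (simp add: poisson_mean_def)
  qed
  ultimately show ?thesis by simp
qed

lemma poisson_mean_sums:
  assumes s: "\<And>\<mu>. summable (\<lambda>k. \<bar>b k\<bar> * \<bar>\<mu>\<bar> ^ k / fact k)"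
  shows "(\<lambda>k. b k * \<mu> ^ k / fact k) sums (exp \<mu> * poisson_mean b \<mu>)"
proof -
  have "summable (\<lambda>k. norm (b k * \<mu> ^ k / fact k))"
    using s[of \<mu>] by (simp add: abs_mult power_abs)
  then have "summable (\<lambda>k. b k * \<mu> ^ k / fact k)" by (rule summable_norm_cancel)
  moreover have "exp \<mu> * poisson_mean b \<mu> = (\<Sum>k. b k * \<mu> ^ k / fact k)"
    unfolding poisson_mean_def mult.assoc[symmetric] mult_exp_exp by simp
  ultimately show ?thesis by (simp add: summable_sums)
qed

text \<open>After thinning, the entry of index \<open>k\<close> is a binomial mean of
  \<open>b\<close>, bounded by the chord from \<open>b 0\<close> to \<open>b k\<close>. Summation
  against the Poisson weights keeps \<open>b 0\<close> and turns \<open>b k\<close> into the mean at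
  \<open>\<mu>\<close>.\<close>

lemma poisson_mean_convex:
  assumes s: "\<And>\<mu>. summable (\<lambda>k. \<bar>b k\<bar> * \<bar>\<mu>\<bar> ^ k / fact k)"
    and conv: "\<And>k. 2 * b (Suc k) \<le> b k + b (Suc (Suc k))" and \<theta>: "0 \<le> \<theta>" "\<theta> \<le> 1" and \<mu>: "\<mu> \<ge> 0"
  shows "poisson_mean b (\<theta> * \<mu>) \<le> (1 - \<theta>) * b 0 + \<theta> * poisson_mean b \<mu>"
proof -
  have S: "(\<lambda>k. (1 - \<theta>) * b 0 * (\<mu> ^ k / fact k) + \<theta> * (b k * \<mu> ^ k / fact k)) sums
      ((1 - \<theta>) * b 0 * exp \<mu> + \<theta> * (exp \<mu> * poisson_mean b \<mu>))"
    by (intro sums_add sums_mult exp_real_sums poisson_mean_sums s)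
  have L: "(\<Sum>j\<le>k. Bernstein k j \<theta> * b j) * \<mu> ^ k / fact k \<le> (1 - \<theta>) * b 0 * (\<mu> ^ k / fact k) + \<theta> * (b k * \<mu> ^ k / fact k)" for k
    using mult_right_mono[OF Bernstein_convex_le[of b, OF conv \<theta>, of k], of "\<mu> ^ k / fact k"] \<mu>
    by (simp add: distrib_right mult.assoc add_divide_distrib)
  have "exp \<mu> * poisson_mean b (\<theta> * \<mu>) \<le> (1 - \<theta>) * b 0 * exp \<mu> + \<theta> * (exp \<mu> * poisson_mean b \<mu>)"
    by (rule sums_le[OF L poisson_thinning[OF s] S])
  also have "\<dots> = exp \<mu> * ((1 - \<theta>) * b 0 + \<theta> * poisson_mean b \<mu>)" by (simp add: algebra_simps)
  finally show ?thesis by simp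
qed

text \<open>Thinning with ratio \<open>\<nu> / \<mu>\<close>: a binomial mean of a nondecreasing
  sequence is at most its last entry.\<close>

lemma poisson_mean_mono:
  assumes s: "\<And>\<mu>. summable (\<lambda>k. \<bar>b k\<bar> * \<bar>\<mu>\<bar> ^ k / fact k)"
    and mono: "\<And>k. b k \<le> b (Suc k)" and \<mu>: "0 \<le> \<nu>" "\<nu> \<le> \<mu>"
  shows "poisson_mean b \<nu> \<le> poisson_mean b \<mu>"
proof (cases "\<mu> = 0")
  case False
  define \<theta> where "\<theta> = \<nu> / \<mu>"
  have \<theta>: "0 \<le> \<theta>" "\<theta> \<le> 1" "\<theta> * \<mu> = \<nu>" using \<mu> False by (auto simp: \<theta>_def)
  have L: "(\<Sum>j\<le>k. Bernstein k j \<theta> * b j) * \<mu> ^ k / fact k \<le> b k * \<mu> ^ k / fact k" for k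
    using mult_right_mono[OF Bernstein_mono_le[of b, OF mono \<theta>(1,2), of k], of "\<mu> ^ k / fact k"] \<mu> by simp
  have "exp \<mu> * poisson_mean b (\<theta> * \<mu>) \<le> exp \<mu> * poisson_mean b \<mu>"
    by (rule sums_le[OF L poisson_thinning[OF s] poisson_mean_sums[OF s]])
  then show ?thesis by (simp add: \<theta>(3))
qed (use \<mu> in auto)

lemma summable_linear_exp:
  assumes "\<And>k. \<bar>b k\<bar> \<le> C * (1 + real k)"
  shows "summable (\<lambda>k. \<bar>b k\<bar> * \<bar>\<mu>\<bar> ^ k / fact k)"
proof (rule summable_comparison_test')
  have C: "C \<ge> 0" using assms[of 0] by simp
  show "summable (\<lambda>k. C * ((2 * \<bar>\<mu>\<bar>) ^ k / fact k))"
    using exp_real_sums[of "2 * \<bar>\<mu>\<bar>"] by (intro summable_mult) (simp add: sums_iff)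
  fix k
  have "real (Suc k) \<le> real (2 ^ k)" using less_exp[of k] by (simp only: of_nat_le_iff Suc_le_eq)
  then have "1 + real k \<le> 2 ^ k" by simp
  then have "\<bar>b k\<bar> \<le> C * 2 ^ k" using order_trans[OF assms[of k] mult_left_mono[OF _ C]] by simp
  then have "\<bar>b k\<bar> * (\<bar>\<mu>\<bar> ^ k / fact k) \<le> C * 2 ^ k * (\<bar>\<mu>\<bar> ^ k / fact k)" by (rule mult_right_mono) simp
  then show "norm (\<bar>b k\<bar> * \<bar>\<mu>\<bar> ^ k / fact k) \<le> C * ((2 * \<bar>\<mu>\<bar>) ^ k / fact k)"
    by (simp add: power_mult_distrib mult_ac)
qed

section \<open>Mean-square error of the radial estimator\<close>

lemma measure_stdg_space [simp]: "measure (stdg n) (space (Rn n)) = 1"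
  using prob_space.prob_space[OF prob_space_gauss, of 1 n] by simp

text \<open>For \<open>a = R^2 r^2\<close>, the vector \<open>gam n a (dotp n y y) * y\<close> is
  the conditional mean of \<open>r X\<close> given \<open>r X + Z = y\<close> when \<open>X\<close>
  is uniform on the sphere of radius \<open>R\<close>; by \<open>gam_sq\<close> its squared norm is
  \<open>a * Ha n a (dotp n y y)\<close>.\<close>

definition gam :: "nat \<Rightarrow> real \<Rightarrow> real \<Rightarrow> real" where "gam n a w = a * qf n (a * w)"
definition Ha :: "nat \<Rightarrow> real \<Rightarrow> real \<Rightarrow> real" where "Ha n a w = Hf n (a * w)"

text \<open>For \<open>a = R\<^sup>2 r\<^sup>2\<close>, \<open>psi n a \<nu>\<close> is \<open>r\<^sup>2\<close> times the mean-square error of the Bayes estimator of the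
  sphere of radius \<open>R\<close> when the actual input \<open>x\<close> has \<open>r\<^sup>2 \<bar>x\<bar>\<^sup>2 = \<nu>\<close>.\<close>

definition bk :: "nat \<Rightarrow> real \<Rightarrow> nat \<Rightarrow> real" where
  "bk n a k = 2 * k - 4 * k * ck n (gam n a) k + a * ck n (Ha n a) k"

definition psi :: "nat \<Rightarrow> real \<Rightarrow> real \<Rightarrow> real" where
  "psi n a \<nu> = poisson_mean (bk n a) (\<nu> / 2)"

lemma measurable_gam [measurable]: "gam n a \<in> borel_measurable borel" "Ha n a \<in> borel_measurable borel"
  unfolding gam_def[abs_def] Ha_def[abs_def] by measurable

lemma abs_gam_le: "n \<ge> 1 \<Longrightarrow> a \<ge> 0 \<Longrightarrow> w \<ge> 0 \<Longrightarrow> \<bar>gam n a w\<bar> \<le> a"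
  using qf_le_1[of n "a * w"] qf_pos[of n "a * w"] by (simp add: gam_def abs_mult mult_left_le)

lemma abs_Ha_le: "n \<ge> 1 \<Longrightarrow> a \<ge> 0 \<Longrightarrow> w \<ge> 0 \<Longrightarrow> \<bar>Ha n a w\<bar> \<le> 1"
  using Hf_nonneg[of n "a * w"] Hf_le_1[of n "a * w"] by (simp add: Ha_def)

lemma gam_sq: "w * (gam n a w)\<^sup>2 = a * Ha n a w"
  by (simp add: gam_def Ha_def Hf_def power2_eq_square algebra_simps)

lemma exp_first_moment_sums: "(\<lambda>k. real k * \<mu> ^ k / fact k) sums (\<mu> * exp (\<mu>::real))"
proof -
  have "(\<lambda>k. \<mu> * (\<mu> ^ k / fact k)) sums (\<mu> * exp \<mu>)"
    by (rule sums_mult[OF exp_real_sums])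
  moreover have "\<mu> * (\<mu> ^ k / fact k) = real (Suc k) * \<mu> ^ Suc k / fact (Suc k)" for k
    by (simp add: fact_Suc del: of_nat_Suc)
  ultimately have "(\<lambda>k. real (Suc k) * \<mu> ^ Suc k / fact (Suc k)) sums (\<mu> * exp \<mu>)" by simp
  then show ?thesis by (subst (asm) sums_Suc_iff) simp
qed

lemma abs_dotp_sq_le: "\<bar>dotp n \<xi> z\<bar> \<le> (1 + vnorm n \<xi>) * (1 + (vnorm n z)\<^sup>2)"
proof -
  have "v \<le> 1 + v\<^sup>2" for v :: real
    using zero_le_power2[of "v - 1 / 2"] by (simp add: power2_eq_square algebra_simps)
  then have "vnorm n \<xi> * vnorm n z \<le> (1 + vnorm n \<xi>) * (1 + (vnorm n z)\<^sup>2)"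
    by (intro mult_mono) auto
  then show ?thesis using dotp_Cauchy_Schwarz[of n \<xi> z] by linarith
qed

context
  fixes n :: nat and a :: real assumes n: "n \<ge> 1" and a: "a \<ge> 0"
begin

text \<open>With \<open>\<xi> = r x\<close> the integrand is the squared distance from
  \<open>\<xi>\<close> to its estimate. Translation moves the shift into an exponential weight; the
  three terms of \<open>bk\<close> are the Poisson coefficients of the squared norm, the cross term
  and the squared estimate.\<close>

lemma estimation_error:
  "(\<integral>z. dotp n \<xi> \<xi> - 2 * gam n a (dotp n (affmap n \<xi> 1 z) (affmap n \<xi> 1 z)) * dotp n \<xi> (affmap n \<xi> 1 z)
      + a * Ha n a (dotp n (affmap n \<xi> 1 z) (affmap n \<xi> 1 z)) \<partial>stdg n) = psi n a (dotp n \<xi> \<xi>)"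
proof -
  define \<nu> where "\<nu> = dotp n \<xi> \<xi>"
  let ?G = "\<lambda>z. gam n a (dotp n z z)" and ?H = "\<lambda>z. Ha n a (dotp n z z)" and ?E = "\<lambda>z. exp (dotp n \<xi> z)"
  have I1: "integrable (stdg n) ?E"
    by (rule integrable_stdg_bound[where C=1 and k=0 and \<rho>="vnorm n \<xi>"]) 
       (use dotp_Cauchy_Schwarz[of n \<xi>] in \<open>auto simp: abs_le_iff\<close>)
  have Eb: "?E z \<le> exp (vnorm n \<xi> * vnorm n z)" for z
    using dotp_Cauchy_Schwarz[of n \<xi> z] by (simp add: abs_le_iff)
  have I2: "integrable (stdg n) (\<lambda>z. ?G z * dotp n \<xi> z * ?E z)"
  proof (rule integrable_stdg_bound[where C="a * (1 + vnorm n \<xi>)" and k=1 and \<rho>="vnorm n \<xi>"])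
    fix z
    have "\<bar>?G z\<bar> * \<bar>dotp n \<xi> z\<bar> * ?E z \<le> a * ((1 + vnorm n \<xi>) * (1 + (vnorm n z)\<^sup>2)) * exp (vnorm n \<xi> * vnorm n z)"
      using abs_gam_le[OF n a, of "dotp n z z"] abs_dotp_sq_le[of n \<xi> z] Eb[of z] a
      by (intro mult_mono) auto
    then show "\<bar>?G z * dotp n \<xi> z * ?E z\<bar> \<le> a * (1 + vnorm n \<xi>) * (1 + (vnorm n z)\<^sup>2) ^ 1 * exp (vnorm n \<xi> * vnorm n z)"
      by (simp add: abs_mult mult_ac)
  qed measurable
  have I3: "integrable (stdg n) (\<lambda>z. ?H z * ?E z)"
  proof (rule integrable_stdg_bound[where C=1 and k=0 and \<rho>="vnorm n \<xi>"])
    fix z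
    have "\<bar>?H z\<bar> * ?E z \<le> 1 * exp (vnorm n \<xi> * vnorm n z)"
      using abs_Ha_le[OF n a, of "dotp n z z"] Eb[of z] by (intro mult_mono) auto
    then show "\<bar>?H z * ?E z\<bar> \<le> 1 * (1 + (vnorm n z)\<^sup>2) ^ 0 * exp (vnorm n \<xi> * vnorm n z)"
      by (simp add: abs_mult)
  qed measurable
  have "(\<integral>z. \<nu> - 2 * gam n a (dotp n (affmap n \<xi> 1 z) (affmap n \<xi> 1 z)) * dotp n \<xi> (affmap n \<xi> 1 z)
      + a * Ha n a (dotp n (affmap n \<xi> 1 z) (affmap n \<xi> 1 z)) \<partial>stdg n)
     = (\<integral>z. (\<nu> - 2 * ?G z * dotp n \<xi> z + a * ?H z) * exp (dotp n \<xi> z - \<nu> / 2) \<partial>stdg n)"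
    unfolding \<nu>_def by (rule integral_stdg_translate) measurable
  also have "\<dots> = (\<integral>z. exp (- (\<nu> / 2)) * (\<nu> * ?E z - 2 * (?G z * dotp n \<xi> z * ?E z) + a * (?H z * ?E z)) \<partial>stdg n)"
  proof (intro Bochner_Integration.integral_cong refl)
    fix z
    have "exp (dotp n \<xi> z - \<nu> / 2) = exp (- (\<nu> / 2)) * ?E z" by (simp add: mult_exp_exp)
    then show "(\<nu> - 2 * ?G z * dotp n \<xi> z + a * ?H z) * exp (dotp n \<xi> z - \<nu> / 2)
       = exp (- (\<nu> / 2)) * (\<nu> * ?E z - 2 * (?G z * dotp n \<xi> z * ?E z) + a * (?H z * ?E z))"
      by (simp add: algebra_simps)
  qed
  also have "\<dots> = exp (- (\<nu> / 2)) * (\<nu> * (\<integral>z. ?E z \<partial>stdg n) - 2 * (\<integral>z. ?G z * dotp n \<xi> z * ?E z \<partial>stdg n) + a * (\<integral>z. ?H z * ?E z \<partial>stdg n))"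
    using I1 I2 I3 by simp
  also have "\<dots> = psi n a \<nu>"
  proof -
    have "(\<lambda>k. 2 * (real k * (\<nu> / 2) ^ k / fact k) - 2 * (2 * k * ck n (gam n a) k * (\<nu> / 2) ^ k / fact k)
        + a * (ck n (Ha n a) k * (\<nu> / 2) ^ k / fact k)) sums
        (2 * (\<nu> / 2 * exp (\<nu> / 2)) - 2 * (\<integral>z. ?G z * dotp n \<xi> z * ?E z \<partial>stdg n) + a * (\<integral>z. ?H z * ?E z \<partial>stdg n))"
      unfolding \<nu>_def
      by (intro sums_add sums_diff sums_mult exp_first_moment_sums radial_dotp_exp_sums[OF n, where C=a] radial_exp_sums[OF n, where C=1])
         (use abs_gam_le[OF n a] abs_Ha_le[OF n a] in \<open>auto intro: order_trans[of _ 1]\<close>)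
    moreover have "2 * (real k * (\<nu> / 2) ^ k / fact k) - 2 * (2 * k * ck n (gam n a) k * (\<nu> / 2) ^ k / fact k)
        + a * (ck n (Ha n a) k * (\<nu> / 2) ^ k / fact k) = bk n a k * (\<nu> / 2) ^ k / fact k" for k
      by (simp add: bk_def algebra_simps add_divide_distrib diff_divide_distrib)
    moreover have "(\<integral>z. ?E z \<partial>stdg n) = exp (\<nu> / 2)" by (simp add: exp_dotp_integral \<nu>_def)
    ultimately show ?thesis by (simp add: psi_def poisson_mean_def sums_iff)
  qed
  finally show ?thesis by (simp add: \<nu>_def)
qed

text \<open>The mixture form of the noncentral chi-square law; \<open>ck\<close> is the mean of
  \<open>F\<close> given the Poisson index.\<close>

lemma radial_mean_poisson:
  assumes F [measurable]: "F \<in> borel_measurable borel" and b: "\<And>w. w \<ge> 0 \<Longrightarrow> \<bar>F w\<bar> \<le> C"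
  shows "(\<integral>z. F (dotp n (affmap n \<xi> 1 z) (affmap n \<xi> 1 z)) \<partial>stdg n) = poisson_mean (ck n F) (dotp n \<xi> \<xi> / 2)"
proof -
  have C: "C \<ge> 0" using b[of 0] by simp
  have b': "\<bar>F w\<bar> \<le> C * (1 + w)" if "w \<ge> 0" for w
    using b[OF that] mult_left_mono[of 1 "1 + w" C] C that by simp
  have "(\<integral>z. F (dotp n (affmap n \<xi> 1 z) (affmap n \<xi> 1 z)) \<partial>stdg n)
     = (\<integral>z. F (dotp n z z) * exp (dotp n \<xi> z - dotp n \<xi> \<xi> / 2) \<partial>stdg n)"
    by (rule integral_stdg_translate) measurable
  also have "\<dots> = exp (- (dotp n \<xi> \<xi> / 2)) * (\<integral>z. F (dotp n z z) * exp (dotp n \<xi> z) \<partial>stdg n)"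
  proof -
    have e: "exp (dotp n \<xi> z - dotp n \<xi> \<xi> / 2) = exp (- (dotp n \<xi> \<xi> / 2)) * exp (dotp n \<xi> z)" for z
      by (simp add: mult_exp_exp)
    show ?thesis unfolding e mult.left_commute[of "F _"] by simp
  qed
  also have "\<dots> = poisson_mean (ck n F) (dotp n \<xi> \<xi> / 2)"
    using radial_exp_sums[OF n F b', of \<xi>] by (simp add: poisson_mean_def sums_iff)
  finally show ?thesis .
qed

text \<open>Stein's identity combined with the Riccati equation \<open>2 t q' = 1 - n q - t q\<^sup>2\<close>.\<close>

lemma ck_gam: "2 * k * ck n (gam n a) k = a * ck n (Ha n a) k - a + ck n (\<lambda>w. pf n (a * w)) k"
proof -
  let ?W = "\<lambda>z. dotp n z z"
  \<comment> \<open>The factor \<open>w ^ k\<close> makes Stein's identity for the standard Gaussian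
    act as the one for \<open>n + 2 k\<close> degrees of freedom.\<close>
  let ?F = "\<lambda>w::real. w ^ k * gam n a w" and ?F' = "\<lambda>w::real. real k * w ^ (k - 1) * gam n a w + w ^ k * (a * (a * qd n (a * w)))"
  let ?C = "(1 + real k) * (a + a * a)"
  have stein: "(\<integral>z. 2 * ?W z * ?F' (?W z) \<partial>stdg n) = (\<integral>z. (?W z - n) * ?F (?W z) \<partial>stdg n)"
  proof (rule stein_chi_square[where C="?C" and k=k])
    show "?F \<in> borel_measurable borel" "?F' \<in> borel_measurable borel" by measurable
    fix w :: real assume w: "w \<ge> 0"
    have "((\<lambda>w. qf n (a * w)) has_real_derivative qd n (a * w) * a) (at w within {0..})"
      by (rule DERIV_chain2[OF DERIV_qf[OF n]]) (use a w in \<open>auto intro!: derivative_eq_intros\<close>)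
    then have "((\<lambda>w. gam n a w) has_real_derivative a * (a * qd n (a * w))) (at w within {0..})"
      unfolding gam_def by (auto intro!: derivative_eq_intros)
    then show "(?F has_real_derivative ?F' w) (at w within {0..})"
      by (auto intro!: derivative_eq_intros)
    have p1: "w ^ k \<le> (1 + w) ^ k" using w by (intro power_mono) auto
    have "w ^ (k - 1) \<le> (1 + w) ^ (k - 1)" using w by (intro power_mono) auto
    also have "\<dots> \<le> (1 + w) ^ k" using w by (intro power_increasing) auto
    finally have p2: "w ^ (k - 1) \<le> (1 + w) ^ k" .
    have "\<bar>?F w\<bar> \<le> (1 + w) ^ k * a"
      unfolding abs_mult using p1 w abs_gam_le[OF n a w] by (intro mult_mono) auto
    also have "\<dots> \<le> (1 + w) ^ k * ?C"
      using a w by (intro mult_left_mono) (auto simp: algebra_simps)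
    finally show "\<bar>?F w\<bar> \<le> ?C * (1 + w) ^ k" by (simp only: mult.commute)
    have "\<bar>k * w ^ (k - 1) * gam n a w\<bar> \<le> k * (1 + w) ^ k * a"
      unfolding abs_mult using p2 w abs_gam_le[OF n a w] by (intro mult_mono) auto
    moreover have "\<bar>w ^ k * (a * (a * qd n (a * w)))\<bar> \<le> (1 + w) ^ k * (a * (a * 1))"
      unfolding abs_mult using p1 w a abs_qd_le_1[OF n, of "a * w"] by (intro mult_mono) auto
    ultimately have "\<bar>?F' w\<bar> \<le> k * (1 + w) ^ k * a + (1 + w) ^ k * (a * (a * 1))" by linarith
    also have "\<dots> = (k * a + a * a) * (1 + w) ^ k" by (simp add: algebra_simps)
    also have "\<dots> \<le> ?C * (1 + w) ^ k"
      using a w by (intro mult_right_mono) (auto simp: algebra_simps)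
    finally show "\<bar>?F' w\<bar> \<le> ?C * (1 + w) ^ k" .
  qed
  define A where "A z = gam n a (?W z) * ?W z ^ k" for z
  define P where "P z = pf n (a * ?W z) * ?W z ^ k" for z
  define H where "H z = Ha n a (?W z) * ?W z ^ k" for z
  define M where "M z = ?W z ^ k" for z
  have iA: "integrable (stdg n) A" unfolding A_def[abs_def]
    by (rule integrable_radial[where C=a and l=0]) (use abs_gam_le[OF n a] in auto)
  have iH: "integrable (stdg n) H" unfolding H_def[abs_def]
    by (rule integrable_radial[where C=1 and l=0]) (use abs_Ha_le[OF n a] in auto)
  have iP: "integrable (stdg n) P" unfolding P_def[abs_def]
  proof (rule integrable_radial[where C=a and l=1 and F="\<lambda>w. pf n (a * w)"])
    fix w :: real assume w: "w \<ge> 0"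
    have "a * w * qf n (a * w) \<le> a * w * 1" using a w qf_le_1[OF n, of "a * w"] by (intro mult_left_mono) auto
    moreover have "a * w * qf n (a * w) \<ge> 0" using a w qf_pos[OF n, of "a * w"] by (intro mult_nonneg_nonneg) auto
    ultimately show "\<bar>pf n (a * w)\<bar> \<le> a * (1 + w) ^ 1" using a by (simp add: pf_def algebra_simps)
  qed measurable
  have iM: "integrable (stdg n) M" unfolding M_def[abs_def] by (rule integrable_pow)
  have "2 * ?W z * ?F' (?W z) = 2 * k * A z + a * M z - n * A z - a * H z" for z
  proof -
    have "2 * (a * ?W z) * qd n (a * ?W z) = 1 - n * qf n (a * ?W z) - Hf n (a * ?W z)"
      using qd_eq[OF n, of "a * ?W z"] a Hf_eq[OF n, of "a * ?W z"] by (simp add: algebra_simps)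
    then have q: "?W z ^ k * (a * (2 * (a * ?W z) * qd n (a * ?W z))) = ?W z ^ k * (a * (1 - n * qf n (a * ?W z) - Hf n (a * ?W z)))"
      by simp
    have "2 * ?W z * (k * ?W z ^ (k - 1) * gam n a (?W z)) = 2 * k * A z"
      by (cases k) (simp_all add: A_def)
    moreover have "2 * ?W z * (?W z ^ k * (a * (a * qd n (a * ?W z)))) = a * M z - n * A z - a * H z"
      using q by (simp add: A_def M_def H_def gam_def Ha_def algebra_simps)
    ultimately show ?thesis by (simp only: distrib_left)
  qed
  moreover have "(?W z - n) * ?F (?W z) = P z - n * A z" for z
    by (simp add: A_def P_def pf_def gam_def algebra_simps)
  ultimately have "(\<integral>z. 2 * k * A z + a * M z - n * A z - a * H z \<partial>stdg n) = (\<integral>z. P z - n * A z \<partial>stdg n)"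
    using stein by simp
  then have "2 * k * (\<integral>z. A z \<partial>stdg n) + a * (\<integral>z. M z \<partial>stdg n) - a * (\<integral>z. H z \<partial>stdg n) = (\<integral>z. P z \<partial>stdg n)"
    using iA iH iP iM by simp
  moreover have "(\<integral>z. M z \<partial>stdg n) = mom n k" by (simp add: M_def mom_def)
  ultimately have "2 * k * ((\<integral>z. A z \<partial>stdg n) / mom n k) + a - a * ((\<integral>z. H z \<partial>stdg n) / mom n k) = (\<integral>z. P z \<partial>stdg n) / mom n k"
    using mom_pos[OF n, of k] by (simp add: field_simps)
  then show ?thesis by (simp add: ck_def A_def H_def P_def)
qed

text \<open>What is left of \<open>bk\<close>, besides an affine term, once \<open>ck_gam\<close>
  has removed the cross term. The negations stand inside because \<open>- Hf\<close> and
  \<open>- pf\<close> are the functions known to be convex.\<close>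

definition Qf :: "real \<Rightarrow> real" where "Qf w = a * - Hf n (a * w) + 2 * - pf n (a * w)"

lemma convex_on_scaled: "convex_on {0..} f \<Longrightarrow> convex_on {0..} (\<lambda>w. f (a * w))" for f :: "real \<Rightarrow> real"
  unfolding convex_on_def
proof (intro conjI ballI allI impI)
  fix x y u v :: real
  assume f: "convex {0..} \<and> (\<forall>x\<in>{0..}. \<forall>y\<in>{0..}. \<forall>u\<ge>0. \<forall>v\<ge>0. u + v = 1 \<longrightarrow> f (u *\<^sub>R x + v *\<^sub>R y) \<le> u * f x + v * f y)"
    and "x \<in> {0..}" "y \<in> {0..}" "u \<ge> 0" "v \<ge> 0" "u + v = 1"
  then have "f (u *\<^sub>R (a * x) + v *\<^sub>R (a * y)) \<le> u * f (a * x) + v * f (a * y)" using a by simp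
  then show "f (a * (u *\<^sub>R x + v *\<^sub>R y)) \<le> u * f (a * x) + v * f (a * y)" by (simp add: algebra_simps)
qed auto

lemma convex_Qf: "convex_on {0..} Qf"
  unfolding Qf_def
  by (intro convex_on_add convex_on_cmul convex_on_scaled[of "\<lambda>t. - Hf n t"] convex_on_scaled[of "\<lambda>t. - pf n t"] convex_Hf[OF n] convex_pf[OF n])
     (use a in auto)

lemma measurable_Qf [measurable]: "Qf \<in> borel_measurable borel"
  unfolding Qf_def[abs_def] by measurable

lemma pf_bounds: "w \<ge> 0 \<Longrightarrow> \<bar>pf n (a * w)\<bar> \<le> a * w"
proof -
  assume w: "w \<ge> 0"
  have "a * w * qf n (a * w) \<le> a * w * 1" using a w qf_le_1[OF n, of "a * w"] by (intro mult_left_mono) auto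
  moreover have "a * w * qf n (a * w) \<ge> 0" using a w qf_pos[OF n, of "a * w"] by (intro mult_nonneg_nonneg) auto
  ultimately show ?thesis by (simp add: pf_def)
qed

lemma abs_Qf_le: "w \<ge> 0 \<Longrightarrow> \<bar>Qf w\<bar> \<le> (2 * a) * (1 + w) ^ 1"
proof -
  assume w: "w \<ge> 0"
  have "\<bar>Hf n (a * w)\<bar> \<le> 1" using abs_Ha_le[OF n a w] by (simp add: Ha_def)
  then have "\<bar>a * - Hf n (a * w)\<bar> \<le> a * 1" unfolding abs_mult using a by (intro mult_mono) auto
  moreover have "\<bar>2 * - pf n (a * w)\<bar> \<le> 2 * (a * w)" using pf_bounds[OF w] by simp
  ultimately have "\<bar>Qf w\<bar> \<le> a + 2 * (a * w)" unfolding Qf_def by linarith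
  then show ?thesis using a by (simp add: algebra_simps)
qed

text \<open>Substituting \<open>ck_gam\<close> reverses the sign of
  \<open>a * ck n (Ha n a) k\<close> and thus turns a concave contribution into a convex
  one.\<close>

lemma bk_eq: "bk n a k = 2 * k + 2 * a + ck n Qf k"
proof -
  have "ck n Qf k = ck n (\<lambda>w. a * - Hf n (a * w)) k + ck n (\<lambda>w. 2 * - pf n (a * w)) k"
    unfolding Qf_def
  proof (rule ck_add[where C=a and l=0 and D="2 * a" and m=1])
    fix w :: real assume w: "w \<ge> 0"
    have "\<bar>Hf n (a * w)\<bar> \<le> 1" using abs_Ha_le[OF n a w] by (simp add: Ha_def)
    then show "\<bar>a * - Hf n (a * w)\<bar> \<le> a * (1 + w) ^ 0" using a mult_left_mono[of "\<bar>Hf n (a * w)\<bar>" 1 a] by (simp add: abs_mult)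
    show "\<bar>2 * - pf n (a * w)\<bar> \<le> 2 * a * (1 + w) ^ 1" using pf_bounds[OF w] a by (simp add: algebra_simps)
  qed measurable
  also have "\<dots> = - (a * ck n (Ha n a) k) - 2 * ck n (\<lambda>w. pf n (a * w)) k"
    by (simp add: ck_def Ha_def mult.assoc)
  finally show ?thesis using ck_gam[of k] by (simp add: bk_def)
qed

lemma bk_convex: "2 * bk n a (Suc k) \<le> bk n a k + bk n a (Suc (Suc k))"
  using ck_convex[OF n measurable_Qf abs_Qf_le convex_Qf, of k] by (simp add: bk_eq)

lemma abs_bk_le: "\<bar>bk n a k\<bar> \<le> (2 + 4 * a) * (1 + real k)"
proof -
  have "\<bar>ck n (gam n a) k\<bar> \<le> a" by (rule ck_abs_le[OF n]) (use abs_gam_le[OF n a] in auto)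
  then have 1: "\<bar>4 * k * ck n (gam n a) k\<bar> \<le> 4 * k * a" unfolding abs_mult by (intro mult_mono) auto
  have "\<bar>ck n (Ha n a) k\<bar> \<le> 1" by (rule ck_abs_le[OF n]) (use abs_Ha_le[OF n a] in auto)
  then have 2: "\<bar>a * ck n (Ha n a) k\<bar> \<le> a * 1" unfolding abs_mult using a by (intro mult_mono) auto
  have "\<bar>bk n a k\<bar> \<le> 2 * k + 4 * k * a + a" using 1 2 unfolding bk_def by linarith
  also have "\<dots> \<le> (2 + 4 * a) * (1 + real k)" using a by (simp add: algebra_simps)
  finally show ?thesis .
qed

lemma psi_chord: "0 \<le> \<theta> \<Longrightarrow> \<theta> \<le> 1 \<Longrightarrow> \<nu> \<ge> 0 \<Longrightarrow> psi n a (\<theta> * \<nu>) \<le> (1 - \<theta>) * psi n a 0 + \<theta> * psi n a \<nu>"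
proof -
  assume "0 \<le> \<theta>" "\<theta> \<le> 1" "\<nu> \<ge> 0"
  \<comment> \<open>At Poisson mean zero only the index \<open>0\<close> has weight.\<close>
  moreover have "psi n a 0 = bk n a 0"
  proof -
    have "(\<Sum>k. bk n a k * 0 ^ k / fact k) = bk n a 0 / fact 0"
      using powser_zero[of "\<lambda>k. bk n a k / fact k"] by simp
    then show ?thesis by (simp add: psi_def poisson_mean_def)
  qed
  ultimately show ?thesis
    using poisson_mean_convex[OF summable_linear_exp[of "bk n a", OF abs_bk_le] bk_convex, of \<theta> "\<nu> / 2"] by (simp add: psi_def)
qed

end

section \<open>The two error levels and the integrand of \<open>f\<close>\<close>

lemma poisson_mean_0: "poisson_mean b 0 = b 0"
  using powser_zero[of "\<lambda>k. b k / fact k"] by (simp add: poisson_mean_def)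

text \<open>The mean squared Bessel quotient for an input at the origin. \<open>Bfun\<close> is the
  counterpart for an input on the sphere, by \<open>Bfun_eq\<close>; its Poisson series is taken as
  definition because monotonicity is read off from there.\<close>

definition Afun :: "nat \<Rightarrow> real \<Rightarrow> real" where "Afun n a = (\<integral>z. Ha n a (dotp n z z) \<partial>stdg n)"
definition Bfun :: "nat \<Rightarrow> real \<Rightarrow> real" where "Bfun n a = poisson_mean (ck n (Ha n a)) (a / 2)"
definition phi :: "nat \<Rightarrow> real \<Rightarrow> real" where "phi n a = Afun n a + Bfun n a - 1"

lemma Afun_ck: "Afun n a = ck n (Ha n a) 0"
  by (simp add: Afun_def ck_def)

lemma psi_0: "psi n a 0 = a * Afun n a"
  by (simp add: psi_def poisson_mean_0 bk_def Afun_ck)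

lemma Ha_mono: "n \<ge> 1 \<Longrightarrow> a \<ge> 0 \<Longrightarrow> 0 \<le> v \<Longrightarrow> v \<le> w \<Longrightarrow> Ha n a v \<le> Ha n a w"
  using Hf_strict_mono[of n "a * v" "a * w"] mult_left_mono[of v w a]
  by (cases "a * v = a * w") (auto simp: Ha_def less_le)

lemma Ha_mono_param: "n \<ge> 1 \<Longrightarrow> 0 \<le> a \<Longrightarrow> a \<le> a' \<Longrightarrow> 0 \<le> w \<Longrightarrow> Ha n a w \<le> Ha n a' w"
  using Ha_mono[of n w a a'] by (simp add: Ha_def mult.commute)

lemma abs_ck_Ha_le: "n \<ge> 1 \<Longrightarrow> a \<ge> 0 \<Longrightarrow> \<bar>ck n (Ha n a) k\<bar> \<le> 1 * (1 + real k)"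
  using ck_abs_le[of n "Ha n a" 1 k] abs_Ha_le[of n a] by (auto intro: order_trans)

lemma ck_Ha_mono: "n \<ge> 1 \<Longrightarrow> a \<ge> 0 \<Longrightarrow> ck n (Ha n a) k \<le> ck n (Ha n a) (Suc k)"
  by (rule ck_mono[where C=1 and l=0]) (auto intro: abs_Ha_le Ha_mono)

text \<open>The parameter enters twice, as Poisson mean and inside \<open>Ha\<close>; the two
  occurrences are increased one after the other.\<close>

lemma Bfun_mono:
  assumes n: "n \<ge> 1" and a: "0 \<le> a" "a \<le> a'"
  shows "Bfun n a \<le> Bfun n a'"
proof -
  have a': "0 \<le> a'" using a by simp
  have "Bfun n a \<le> poisson_mean (ck n (Ha n a)) (a' / 2)"
    unfolding Bfun_def using a
    by (intro poisson_mean_mono summable_linear_exp[OF abs_ck_Ha_le[OF n a(1)]] ck_Ha_mono[OF n]) auto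
  also have "\<dots> \<le> Bfun n a'"
  proof -
    have "ck n (Ha n a) k \<le> ck n (Ha n a') k" for k
      by (rule ck_mono_fun[OF n, where C=1 and D=1 and l=0 and m=0])
         (use abs_Ha_le[OF n] Ha_mono_param[OF n a] a a' in auto)
    then have "ck n (Ha n a) k * (a' / 2) ^ k / fact k \<le> ck n (Ha n a') k * (a' / 2) ^ k / fact k" for k
      using a' by (intro divide_right_mono mult_right_mono) auto
    then have "exp (a' / 2) * poisson_mean (ck n (Ha n a)) (a' / 2) \<le> exp (a' / 2) * poisson_mean (ck n (Ha n a')) (a' / 2)"
      by (rule sums_le[OF _ poisson_mean_sums[OF summable_linear_exp[OF abs_ck_Ha_le[OF n a(1)]]]
            poisson_mean_sums[OF summable_linear_exp[OF abs_ck_Ha_le[OF n a']]]])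
    then show ?thesis by (simp add: Bfun_def)
  qed
  finally show ?thesis .
qed

lemma Afun_le_Bfun:
  assumes n: "n \<ge> 1" and a: "0 \<le> a" shows "Afun n a \<le> Bfun n a"
proof -
  have "poisson_mean (ck n (Ha n a)) 0 \<le> poisson_mean (ck n (Ha n a)) (a / 2)"
    using a by (intro poisson_mean_mono summable_linear_exp[OF abs_ck_Ha_le[OF n a]] ck_Ha_mono[OF n]) auto
  then show ?thesis by (simp add: Afun_ck Bfun_def poisson_mean_0)
qed

text \<open>The indicator of the zero vector is invariant under scaling, hence independent of the
  norm. Its product with the squared norm vanishes, while the squared norm has mean
  \<open>n > 0\<close>.\<close>

lemma AE_stdg_nonzero: assumes n: "n \<ge> 1" shows "AE z in stdg n. dotp n z z > 0"
proof -
  define \<phi> :: "(nat \<Rightarrow> real) \<Rightarrow> real" where "\<phi> z = indicator {z. dotp n z z = 0} z" for z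
  have [measurable]: "\<phi> \<in> borel_measurable (Rn n)"
  proof -
    have "\<phi> = (\<lambda>z. indicator {0} (dotp n z z) :: real)" by (auto simp: \<phi>_def indicator_def)
    then show ?thesis by simp
  qed
  have "(\<integral>z. \<phi> z * (vnorm n z)\<^sup>2 \<partial>stdg n) = (\<integral>z. \<phi> z \<partial>stdg n) * (\<integral>z. (vnorm n z)\<^sup>2 \<partial>stdg n)"
    by (rule stdg_radial_proportional(2)[where C=1 and F="\<lambda>t. t\<^sup>2"]) (auto simp: \<phi>_def indicator_def)
  moreover have "\<phi> z * (vnorm n z)\<^sup>2 = 0" for z by (simp add: \<phi>_def indicator_def vnorm_sq)
  moreover have "(\<integral>z. (vnorm n z)\<^sup>2 \<partial>stdg n) = n"
    using mom_Suc[of n 0] by (simp add: mom_def vnorm_sq)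
  ultimately have "(\<integral>z. \<phi> z \<partial>stdg n) = 0" using n by simp
  moreover have "integrable (stdg n) \<phi>"
    by (rule integrable_stdg_bound[where C=1 and k=0 and \<rho>=0]) (auto simp: \<phi>_def indicator_def)
  ultimately have "AE z in stdg n. \<phi> z = 0"
    by (subst (asm) integral_nonneg_eq_0_iff_AE) (auto simp: \<phi>_def)
  then show ?thesis
    by eventually_elim (auto simp: \<phi>_def indicator_def less_le split: if_splits)
qed

lemma integrable_Ha: "n \<ge> 1 \<Longrightarrow> a \<ge> 0 \<Longrightarrow> integrable (stdg n) (\<lambda>z. Ha n a (dotp n z z))"
  using integrable_radial[of "Ha n a" 1 0 n 0] abs_Ha_le[of n a] by simp

text \<open>The integrands are strictly ordered except at the zero vector, a null set. The
  strictness of \<open>phi\<close> comes from here.\<close>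

lemma Afun_strict_mono:
  assumes n: "n \<ge> 1" and a: "0 \<le> a" "a < a'"
  shows "Afun n a < Afun n a'"
proof -
  interpret prob_space "stdg n" by (rule prob_space_gauss) simp
  show ?thesis unfolding Afun_def
  proof (rule integral_less_AE_space)
    show "AE z in stdg n. Ha n a (dotp n z z) < Ha n a' (dotp n z z)"
      using AE_stdg_nonzero[OF n]
    proof eventually_elim
      case (elim z)
      then show ?case unfolding Ha_def using a by (intro Hf_strict_mono[OF n]) auto
    qed
    show "emeasure (stdg n) (space (stdg n)) \<noteq> 0" using emeasure_space_1 by simp
  qed (use integrable_Ha[OF n] a in auto)
qed

lemma phi_strict_mono: "n \<ge> 1 \<Longrightarrow> 0 \<le> a \<Longrightarrow> a < a' \<Longrightarrow> phi n a < phi n a'"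
  using Afun_strict_mono[of n a a'] Bfun_mono[of n a a'] by (simp add: phi_def)

lemma tendsto_Hf:
  assumes n: "n \<ge> 1" and "X \<longlonglongrightarrow> t" "\<And>i. X i \<ge> (0::real)" "t \<ge> 0"
  shows "(\<lambda>i. Hf n (X i)) \<longlonglongrightarrow> Hf n t"
  by (rule continuous_on_tendsto_compose[OF cont_Hf[OF n] assms(2)]) (use assms in auto)

lemma vnorm_e1: "n \<ge> 1 \<Longrightarrow> dotp n (e1 n) (e1 n) = 1"
  by (simp add: dotp_def e1_def if_distrib[of "\<lambda>c. c * _"] cong: if_cong)

lemma Bfun_eq:
  assumes n: "n \<ge> 1" and a: "a \<ge> 0" and \<xi>: "dotp n \<xi> \<xi> = a"
  shows "Bfun n a = (\<integral>z. Ha n a (dotp n (affmap n \<xi> 1 z) (affmap n \<xi> 1 z)) \<partial>stdg n)"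
  using radial_mean_poisson[OF n a, of "Ha n a" 1 \<xi>] abs_Ha_le[OF n a] by (simp add: Bfun_def \<xi>)

lemma continuous_on_phi: assumes n: "n \<ge> 1" shows "continuous_on {0..} (phi n)"
proof -
  interpret prob_space "stdg n" by (rule prob_space_gauss) simp
  have A: "continuous_on {0..} (Afun n)"
    unfolding continuous_on_sequentially
  proof (intro allI ballI impI)
    fix X and a :: real assume X: "a \<in> {0..}" "(\<forall>i. X i \<in> {0..}) \<and> X \<longlonglongrightarrow> a"
    show "(Afun n \<circ> X) \<longlonglongrightarrow> Afun n a"
      unfolding Afun_def comp_def
    proof (rule integral_dominated_convergence[where w="\<lambda>_. 1"])
      show "AE z in stdg n. (\<lambda>i. Ha n (X i) (dotp n z z)) \<longlonglongrightarrow> Ha n a (dotp n z z)"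
        unfolding Ha_def using X by (intro AE_I2 tendsto_Hf[OF n] tendsto_intros) auto
      show "AE z in stdg n. norm (Ha n (X i) (dotp n z z)) \<le> 1" for i
        using abs_Ha_le[OF n] X by auto
    qed measurable
  qed
  have B: "continuous_on {0..} (Bfun n)"
    unfolding continuous_on_sequentially
  proof (intro allI ballI impI)
    fix X and a :: real assume X: "a \<in> {0..}" "(\<forall>i. X i \<in> {0..}) \<and> X \<longlonglongrightarrow> a"
    \<comment> \<open>Shifting by \<open>sqrt b\<close> along the first axis replaces the Poisson
      series by an explicit integrand in \<open>b\<close>, to which dominated convergence with the
      bound \<open>1\<close> applies.\<close>
    define S where "S b z = b + 2 * sqrt b * dotp n (e1 n) z + dotp n z z" for b z
    have S: "dotp n (affmap n (vscale n (sqrt b) (e1 n)) 1 z) (affmap n (vscale n (sqrt b) (e1 n)) 1 z) = S b z" if "b \<ge> 0" for b z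
      using that by (simp add: dotp_affmap_self S_def vnorm_e1[OF n])
    have Bb: "Bfun n b = (\<integral>z. Ha n b (S b z) \<partial>stdg n)" if "b \<ge> 0" for b
      using Bfun_eq[OF n that, of "vscale n (sqrt b) (e1 n)"] that by (simp add: vnorm_e1[OF n] S)
    have S0: "S b z \<ge> 0" if "b \<ge> 0" for b z unfolding S[OF that, symmetric] by simp
    have "(\<lambda>i. \<integral>z. Ha n (X i) (S (X i) z) \<partial>stdg n) \<longlonglongrightarrow> (\<integral>z. Ha n a (S a z) \<partial>stdg n)"
    proof (rule integral_dominated_convergence[where w="\<lambda>_. 1"])
      show "AE z in stdg n. (\<lambda>i. Ha n (X i) (S (X i) z)) \<longlonglongrightarrow> Ha n a (S a z)"
        unfolding Ha_def
      proof (intro AE_I2 tendsto_Hf[OF n])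
        fix z show "(\<lambda>i. X i * S (X i) z) \<longlonglongrightarrow> a * S a z"
          unfolding S_def using X by (intro tendsto_intros) auto
      qed (use X S0 in auto)
      show "AE z in stdg n. norm (Ha n (X i) (S (X i) z)) \<le> 1" for i
        using abs_Ha_le[OF n] X S0 by auto
    qed (unfold S_def, measurable)
    then show "(Bfun n \<circ> X) \<longlonglongrightarrow> Bfun n a"
      using X by (simp add: Bb comp_def)
  qed
  show ?thesis unfolding phi_def by (intro continuous_intros A B)
qed

lemma phi_0: "n \<ge> 1 \<Longrightarrow> phi n 0 = - 1"
  by (simp add: phi_def Afun_def Bfun_def poisson_mean_0 ck_def Ha_def Hf_def)

text \<open>\<open>Afun\<close> tends to \<open>1\<close> by \<open>Hf_ge\<close>, and
  \<open>Bfun\<close> dominates it, so \<open>phi \<ge> 2 Afun - 1\<close>; a value of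
  \<open>Afun\<close> above \<open>1 / 2\<close> suffices.\<close>

lemma phi_eventually_nonneg:
  assumes n: "n \<ge> 1" obtains a0 where "a0 > 0" "phi n a0 \<ge> 0"
proof -
  interpret prob_space "stdg n" by (rule prob_space_gauss) simp
  have "(\<lambda>i. Afun n (real i)) \<longlonglongrightarrow> (\<integral>z. 1 \<partial>stdg n)"
    unfolding Afun_def
  proof (rule integral_dominated_convergence[where w="\<lambda>_. 1"])
    show "AE z in stdg n. (\<lambda>i. Ha n (real i) (dotp n z z)) \<longlonglongrightarrow> 1"
      using AE_stdg_nonzero[OF n]
    proof eventually_elim
      case (elim z)
      show ?case
      proof (rule tendsto_sandwich)
        show "eventually (\<lambda>i. 1 - n / sqrt (real i * dotp n z z) \<le> Ha n (real i) (dotp n z z)) sequentially"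
          unfolding Ha_def using eventually_gt_at_top[of 0]
          by eventually_elim (use elim in \<open>intro Hf_ge[OF n], simp\<close>)
        show "eventually (\<lambda>i. Ha n (real i) (dotp n z z) \<le> 1) sequentially"
          unfolding Ha_def by (intro always_eventually allI Hf_le_1[OF n]) simp
        have "filterlim (\<lambda>i. sqrt (real i * dotp n z z)) at_top sequentially"
          unfolding mult.commute[of "real _"]
          by (rule filterlim_compose[OF sqrt_at_top filterlim_tendsto_pos_mult_at_top[OF tendsto_const elim filterlim_real_sequentially]])
        then have "(\<lambda>i. n / sqrt (real i * dotp n z z)) \<longlonglongrightarrow> 0"
          by (rule tendsto_divide_0[OF tendsto_const filterlim_at_top_imp_at_infinity])
        from tendsto_diff[OF tendsto_const[of 1] this]
        show "(\<lambda>i. 1 - n / sqrt (real i * dotp n z z)) \<longlonglongrightarrow> 1" by simp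
      qed simp
    qed
    show "AE z in stdg n. norm (Ha n (real i) (dotp n z z)) \<le> 1" for i
      using abs_Ha_le[OF n] by auto
  qed measurable
  then have "(\<lambda>i. Afun n (real i)) \<longlonglongrightarrow> 1" by (simp add: prob_space)
  then have "eventually (\<lambda>i. Afun n (real i) > 1 / 2) sequentially"
    by (rule order_tendstoD) simp
  then have "eventually (\<lambda>i. Afun n (real i) > 1 / 2 \<and> i > 0) sequentially"
    using eventually_gt_at_top by (rule eventually_conj)
  then obtain i where "Afun n (real i) > 1 / 2" "i > 0"
    by (auto dest: eventually_happens)
  then have "real i > 0" "phi n (real i) \<ge> 0"
    using Afun_le_Bfun[OF n, of "real i"] by (auto simp: phi_def)
  then show thesis by (rule that)
qed

section \<open>Inputs of bounded amplitude\<close>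

lemma measurable_fst_comp [measurable (raw)]:
  assumes "g \<in> M \<rightarrow>\<^sub>M Rn n \<Otimes>\<^sub>M N" "i < n"
  shows "(\<lambda>q. fst (g q) i) \<in> borel_measurable M"
proof (rule measurable_comp_Rn[OF _ assms(2)])
  show "(\<lambda>q. fst (g q)) \<in> M \<rightarrow>\<^sub>M Rn n"
    by (rule measurable_compose[OF assms(1) measurable_fst])
qed

lemma measurable_snd_comp [measurable (raw)]:
  assumes "g \<in> M \<rightarrow>\<^sub>M N \<Otimes>\<^sub>M Rn n" "i < n"
  shows "(\<lambda>q. snd (g q) i) \<in> borel_measurable M"
proof (rule measurable_comp_Rn[OF _ assms(2)])
  show "(\<lambda>q. snd (g q)) \<in> M \<rightarrow>\<^sub>M Rn n"
    by (rule measurable_compose[OF assms(1) measurable_snd])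
qed

text \<open>\<open>Lw n r x\<close> is the density of \<open>r x + Z\<close>, and \<open>Nf P n r\<close> that of \<open>r X + Z\<close>, relative to the law of the
  standard Gaussian \<open>Z\<close>; \<open>postf P n r a y\<close> is the conditional expectation of \<open>a X\<close> given \<open>r X + Z = y\<close>.
  The noise variance \<open>s\<close> corresponds to \<open>r = 1 / \<surd>s\<close>.\<close>

definition Lw :: "nat \<Rightarrow> real \<Rightarrow> (nat \<Rightarrow> real) \<Rightarrow> (nat \<Rightarrow> real) \<Rightarrow> real" where
  "Lw n r x y = exp (r * dotp n y x - r\<^sup>2 * dotp n x x / 2)"

definition Nf :: "(nat \<Rightarrow> real) measure \<Rightarrow> nat \<Rightarrow> real \<Rightarrow> (nat \<Rightarrow> real) \<Rightarrow> real" where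
  "Nf P n r y = (\<integral>x. Lw n r x y \<partial>P)"

definition postf :: "(nat \<Rightarrow> real) measure \<Rightarrow> nat \<Rightarrow> real \<Rightarrow> ((nat \<Rightarrow> real) \<Rightarrow> real) \<Rightarrow> (nat \<Rightarrow> real) \<Rightarrow> real" where
  "postf P n r a y = (\<integral>x. a x * Lw n r x y \<partial>P) / Nf P n r y"

abbreviation chan :: "nat \<Rightarrow> real \<Rightarrow> (nat \<Rightarrow> real) \<times> (nat \<Rightarrow> real) \<Rightarrow> (nat \<Rightarrow> real)" where
  "chan n r p \<equiv> affmap n (vscale n r (fst p)) 1 (snd p)"

lemma measurable_Lw [measurable (raw)]:
  assumes [measurable]: "\<And>i. i < n \<Longrightarrow> (\<lambda>q. x q i) \<in> borel_measurable M" "\<And>i. i < n \<Longrightarrow> (\<lambda>q. y q i) \<in> borel_measurable M"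
    "r \<in> borel_measurable M"
  shows "(\<lambda>q. Lw n (r q) (x q) (y q)) \<in> borel_measurable M"
  unfolding Lw_def by measurable

lemma Lw_pos [simp]: "Lw n r x y > 0" by (simp add: Lw_def)
lemma Lw_nonneg [simp]: "Lw n r x y \<ge> 0" by (simp add: Lw_def)

text \<open>The reference measure is always the input law times the standard Gaussian; the noise
  level is carried by the gain \<open>r\<close>.\<close>

locale bounded_input = prob_space P for P :: "(nat \<Rightarrow> real) measure" +
  fixes n :: nat and R :: real
  assumes n: "n \<ge> 1" and sets_P [measurable_cong, simp]: "sets P = sets (Rn n)"
    and bd: "AE x in P. vnorm n x \<le> R" and R: "R \<ge> 0"
begin

sublocale G: prob_space "stdg n" by (rule prob_space_gauss) simp

sublocale PG: pair_prob_space P "stdg n" ..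

lemma space_P [simp]: "space P = space (Rn n)"
  by (rule sets_eq_imp_space_eq) simp

lemma measurable_P_comp [measurable]: "i < n \<Longrightarrow> (\<lambda>x. x i) \<in> borel_measurable P"
  by simp

lemma AE_pair_bd: "AE p in P \<Otimes>\<^sub>M stdg n. vnorm n (fst p) \<le> R"
proof (rule AE_distrD[of fst _ P])
  show "AE x in distr (P \<Otimes>\<^sub>M stdg n) P fst. vnorm n x \<le> R"
    unfolding G.distr_pair_fst by (rule bd)
qed simp

lemma distr_snd: "distr (P \<Otimes>\<^sub>M stdg n) (stdg n) snd = stdg n"
proof (rule measure_eqI)
  fix A assume "A \<in> sets (distr (P \<Otimes>\<^sub>M stdg n) (stdg n) snd)"
  then have A: "A \<in> sets (stdg n)" by simp
  then have "snd -` A \<inter> space (P \<Otimes>\<^sub>M stdg n) = space P \<times> A"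
    using sets.sets_into_space[OF A] by (auto simp: space_pair_measure)
  then show "emeasure (distr (P \<Otimes>\<^sub>M stdg n) (stdg n) snd) A = emeasure (stdg n) A"
    using A emeasure_space_1 by (simp add: emeasure_distr G.emeasure_pair_measure_Times)
qed simp

lemma integrable_snd_fun: "integrable (stdg n) h \<Longrightarrow> integrable (P \<Otimes>\<^sub>M stdg n) (\<lambda>p. h (snd p) :: real)"
  by (rule integrable_distr[of snd _ "stdg n"]) (auto simp: distr_snd)

lemma integral_fst_fun: "a \<in> borel_measurable (Rn n) \<Longrightarrow> (\<integral>p. a (fst p) \<partial>(P \<Otimes>\<^sub>M stdg n)) = (\<integral>x. a x \<partial>P :: real)"
  by (subst (2) G.distr_pair_fst[of P, symmetric], subst integral_distr) auto

lemma integrable_pair_bound: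
  fixes F :: "(nat \<Rightarrow> real) \<times> (nat \<Rightarrow> real) \<Rightarrow> real"
  assumes F: "F \<in> borel_measurable (P \<Otimes>\<^sub>M stdg n)"
    and b: "\<And>x z. vnorm n x \<le> R \<Longrightarrow> \<bar>F (x, z)\<bar> \<le> C * (1 + (vnorm n z)\<^sup>2) ^ k * exp (\<rho> * vnorm n z)"
  shows "integrable (P \<Otimes>\<^sub>M stdg n) F"
proof (rule Bochner_Integration.integrable_bound)
  show "integrable (P \<Otimes>\<^sub>M stdg n) (\<lambda>p. \<bar>C\<bar> * (1 + (vnorm n (snd p))\<^sup>2) ^ k * exp (\<rho> * vnorm n (snd p)))"
    by (rule integrable_snd_fun, rule integrable_stdg_bound[where C="\<bar>C\<bar>" and k=k and \<rho>=\<rho>]) (auto simp: abs_mult)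
  show "AE p in P \<Otimes>\<^sub>M stdg n. norm (F p) \<le> norm (\<bar>C\<bar> * (1 + (vnorm n (snd p))\<^sup>2) ^ k * exp (\<rho> * vnorm n (snd p)))"
    using AE_pair_bd
  proof eventually_elim
    case (elim p)
    have "\<bar>F p\<bar> \<le> C * (1 + (vnorm n (snd p))\<^sup>2) ^ k * exp (\<rho> * vnorm n (snd p))"
      using b[of "fst p" "snd p"] elim by simp
    also have "\<dots> \<le> \<bar>C\<bar> * (1 + (vnorm n (snd p))\<^sup>2) ^ k * exp (\<rho> * vnorm n (snd p))"
      by (intro mult_right_mono) auto
    finally show ?case by (simp add: abs_mult)
  qed
qed (rule F)

lemma Lw_le: "vnorm n x \<le> R \<Longrightarrow> Lw n r x y \<le> exp ((\<bar>r\<bar> * R) * vnorm n y)"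
proof -
  assume x: "vnorm n x \<le> R"
  have "r * dotp n y x \<le> \<bar>r\<bar> * \<bar>dotp n y x\<bar>" by (metis abs_ge_self abs_mult)
  also have "\<dots> \<le> \<bar>r\<bar> * (vnorm n y * R)"
    by (intro mult_left_mono order_trans[OF dotp_Cauchy_Schwarz] x) auto
  also have "\<dots> = (\<bar>r\<bar> * R) * vnorm n y" by (simp add: mult_ac)
  finally have "r * dotp n y x \<le> (\<bar>r\<bar> * R) * vnorm n y" .
  moreover have "0 \<le> r\<^sup>2 * dotp n x x" by simp
  ultimately have "r * dotp n y x - r\<^sup>2 * dotp n x x / 2 \<le> (\<bar>r\<bar> * R) * vnorm n y"
    by linarith
  then show ?thesis by (simp add: Lw_def)
qed

text \<open>This lower bound keeps \<open>Nf\<close> away from \<open>0\<close>, which permits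
  division by it and controls its logarithm.\<close>

lemma Lw_ge: "vnorm n x \<le> R \<Longrightarrow> Lw n r x y \<ge> exp (- ((\<bar>r\<bar> * R) * vnorm n y) - r\<^sup>2 * R\<^sup>2 / 2)"
proof -
  assume x: "vnorm n x \<le> R"
  have "- (r * dotp n y x) \<le> \<bar>r\<bar> * \<bar>dotp n y x\<bar>" by (metis abs_ge_minus_self abs_mult)
  also have "\<dots> \<le> \<bar>r\<bar> * (vnorm n y * R)"
    by (intro mult_left_mono order_trans[OF dotp_Cauchy_Schwarz] x) auto
  also have "\<dots> = (\<bar>r\<bar> * R) * vnorm n y" by (simp add: mult_ac)
  finally have 1: "- (r * dotp n y x) \<le> (\<bar>r\<bar> * R) * vnorm n y" .
  have "dotp n x x \<le> R\<^sup>2" using power_mono[OF x, of 2] by (simp add: vnorm_sq)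
  then have "r\<^sup>2 * dotp n x x \<le> r\<^sup>2 * R\<^sup>2" by (intro mult_left_mono) auto
  with 1 show ?thesis by (simp add: Lw_def)
qed

lemma measurable_Nf [measurable (raw)]:
  assumes [measurable]: "\<And>i. i < n \<Longrightarrow> (\<lambda>q. y q i) \<in> borel_measurable M" "r \<in> borel_measurable M"
  shows "(\<lambda>q. Nf P n (r q) (y q)) \<in> borel_measurable M"
  unfolding Nf_def
  by (rule borel_measurable_lebesgue_integral) (simp add: split_beta', measurable)

lemma measurable_postf [measurable (raw)]:
  assumes [measurable]: "\<And>i. i < n \<Longrightarrow> (\<lambda>q. y q i) \<in> borel_measurable M" "a \<in> borel_measurable (Rn n)" "r \<in> borel_measurable M"
  shows "(\<lambda>q. postf P n (r q) a (y q)) \<in> borel_measurable M"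
  unfolding postf_def
  by (intro borel_measurable_divide borel_measurable_lebesgue_integral measurable_Nf) (simp_all add: split_beta', measurable)

lemma integrable_Lw:
  assumes [measurable]: "a \<in> borel_measurable (Rn n)" and a: "\<And>x. vnorm n x \<le> R \<Longrightarrow> \<bar>a x\<bar> \<le> A"
  shows "integrable P (\<lambda>x. a x * Lw n r x y)"
proof (rule integrable_const_bound[where B="A * exp ((\<bar>r\<bar> * R) * vnorm n y)"])
  show "AE x in P. norm (a x * Lw n r x y) \<le> A * exp (\<bar>r\<bar> * R * vnorm n y)"
    using bd
  proof eventually_elim
    case (elim x)
    have "\<bar>a x\<bar> * Lw n r x y \<le> A * exp (\<bar>r\<bar> * R * vnorm n y)"
      using a[OF elim] Lw_le[OF elim, of r y] order_trans[OF abs_ge_zero a[OF elim]] by (intro mult_mono) auto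
    then show ?case by (simp add: abs_mult)
  qed
qed measurable

lemma integrable_Lw': "integrable P (\<lambda>x. Lw n r x y)"
  using integrable_Lw[of "\<lambda>_. 1" 1 r y] by simp

lemma Nf_ge: "Nf P n r y \<ge> exp (- ((\<bar>r\<bar> * R) * vnorm n y) - r\<^sup>2 * R\<^sup>2 / 2)"
proof -
  have "exp (- ((\<bar>r\<bar> * R) * vnorm n y) - r\<^sup>2 * R\<^sup>2 / 2) = (\<integral>x. exp (- ((\<bar>r\<bar> * R) * vnorm n y) - r\<^sup>2 * R\<^sup>2 / 2) \<partial>P)"
    using prob_space by simp
  also have "\<dots> \<le> Nf P n r y"
    unfolding Nf_def using bd by (intro integral_mono_AE integrable_Lw') (auto intro: Lw_ge elim!: eventually_mono)
  finally show ?thesis .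
qed

lemma Nf_pos: "Nf P n r y > 0"
  using Nf_ge[of r y] exp_gt_zero less_le_trans by blast

lemma Nf_le: "Nf P n r y \<le> exp ((\<bar>r\<bar> * R) * vnorm n y)"
proof -
  have "Nf P n r y \<le> (\<integral>x. exp ((\<bar>r\<bar> * R) * vnorm n y) \<partial>P)"
    unfolding Nf_def using bd by (intro integral_mono_AE integrable_Lw') (auto intro: Lw_le elim!: eventually_mono)
  then show ?thesis using prob_space by simp
qed

lemma abs_postf_le:
  assumes [measurable]: "a \<in> borel_measurable (Rn n)" and a: "\<And>x. vnorm n x \<le> R \<Longrightarrow> \<bar>a x\<bar> \<le> A"
  shows "\<bar>postf P n r a y\<bar> \<le> A"
proof -
  have "\<bar>\<integral>x. a x * Lw n r x y \<partial>P\<bar> \<le> (\<integral>x. \<bar>a x * Lw n r x y\<bar> \<partial>P)"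
    by (rule integral_abs_bound)
  also have "\<dots> \<le> (\<integral>x. A * Lw n r x y \<partial>P)"
  proof (rule integral_mono_AE)
    show "integrable P (\<lambda>x. \<bar>a x * Lw n r x y\<bar>)" by (rule integrable_abs[OF integrable_Lw[OF assms(1) a]])
    show "integrable P (\<lambda>x. A * Lw n r x y)" using integrable_Lw' by simp
    show "AE x in P. \<bar>a x * Lw n r x y\<bar> \<le> A * Lw n r x y"
      using bd by eventually_elim (simp add: abs_mult a mult_right_mono)
  qed
  also have "\<dots> = A * Nf P n r y" by (simp add: Nf_def)
  finally show ?thesis using Nf_pos[of r y] by (simp add: postf_def divide_simps)
qed

lemma postf_Nf: "postf P n r a y * Nf P n r y = (\<integral>x. a x * Lw n r x y \<partial>P)"
  using Nf_pos[of r y] by (simp add: postf_def)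

text \<open>The Cameron-Martin formula for each fixed \<open>x\<close>, integrated over the input
  law.\<close>

lemma chan_distr:
  "distr (P \<Otimes>\<^sub>M stdg n) (P \<Otimes>\<^sub>M stdg n) (\<lambda>p. (fst p, chan n r p))
     = density (P \<Otimes>\<^sub>M stdg n) (\<lambda>p. ennreal (Lw n r (fst p) (snd p)))"
proof (rule measure_eqI)
  fix A assume "A \<in> sets (distr (P \<Otimes>\<^sub>M stdg n) (P \<Otimes>\<^sub>M stdg n) (\<lambda>p. (fst p, chan n r p)))"
  then have A [measurable]: "A \<in> sets (P \<Otimes>\<^sub>M stdg n)" by simp
  have m [measurable]: "(\<lambda>p. (fst p, chan n r p)) \<in> P \<Otimes>\<^sub>M stdg n \<rightarrow>\<^sub>M P \<Otimes>\<^sub>M stdg n" by measurable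
  let ?D = "distr (P \<Otimes>\<^sub>M stdg n) (P \<Otimes>\<^sub>M stdg n) (\<lambda>p. (fst p, chan n r p))"
  have "emeasure ?D A = (\<integral>\<^sup>+p. indicator A p \<partial>?D)"
    by (rule nn_integral_indicator[symmetric]) (simp only: sets_distr A)
  also have "\<dots> = (\<integral>\<^sup>+p. indicator A (fst p, chan n r p) \<partial>(P \<Otimes>\<^sub>M stdg n))"
    by (rule nn_integral_distr) measurable
  also have "\<dots> = (\<integral>\<^sup>+x. \<integral>\<^sup>+z. indicator A (x, affmap n (vscale n r x) 1 z) \<partial>stdg n \<partial>P)"
    using G.nn_integral_fst[of "\<lambda>p. indicator A (fst p, chan n r p)" P] by simp
  also have "\<dots> = (\<integral>\<^sup>+x. \<integral>\<^sup>+z. ennreal (Lw n r x z) * indicator A (x, z) \<partial>stdg n \<partial>P)"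
  proof (rule nn_integral_cong)
    fix x assume x: "x \<in> space P"
    have A' [measurable]: "(\<lambda>z. indicator A (x, z) :: ennreal) \<in> borel_measurable (Rn n)"
    proof -
      have "(\<lambda>z. indicator A (x, z) :: ennreal) \<in> borel_measurable (stdg n)"
        by (rule measurable_compose[OF measurable_Pair1'[OF x] borel_measurable_indicator[OF A]])
      then show ?thesis by simp
    qed
    have L: "exp (dotp n (vscale n r x) z - dotp n (vscale n r x) (vscale n r x) / 2) = Lw n r x z" for z
      by (simp add: Lw_def dotp_commute[of n z x] power2_eq_square)
    have "(\<integral>\<^sup>+z. indicator A (x, affmap n (vscale n r x) 1 z) \<partial>stdg n) = (\<integral>\<^sup>+y. indicator A (x, y) \<partial>distr (stdg n) (Rn n) (affmap n (vscale n r x) 1))"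
    proof (rule nn_integral_distr[symmetric])
      show "affmap n (vscale n r x) 1 \<in> stdg n \<rightarrow>\<^sub>M Rn n" by measurable
    qed (use A' in simp)
    also have "\<dots> = (\<integral>\<^sup>+z. ennreal (Lw n r x z) * indicator A (x, z) \<partial>stdg n)"
      unfolding gauss_translate L
    proof (rule nn_integral_density)
      show "(\<lambda>z. ennreal (Lw n r x z)) \<in> borel_measurable (stdg n)" by measurable
    qed (use A' in simp)
    finally show "(\<integral>\<^sup>+z. indicator A (x, affmap n (vscale n r x) 1 z) \<partial>stdg n) = (\<integral>\<^sup>+z. ennreal (Lw n r x z) * indicator A (x, z) \<partial>stdg n)" .
  qed
  also have "\<dots> = (\<integral>\<^sup>+p. ennreal (Lw n r (fst p) (snd p)) * indicator A p \<partial>(P \<Otimes>\<^sub>M stdg n))"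
    using G.nn_integral_fst[of "\<lambda>p. ennreal (Lw n r (fst p) (snd p)) * indicator A p" P] by simp
  also have "\<dots> = emeasure (density (P \<Otimes>\<^sub>M stdg n) (\<lambda>p. ennreal (Lw n r (fst p) (snd p)))) A"
  proof (rule emeasure_density[symmetric])
    show "(\<lambda>p. ennreal (Lw n r (fst p) (snd p))) \<in> borel_measurable (P \<Otimes>\<^sub>M stdg n)" by measurable
  qed (rule A)
  finally show "emeasure (distr (P \<Otimes>\<^sub>M stdg n) (P \<Otimes>\<^sub>M stdg n) (\<lambda>p. (fst p, chan n r p))) A = \<dots>" .
qed simp

lemma integral_chan:
  assumes [measurable]: "H \<in> borel_measurable (P \<Otimes>\<^sub>M stdg n)"
  shows "(\<integral>p. H (fst p, chan n r p) \<partial>(P \<Otimes>\<^sub>M stdg n)) = (\<integral>p. H p * Lw n r (fst p) (snd p) \<partial>(P \<Otimes>\<^sub>M stdg n) :: real)"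
proof -
  have m [measurable]: "(\<lambda>p. (fst p, chan n r p)) \<in> P \<Otimes>\<^sub>M stdg n \<rightarrow>\<^sub>M P \<Otimes>\<^sub>M stdg n" by measurable
  have "(\<integral>p. H (fst p, chan n r p) \<partial>(P \<Otimes>\<^sub>M stdg n)) = (\<integral>p. H p \<partial>distr (P \<Otimes>\<^sub>M stdg n) (P \<Otimes>\<^sub>M stdg n) (\<lambda>p. (fst p, chan n r p)))"
    by (simp add: integral_distr)
  also have "\<dots> = (\<integral>p. H p * Lw n r (fst p) (snd p) \<partial>(P \<Otimes>\<^sub>M stdg n))"
    unfolding chan_distr by (simp add: integral_density mult.commute)
  finally show ?thesis .
qed

lemma vnorm_chan_le: "vnorm n (fst p) \<le> R \<Longrightarrow> vnorm n (chan n r p) \<le> \<bar>r\<bar> * R + vnorm n (snd p)"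
proof -
  assume x: "vnorm n (fst p) \<le> R"
  have "dotp n (chan n r p) (chan n r p) = r\<^sup>2 * dotp n (fst p) (fst p) + 2 * (r * dotp n (fst p) (snd p)) + dotp n (snd p) (snd p)"
    by (simp add: dotp_affmap_self power2_eq_square mult_ac)
  also have "\<dots> \<le> (\<bar>r\<bar> * R)\<^sup>2 + 2 * ((\<bar>r\<bar> * R) * vnorm n (snd p)) + (vnorm n (snd p))\<^sup>2"
  proof (intro add_mono mult_left_mono)
    have "(vnorm n (fst p))\<^sup>2 \<le> R\<^sup>2" by (rule power_mono[OF x]) simp
    then show "r\<^sup>2 * dotp n (fst p) (fst p) \<le> (\<bar>r\<bar> * R)\<^sup>2"
      unfolding power_mult_distrib power2_abs vnorm_sq by (rule mult_left_mono) simp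
    have "r * dotp n (fst p) (snd p) \<le> \<bar>r\<bar> * \<bar>dotp n (fst p) (snd p)\<bar>" by (metis abs_ge_self abs_mult)
    also have "\<dots> \<le> \<bar>r\<bar> * (R * vnorm n (snd p))"
      by (intro mult_left_mono order_trans[OF dotp_Cauchy_Schwarz] mult_right_mono x) auto
    finally show "r * dotp n (fst p) (snd p) \<le> \<bar>r\<bar> * R * vnorm n (snd p)" by (simp add: mult_ac)
  qed (auto simp: vnorm_sq)
  also have "\<dots> = (\<bar>r\<bar> * R + vnorm n (snd p))\<^sup>2" by (simp add: power2_sum)
  finally have "vnorm n (chan n r p) \<le> sqrt ((\<bar>r\<bar> * R + vnorm n (snd p))\<^sup>2)"
    unfolding vnorm_dotp[of n "chan n r p"] by (rule real_sqrt_le_mono)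
  then show ?thesis using R by (simp add: abs_of_nonneg)
qed

text \<open>The defining property of conditional expectation. After passing to the product measure
  with weight \<open>Lw\<close>, the input is integrated first and \<open>postf_Nf\<close> replaces
  \<open>a\<close> by its posterior mean.\<close>

lemma tower:
  assumes [measurable]: "\<rho> \<in> borel_measurable (Rn n)" "a \<in> borel_measurable (Rn n)"
    and a: "\<And>x. vnorm n x \<le> R \<Longrightarrow> \<bar>a x\<bar> \<le> A"
    and \<rho>: "\<And>y. \<bar>\<rho> y\<bar> \<le> C * (1 + (vnorm n y)\<^sup>2) ^ k"
  shows "(\<integral>p. \<rho> (chan n r p) * a (fst p) \<partial>(P \<Otimes>\<^sub>M stdg n)) = (\<integral>p. \<rho> (chan n r p) * postf P n r a (chan n r p) \<partial>(P \<Otimes>\<^sub>M stdg n))"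
proof -
  have int: "integrable (P \<Otimes>\<^sub>M stdg n) (\<lambda>(x, z). \<rho> z * b x z * Lw n r x z)"
    if [measurable]: "(\<lambda>p. b (fst p) (snd p)) \<in> borel_measurable (P \<Otimes>\<^sub>M stdg n)" and b: "\<And>x z. vnorm n x \<le> R \<Longrightarrow> \<bar>b x z\<bar> \<le> A" for b
  proof (rule integrable_pair_bound[where C="C * A" and k=k and \<rho>="\<bar>r\<bar> * R"])
    show "(\<lambda>(x, z). \<rho> z * b x z * Lw n r x z) \<in> borel_measurable (P \<Otimes>\<^sub>M stdg n)"
      by (simp add: split_beta')
    fix x z assume x: "vnorm n x \<le> R"
    have "\<bar>\<rho> z\<bar> * \<bar>b x z\<bar> * Lw n r x z \<le> (C * (1 + (vnorm n z)\<^sup>2) ^ k) * A * exp (\<bar>r\<bar> * R * vnorm n z)"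
      using \<rho>[of z] b[OF x, of z] Lw_le[OF x, of r z] order_trans[OF abs_ge_zero \<rho>[of z]] order_trans[OF abs_ge_zero b[OF x, of z]]
      by (intro mult_mono) auto
    then show "\<bar>case (x, z) of (x, z) \<Rightarrow> \<rho> z * b x z * Lw n r x z\<bar> \<le> C * A * (1 + (vnorm n z)\<^sup>2) ^ k * exp (\<bar>r\<bar> * R * vnorm n z)"
      by (simp add: abs_mult mult_ac)
  qed
  have i1: "integrable (P \<Otimes>\<^sub>M stdg n) (\<lambda>(x, z). \<rho> z * a x * Lw n r x z)"
    by (rule int) (use a in auto)
  have i2: "integrable (P \<Otimes>\<^sub>M stdg n) (\<lambda>(x, z). \<rho> z * postf P n r a z * Lw n r x z)"
    by (rule int) (use abs_postf_le[of a A] a in auto)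
  have "(\<integral>p. \<rho> (chan n r p) * a (fst p) \<partial>(P \<Otimes>\<^sub>M stdg n)) = (\<integral>p. (\<rho> (snd p) * a (fst p)) * Lw n r (fst p) (snd p) \<partial>(P \<Otimes>\<^sub>M stdg n))"
    using integral_chan[of "\<lambda>p. \<rho> (snd p) * a (fst p)" r] by simp
  also have "\<dots> = (\<integral>z. (\<integral>x. \<rho> z * a x * Lw n r x z \<partial>P) \<partial>stdg n)"
    using PG.integral_snd[OF i1] by (simp add: split_beta')
  also have "\<dots> = (\<integral>z. (\<integral>x. \<rho> z * postf P n r a z * Lw n r x z \<partial>P) \<partial>stdg n)"
    using postf_Nf[of r a] by (simp add: mult.assoc Nf_def)
  also have "\<dots> = (\<integral>p. (\<rho> (snd p) * postf P n r a (snd p)) * Lw n r (fst p) (snd p) \<partial>(P \<Otimes>\<^sub>M stdg n))"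
    using PG.integral_snd[OF i2] by (simp add: split_beta')
  also have "\<dots> = (\<integral>p. \<rho> (chan n r p) * postf P n r a (chan n r p) \<partial>(P \<Otimes>\<^sub>M stdg n))"
    using integral_chan[of "\<lambda>p. \<rho> (snd p) * postf P n r a (snd p)" r] by simp
  finally show ?thesis .
qed

end

section \<open>The derivative of mutual information\<close>

lemma vadd_eq_affmap: "vadd n x z = affmap n x 1 z"
  by (simp add: vadd_def affmap_def)

lemma one_plus_le_sq: "0 \<le> a \<Longrightarrow> 0 \<le> b \<Longrightarrow> a + b * v \<le> (a + b) * (1 + v\<^sup>2)" for a b v :: real
proof -
  assume ab: "0 \<le> a" "0 \<le> b"
  have "v \<le> 1 + v\<^sup>2" using zero_le_power2[of "v - 1 / 2"] by (simp add: power2_eq_square algebra_simps)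
  then have "b * v \<le> b * (1 + v\<^sup>2)" using ab by (intro mult_left_mono) auto
  moreover have "a * 1 \<le> a * (1 + v\<^sup>2)" using ab by (intro mult_left_mono) auto
  ultimately show ?thesis by (simp add: distrib_right)
qed

context bounded_input
begin

abbreviation "PS \<equiv> P \<Otimes>\<^sub>M stdg n"

text \<open>\<open>xh r\<close> is the conditional mean of the input given the output, so that \<open>m2 - xsq r\<close> is the minimum
  mean-square error.\<close>

definition m2 :: real where "m2 = (\<integral>x. dotp n x x \<partial>P)"
text \<open>The divergence of the law of \<open>r X + Z\<close> from that of \<open>Z\<close>, as
  the mean logarithm of the density.\<close>

definition J :: "real \<Rightarrow> real" where "J r = (\<integral>p. ln (Nf P n r (chan n r p)) \<partial>PS)"
definition xh :: "real \<Rightarrow> nat \<Rightarrow> (nat \<Rightarrow> real) \<Rightarrow> real" where "xh r i = postf P n r (\<lambda>x. x i)"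
definition xsq :: "real \<Rightarrow> real" where "xsq r = (\<integral>p. (\<Sum>i<n. (xh r i (chan n r p))\<^sup>2) \<partial>PS)"

lemma measurable_xh [measurable (raw)]:
  assumes "\<And>i. i < n \<Longrightarrow> (\<lambda>q. y q i) \<in> borel_measurable M" "i < n"
  shows "(\<lambda>q. xh r i (y q)) \<in> borel_measurable M"
  unfolding xh_def using assms by measurable

lemma abs_xh_le: "i < n \<Longrightarrow> \<bar>xh r i y\<bar> \<le> R"
  unfolding xh_def
proof (rule abs_postf_le)
  fix x assume i: "i < n" and "vnorm n x \<le> R"
  then show "\<bar>x i\<bar> \<le> R" using abs_component_le[OF i, of x] by simp
qed auto

lemma dotp_self_le: "vnorm n x \<le> R \<Longrightarrow> dotp n x x \<le> R\<^sup>2"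
  using power_mono[of "vnorm n x" R 2] by (simp add: vnorm_sq)

lemma dotp_chan: "dotp n (chan n r p) x = r * dotp n (fst p) x + dotp n (snd p) x"
  by (simp add: dotp_affmap_right dotp_commute[of n _ x])

lemma postf_add:
  assumes [measurable]: "a \<in> borel_measurable (Rn n)" "b \<in> borel_measurable (Rn n)"
    and "\<And>x. vnorm n x \<le> R \<Longrightarrow> \<bar>a x\<bar> \<le> A" "\<And>x. vnorm n x \<le> R \<Longrightarrow> \<bar>b x\<bar> \<le> B"
  shows "postf P n r (\<lambda>x. a x + b x) y = postf P n r a y + postf P n r b y"
  unfolding postf_def distrib_right
  by (subst Bochner_Integration.integral_add[OF integrable_Lw[OF assms(1,3)] integrable_Lw[OF assms(2,4)]])
     (auto simp: add_divide_distrib)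

lemma postf_cmult: "postf P n r (\<lambda>x. c * a x) y = c * postf P n r a y"
  by (simp add: postf_def mult.assoc)

lemma postf_dotp: "postf P n r (\<lambda>x. dotp n w x) y = (\<Sum>i<n. w i * xh r i y)"
proof -
  have int: "integrable P (\<lambda>x. x i * Lw n r x y)" if "i < n" for i
  proof (rule integrable_Lw[where A=R])
    fix x assume "vnorm n x \<le> R" then show "\<bar>x i\<bar> \<le> R" using abs_component_le[OF that, of x] by simp
  qed (use that in auto)
  have "(\<integral>x. dotp n w x * Lw n r x y \<partial>P) = (\<integral>x. (\<Sum>i<n. w i * (x i * Lw n r x y)) \<partial>P)"
    by (simp add: dotp_def sum_distrib_right mult.assoc)
  also have "\<dots> = (\<Sum>i<n. w i * (\<integral>x. x i * Lw n r x y \<partial>P))"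
    using int by (subst Bochner_Integration.integral_sum) auto
  finally show ?thesis by (simp add: postf_def xh_def sum_divide_distrib)
qed

text \<open>For \<open>p = (u, z)\<close> this is the derivative in \<open>r\<close> of
  \<open>ln (Lw n r x (r u + z))\<close>: the gain varies both in the likelihood and in the observed
  output.\<close>

definition uder :: "real \<Rightarrow> (nat \<Rightarrow> real) \<times> (nat \<Rightarrow> real) \<Rightarrow> (nat \<Rightarrow> real) \<Rightarrow> real" where
  "uder r p x = 2 * r * dotp n (fst p) x + dotp n (snd p) x - r * dotp n x x"

lemma measurable_uder [measurable]: "uder r p \<in> borel_measurable (Rn n)"
  unfolding uder_def[abs_def] by measurable

lemma abs_uder_le:
  assumes r: "0 \<le> r" "r \<le> M" and p: "vnorm n (fst p) \<le> R" and x: "vnorm n x \<le> R"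
  shows "\<bar>uder r p x\<bar> \<le> 3 * M * R\<^sup>2 + R * vnorm n (snd p)"
proof -
  have "\<bar>dotp n (fst p) x\<bar> \<le> R * R"
    by (rule order_trans[OF dotp_Cauchy_Schwarz]) (intro mult_mono p x R; simp)
  then have "\<bar>2 * r * dotp n (fst p) x\<bar> \<le> 2 * M * R\<^sup>2"
    unfolding abs_mult power2_eq_square using r by (intro mult_mono) auto
  moreover have "\<bar>dotp n (snd p) x\<bar> \<le> vnorm n (snd p) * R"
    by (rule order_trans[OF dotp_Cauchy_Schwarz]) (intro mult_left_mono x; simp)
  moreover have "\<bar>r * dotp n x x\<bar> \<le> M * R\<^sup>2"
    unfolding abs_mult using r dotp_self_le[OF x] by (intro mult_mono) auto
  ultimately show ?thesis unfolding uder_def by (simp add: mult.commute)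
qed

text \<open>The pair \<open>p\<close> stays fixed while the integration variable \<open>x\<close> is
  averaged. \<open>vnorm_chan_le\<close> bounds the output for all gains up to \<open>M\<close> and
  so supplies the envelope.\<close>

lemma DERIV_Nf_chan:
  assumes r: "0 \<le> r" "r \<le> M" and p: "vnorm n (fst p) \<le> R"
  shows "((\<lambda>r. Nf P n r (chan n r p)) has_real_derivative (\<integral>x. uder r p x * Lw n r x (chan n r p) \<partial>P)) (at r within {0..M})"
proof -
  have M: "M \<ge> 0" using r by simp
  let ?B = "exp (M * R * (M * R + vnorm n (snd p)))"
  have L: "Lw n t x (chan n t p) \<le> ?B" if t: "t \<in> {0..M}" and x: "vnorm n x \<le> R" for t x
  proof -
    have "Lw n t x (chan n t p) \<le> exp ((\<bar>t\<bar> * R) * vnorm n (chan n t p))" by (rule Lw_le[OF x])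
    also have "\<dots> \<le> exp ((M * R) * (M * R + vnorm n (snd p)))"
    proof -
      have "\<bar>t\<bar> * R \<le> M * R" using t R by (intro mult_right_mono) auto
      then show ?thesis using vnorm_chan_le[OF p, of t] R M t by (intro exp_le_cancel_iff[THEN iffD2] mult_mono) auto
    qed
    finally show ?thesis .
  qed
  have "((\<lambda>r. \<integral>x. Lw n r x (chan n r p) \<partial>P) has_real_derivative (\<integral>x. uder r p x * Lw n r x (chan n r p) \<partial>P)) (at r within {0..M})"
  proof (rule has_real_derivative_integral[where f="\<lambda>r x. Lw n r x (chan n r p)" and f'="\<lambda>r x. uder r p x * Lw n r x (chan n r p)"
        and G="\<lambda>_. (3 * M * R\<^sup>2 + R * vnorm n (snd p)) * ?B"])
    show "integrable P (\<lambda>x. Lw n t x (chan n t p))" for t by (rule integrable_Lw')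
    show "(\<lambda>x. uder r p x * Lw n r x (chan n r p)) \<in> borel_measurable P"
      using measurable_uder[of r p] by measurable
    show "AE x in P. \<forall>t\<in>{0..M}. ((\<lambda>t. Lw n t x (chan n t p)) has_real_derivative uder t p x * Lw n t x (chan n t p)) (at t within {0..M})"
    proof (intro AE_I2 ballI)
      fix x t
      have "((\<lambda>t. t * (t * dotp n (fst p) x + dotp n (snd p) x) - t\<^sup>2 * dotp n x x / 2) has_real_derivative uder t p x) (at t within {0..M})"
        unfolding uder_def by (auto intro!: derivative_eq_intros simp: algebra_simps)
      from DERIV_chain2[OF DERIV_exp this]
      show "((\<lambda>t. Lw n t x (chan n t p)) has_real_derivative uder t p x * Lw n t x (chan n t p)) (at t within {0..M})"
        unfolding Lw_def dotp_chan by (simp only: mult.commute)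
    qed
    show "AE x in P. \<forall>t\<in>{0..M}. \<bar>uder t p x * Lw n t x (chan n t p)\<bar> \<le> (3 * M * R\<^sup>2 + R * vnorm n (snd p)) * ?B"
      using bd
    proof eventually_elim
      case (elim x)
      show ?case
      proof
        fix t assume t: "t \<in> {0..M}"
        have "\<bar>uder t p x\<bar> * Lw n t x (chan n t p) \<le> (3 * M * R\<^sup>2 + R * vnorm n (snd p)) * ?B"
          using abs_uder_le[of t M p x] t p elim L[OF t elim] M R by (intro mult_mono) auto
        then show "\<bar>uder t p x * Lw n t x (chan n t p)\<bar> \<le> (3 * M * R\<^sup>2 + R * vnorm n (snd p)) * ?B"
          by (simp add: abs_mult)
      qed
    qed
  qed (use r in auto)
  then show ?thesis by (simp add: Nf_def)
qed

text \<open>The derivative in \<open>r\<close> of \<open>ln (Nf P n r (chan n r p))\<close>: the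
  logarithmic derivative of an average of likelihoods is the posterior mean of
  \<open>uder\<close>.\<close>

definition Dj :: "real \<Rightarrow> (nat \<Rightarrow> real) \<times> (nat \<Rightarrow> real) \<Rightarrow> real" where
  "Dj r p = postf P n r (uder r p) (chan n r p)"

text \<open>One copy of \<open>r * fst p\<close> is merged with the noise into the output, so that
  the remaining terms are conditional means given the output, ready for
  \<open>tower\<close>.\<close>

lemma Dj_eq:
  assumes p: "vnorm n (fst p) \<le> R" and r: "0 \<le> r"
  shows "Dj r p = (\<Sum>i<n. chan n r p i * xh r i (chan n r p)) + r * (\<Sum>i<n. fst p i * xh r i (chan n r p))
     - r * postf P n r (\<lambda>x. dotp n x x) (chan n r p)"
proof -
  let ?y = "chan n r p"
  have ca: "\<bar>dotp n w x\<bar> \<le> vnorm n w * R" if "vnorm n x \<le> R" for w x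
    by (rule order_trans[OF dotp_Cauchy_Schwarz]) (intro mult_left_mono that; simp)
  have sq: "\<bar>dotp n x x\<bar> \<le> R\<^sup>2" if "vnorm n x \<le> R" for x
    using dotp_self_le[OF that] by simp
  have "uder r p = (\<lambda>x. (dotp n ?y x + r * dotp n (fst p) x) + (- r) * dotp n x x)"
    by (rule ext) (simp add: uder_def dotp_chan)
  then have "Dj r p = postf P n r (\<lambda>x. (dotp n ?y x + r * dotp n (fst p) x) + (- r) * dotp n x x) ?y"
    by (simp only: Dj_def)
  also have "\<dots> = postf P n r (\<lambda>x. dotp n ?y x + r * dotp n (fst p) x) ?y + postf P n r (\<lambda>x. (- r) * dotp n x x) ?y"
  proof (rule postf_add[where A="vnorm n ?y * R + r * (vnorm n (fst p) * R)" and B="r * R\<^sup>2"])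
    fix x assume x: "vnorm n x \<le> R"
    have "\<bar>r * dotp n (fst p) x\<bar> \<le> r * (vnorm n (fst p) * R)"
      unfolding abs_mult using r ca[OF x, of "fst p"] by (intro mult_mono) auto
    then show "\<bar>dotp n ?y x + r * dotp n (fst p) x\<bar> \<le> vnorm n ?y * R + r * (vnorm n (fst p) * R)"
      using ca[OF x, of ?y] by linarith
    show "\<bar>- r * dotp n x x\<bar> \<le> r * R\<^sup>2" unfolding abs_mult using r sq[OF x] by (intro mult_mono) auto
  qed measurable
  also have "postf P n r (\<lambda>x. dotp n ?y x + r * dotp n (fst p) x) ?y = postf P n r (\<lambda>x. dotp n ?y x) ?y + postf P n r (\<lambda>x. r * dotp n (fst p) x) ?y"
  proof (rule postf_add[where A="vnorm n ?y * R" and B="r * (vnorm n (fst p) * R)"])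
    fix x assume x: "vnorm n x \<le> R"
    show "\<bar>dotp n ?y x\<bar> \<le> vnorm n ?y * R" by (rule ca[OF x])
    show "\<bar>r * dotp n (fst p) x\<bar> \<le> r * (vnorm n (fst p) * R)"
      unfolding abs_mult using r ca[OF x, of "fst p"] by (intro mult_mono) auto
  qed measurable
  finally show ?thesis unfolding postf_cmult postf_dotp by simp
qed

lemma abs_ln_Nf_le:
  "\<bar>ln (Nf P n r y)\<bar> \<le> (\<bar>r\<bar> * R) * vnorm n y + r\<^sup>2 * R\<^sup>2 / 2"
proof -
  have "ln (Nf P n r y) \<le> (\<bar>r\<bar> * R) * vnorm n y"
    using Nf_le[of r y] Nf_pos[of r y] by (metis ln_exp ln_le_cancel_iff exp_gt_zero)
  moreover have "ln (Nf P n r y) \<ge> - ((\<bar>r\<bar> * R) * vnorm n y) - r\<^sup>2 * R\<^sup>2 / 2"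
    using Nf_ge[of r y] Nf_pos[of r y] by (metis ln_exp ln_le_cancel_iff exp_gt_zero)
  moreover have "0 \<le> r\<^sup>2 * R\<^sup>2 / 2" by simp
  ultimately show ?thesis unfolding abs_le_iff by linarith
qed

lemma integrable_ln_Nf: "integrable PS (\<lambda>p. ln (Nf P n r (chan n r p)))"
proof (rule integrable_pair_bound[where C="((\<bar>r\<bar> * R) * (\<bar>r\<bar> * R) + r\<^sup>2 * R\<^sup>2 / 2) + \<bar>r\<bar> * R" and k=1 and \<rho>=0])
  fix x z assume x: "vnorm n x \<le> R"
  have "\<bar>ln (Nf P n r (chan n r (x, z)))\<bar> \<le> (\<bar>r\<bar> * R) * (\<bar>r\<bar> * R + vnorm n z) + r\<^sup>2 * R\<^sup>2 / 2"
    using R vnorm_chan_le[of "(x, z)" r] x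
    by (intro order_trans[OF abs_ln_Nf_le] add_mono mult_left_mono) auto
  also have "\<dots> = ((\<bar>r\<bar> * R) * (\<bar>r\<bar> * R) + r\<^sup>2 * R\<^sup>2 / 2) + (\<bar>r\<bar> * R) * vnorm n z" by (simp add: algebra_simps)
  also have "\<dots> \<le> (((\<bar>r\<bar> * R) * (\<bar>r\<bar> * R) + r\<^sup>2 * R\<^sup>2 / 2) + \<bar>r\<bar> * R) * (1 + (vnorm n z)\<^sup>2)"
    using R by (intro one_plus_le_sq) auto
  finally show "\<bar>ln (Nf P n r (chan n r (x, z)))\<bar> \<le> (((\<bar>r\<bar> * R) * (\<bar>r\<bar> * R) + r\<^sup>2 * R\<^sup>2 / 2) + \<bar>r\<bar> * R) * (1 + (vnorm n z)\<^sup>2) ^ 1 * exp (0 * vnorm n z)"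
    by simp
qed measurable

lemma integrable_coord_product:
  assumes ij: "i < n" shows "integrable PS (\<lambda>p. snd p i * fst p i)" "integrable PS (\<lambda>p. (fst p i)\<^sup>2)"
proof -
  have 1: "\<bar>x i\<bar> \<le> R" if "vnorm n x \<le> R" for x using abs_component_le[OF ij, of x] that by simp
  show "integrable PS (\<lambda>p. snd p i * fst p i)"
  proof (rule integrable_pair_bound[where C="R" and k=1 and \<rho>=0])
    fix x z assume x: "vnorm n x \<le> R"
    have "\<bar>z i\<bar> \<le> 0 + 1 * vnorm n z" using abs_component_le[OF ij, of z] by simp
    also have "\<dots> \<le> (0 + 1) * (1 + (vnorm n z)\<^sup>2)" by (rule one_plus_le_sq) auto
    finally have "\<bar>z i\<bar> * \<bar>x i\<bar> \<le> (1 + (vnorm n z)\<^sup>2) * R" using 1[OF x] by (intro mult_mono) auto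
    then show "\<bar>snd (x, z) i * fst (x, z) i\<bar> \<le> R * (1 + (vnorm n z)\<^sup>2) ^ 1 * exp (0 * vnorm n z)"
      by (simp add: abs_mult mult.commute)
  qed (use ij in measurable)
  show "integrable PS (\<lambda>p. (fst p i)\<^sup>2)"
  proof (rule integrable_pair_bound[where C="R\<^sup>2" and k=0 and \<rho>=0])
    fix x z assume x: "vnorm n x \<le> R"
    show "\<bar>(fst (x, z) i)\<^sup>2\<bar> \<le> R\<^sup>2 * (1 + (vnorm n z)\<^sup>2) ^ 0 * exp (0 * vnorm n z)"
      using power_mono[OF 1[OF x], of 2] by simp
  qed (use ij in measurable)
qed

lemma integral_coord_product: assumes i: "i < n" shows "(\<integral>p. snd p i * fst p i \<partial>PS) = 0"
proof -
  have "integrable PS (\<lambda>(x, z). z i * x i)"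
    using integrable_coord_product(1)[OF i] by (simp add: split_beta')
  from PG.integral_fst[OF this]
  have "(\<integral>p. snd p i * fst p i \<partial>PS) = (\<integral>x. (\<integral>z. z i * x i \<partial>stdg n) \<partial>P)" by (simp add: split_beta')
  also have "\<dots> = (\<integral>x. 0 \<partial>P)"
  proof (intro Bochner_Integration.integral_cong refl)
    fix x
    show "(\<integral>z. z i * x i \<partial>stdg n) = 0"
      by (rule integral_stdg_odd) (use i in \<open>auto simp: vscale_def\<close>)
  qed
  finally show ?thesis by simp
qed

lemma m2_eq: "(\<integral>p. (\<Sum>i<n. (fst p i)\<^sup>2) \<partial>PS) = m2"
proof -
  have "(\<integral>p. (\<Sum>i<n. (fst p i)\<^sup>2) \<partial>PS) = (\<integral>x. (\<Sum>i<n. (x i)\<^sup>2) \<partial>P)"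
    by (rule integral_fst_fun[of "\<lambda>x. \<Sum>i<n. (x i)\<^sup>2"]) measurable
  then show ?thesis by (simp add: m2_def dotp_def power2_eq_square)
qed

lemma chan_component: "i < n \<Longrightarrow> chan n r p i = r * fst p i + snd p i"
  by (simp add: affmap_def vscale_def)

lemma integral_chan_fst: "(\<integral>p. (\<Sum>i<n. chan n r p i * fst p i) \<partial>PS) = r * m2"
  and integrable_chan_fst: "integrable PS (\<lambda>p. \<Sum>i<n. chan n r p i * fst p i)"
proof -
  have e: "(\<Sum>i<n. chan n r p i * fst p i) = r * (\<Sum>i<n. (fst p i)\<^sup>2) + (\<Sum>i<n. snd p i * fst p i)" for p
    unfolding sum_distrib_left sum.distrib[symmetric]
    by (intro sum.cong refl) (simp add: chan_component power2_eq_square algebra_simps)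
  have i1: "integrable PS (\<lambda>p. \<Sum>i<n. (fst p i)\<^sup>2)" and i2: "integrable PS (\<lambda>p. \<Sum>i<n. snd p i * fst p i)"
    using integrable_coord_product by auto
  show "integrable PS (\<lambda>p. \<Sum>i<n. chan n r p i * fst p i)" unfolding e using i1 i2 by simp
  have "(\<integral>p. (\<Sum>i<n. chan n r p i * fst p i) \<partial>PS) = r * (\<integral>p. (\<Sum>i<n. (fst p i)\<^sup>2) \<partial>PS) + (\<integral>p. (\<Sum>i<n. snd p i * fst p i) \<partial>PS)"
    unfolding e using i1 i2 by simp
  also have "(\<integral>p. (\<Sum>i<n. snd p i * fst p i) \<partial>PS) = 0"
    using integrable_coord_product integral_coord_product by (subst Bochner_Integration.integral_sum) auto
  finally show "(\<integral>p. (\<Sum>i<n. chan n r p i * fst p i) \<partial>PS) = r * m2" by (simp add: m2_eq)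
qed

lemma integrable_xh_products:
  assumes i: "i < n"
  shows "integrable PS (\<lambda>p. chan n r p i * xh r i (chan n r p))" (is ?A)
    and "integrable PS (\<lambda>p. xh r i (chan n r p) * fst p i)" (is ?B)
    and "integrable PS (\<lambda>p. (xh r i (chan n r p))\<^sup>2)" (is ?C)
proof -
  have 1: "\<bar>x i\<bar> \<le> R" if "vnorm n x \<le> R" for x using abs_component_le[OF i, of x] that by simp
  show ?A
  proof (rule integrable_pair_bound[where C="(\<bar>r\<bar> * R + 1) * R" and k=1 and \<rho>=0])
    fix x z assume x: "vnorm n x \<le> R"
    have "\<bar>chan n r (x, z) i\<bar> \<le> \<bar>r\<bar> * R + 1 * vnorm n z"
      using order_trans[OF abs_component_le[OF i] vnorm_chan_le[of "(x, z)" r]] x by simp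
    also have "\<dots> \<le> (\<bar>r\<bar> * R + 1) * (1 + (vnorm n z)\<^sup>2)" using R by (intro one_plus_le_sq) auto
    finally have "\<bar>chan n r (x, z) i\<bar> * \<bar>xh r i (chan n r (x, z))\<bar> \<le> (\<bar>r\<bar> * R + 1) * (1 + (vnorm n z)\<^sup>2) * R"
      using abs_xh_le[OF i] R by (intro mult_mono) auto
    then show "\<bar>chan n r (x, z) i * xh r i (chan n r (x, z))\<bar> \<le> (\<bar>r\<bar> * R + 1) * R * (1 + (vnorm n z)\<^sup>2) ^ 1 * exp (0 * vnorm n z)"
      by (simp add: abs_mult mult_ac)
  qed (use i in measurable)
  show ?B
  proof (rule integrable_pair_bound[where C="R * R" and k=0 and \<rho>=0])
    fix x z assume x: "vnorm n x \<le> R"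
    have "\<bar>xh r i (chan n r (x, z))\<bar> * \<bar>x i\<bar> \<le> R * R"
      using abs_xh_le[OF i] R 1[OF x] by (intro mult_mono) auto
    then show "\<bar>xh r i (chan n r (x, z)) * fst (x, z) i\<bar> \<le> R * R * (1 + (vnorm n z)\<^sup>2) ^ 0 * exp (0 * vnorm n z)"
      by (simp add: abs_mult)
  qed (use i in measurable)
  show ?C
  proof (rule integrable_pair_bound[where C="R\<^sup>2" and k=0 and \<rho>=0])
    fix x z assume x: "vnorm n x \<le> R"
    show "\<bar>(xh r i (chan n r (x, z)))\<^sup>2\<bar> \<le> R\<^sup>2 * (1 + (vnorm n z)\<^sup>2) ^ 0 * exp (0 * vnorm n z)"
      using power_mono[OF abs_xh_le[OF i, of r "chan n r (x, z)"], of 2] by simp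
  qed (use i in measurable)
qed

lemma tower_coord:
  assumes i: "i < n" and [measurable]: "\<rho> \<in> borel_measurable (Rn n)" and \<rho>: "\<And>y. \<bar>\<rho> y\<bar> \<le> C * (1 + (vnorm n y)\<^sup>2) ^ k"
  shows "(\<integral>p. \<rho> (chan n r p) * fst p i \<partial>PS) = (\<integral>p. \<rho> (chan n r p) * xh r i (chan n r p) \<partial>PS)"
  unfolding xh_def
proof (rule tower[where A=R])
  fix x assume "vnorm n x \<le> R" then show "\<bar>x i\<bar> \<le> R" using abs_component_le[OF i, of x] by simp
qed (use i \<rho> in auto)

text \<open>By the tower property the three terms of \<open>Dj_eq\<close> have means
  \<open>r * m2\<close>, \<open>r * xsq r\<close> and \<open>r * m2\<close>, and the first cancels
  the third.\<close>

lemma integral_Dj: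
  assumes r: "0 \<le> r" shows "(\<integral>p. Dj r p \<partial>PS) = r * xsq r"
proof -
  let ?A = "\<lambda>p. \<Sum>i<n. chan n r p i * xh r i (chan n r p)"
  let ?B = "\<lambda>p. \<Sum>i<n. fst p i * xh r i (chan n r p)"
  let ?C = "\<lambda>p. postf P n r (\<lambda>x. dotp n x x) (chan n r p)"
  have iA: "integrable PS ?A" using integrable_xh_products(1) by auto
  have iB: "integrable PS ?B" using integrable_xh_products(2) by (auto simp: mult.commute)
  have sq: "\<bar>dotp n x x\<bar> \<le> R\<^sup>2" if "vnorm n x \<le> R" for x
    using dotp_self_le[OF that] by simp
  have iC: "integrable PS ?C"
  proof (rule integrable_pair_bound[where C="R\<^sup>2" and k=0 and \<rho>=0])
    fix x z
    show "\<bar>?C (x, z)\<bar> \<le> R\<^sup>2 * (1 + (vnorm n z)\<^sup>2) ^ 0 * exp (0 * vnorm n z)"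
      using abs_postf_le[of "\<lambda>x. dotp n x x" "R\<^sup>2"] sq by simp
  qed measurable
  have "(\<integral>p. Dj r p \<partial>PS) = (\<integral>p. ?A p + r * ?B p - r * ?C p \<partial>PS)"
  proof (rule integral_cong_AE)
    have "(\<lambda>p. Dj r p) \<in> borel_measurable PS"
      unfolding Dj_def postf_def uder_def
      by (intro borel_measurable_divide borel_measurable_lebesgue_integral) (simp_all add: split_beta', measurable)
    then show "Dj r \<in> borel_measurable PS" by simp
    show "(\<lambda>p. ?A p + r * ?B p - r * ?C p) \<in> borel_measurable PS"
      using iA iB iC by auto
    show "AE p in PS. Dj r p = ?A p + r * ?B p - r * ?C p"
      using AE_pair_bd by eventually_elim (rule Dj_eq[OF _ r])
  qed
  also have "\<dots> = (\<integral>p. ?A p \<partial>PS) + r * (\<integral>p. ?B p \<partial>PS) - r * (\<integral>p. ?C p \<partial>PS)"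
    using iA iB iC by simp
  also have "(\<integral>p. ?A p \<partial>PS) = r * m2"
  proof -
    have c: "(\<integral>p. chan n r p i * fst p i \<partial>PS) = (\<integral>p. chan n r p i * xh r i (chan n r p) \<partial>PS)" if i: "i < n" for i
    proof (rule tower_coord[OF i, where \<rho>="\<lambda>y. y i" and C=1 and k=1])
      fix y :: "nat \<Rightarrow> real"
      have "\<bar>y i\<bar> \<le> 0 + 1 * vnorm n y" using abs_component_le[OF i, of y] by simp
      also have "\<dots> \<le> (0 + 1) * (1 + (vnorm n y)\<^sup>2)" by (rule one_plus_le_sq) auto
      finally show "\<bar>y i\<bar> \<le> 1 * (1 + (vnorm n y)\<^sup>2) ^ 1" by simp
    qed (use i in measurable)
    have ii: "integrable PS (\<lambda>p. chan n r p i * fst p i)" if i: "i < n" for i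
    proof -
      have "integrable PS (\<lambda>p. r * (fst p i)\<^sup>2 + snd p i * fst p i)"
        using integrable_coord_product[OF i] by simp
      then show ?thesis using i by (simp add: chan_component power2_eq_square algebra_simps)
    qed
    have "(\<integral>p. ?A p \<partial>PS) = (\<Sum>i<n. \<integral>p. chan n r p i * xh r i (chan n r p) \<partial>PS)"
      using integrable_xh_products(1) by (intro Bochner_Integration.integral_sum) auto
    also have "\<dots> = (\<Sum>i<n. \<integral>p. chan n r p i * fst p i \<partial>PS)" using c by simp
    also have "\<dots> = (\<integral>p. (\<Sum>i<n. chan n r p i * fst p i) \<partial>PS)"
      using ii by (intro Bochner_Integration.integral_sum[symmetric]) auto
    finally show ?thesis by (simp add: integral_chan_fst)
  qed
  also have "(\<integral>p. ?B p \<partial>PS) = xsq r"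
  proof -
    have c: "(\<integral>p. xh r i (chan n r p) * fst p i \<partial>PS) = (\<integral>p. xh r i (chan n r p) * xh r i (chan n r p) \<partial>PS)" if i: "i < n" for i
      by (rule tower_coord[OF i, where \<rho>="xh r i" and C=R and k=0]) (use i abs_xh_le[OF i] in auto)
    have "(\<integral>p. ?B p \<partial>PS) = (\<Sum>i<n. \<integral>p. xh r i (chan n r p) * fst p i \<partial>PS)"
      using integrable_xh_products(2) by (subst Bochner_Integration.integral_sum) (auto simp: mult.commute)
    also have "\<dots> = (\<Sum>i<n. \<integral>p. (xh r i (chan n r p))\<^sup>2 \<partial>PS)" using c by (simp add: power2_eq_square)
    also have "\<dots> = xsq r"
      unfolding xsq_def using integrable_xh_products(3) by (intro Bochner_Integration.integral_sum[symmetric]) auto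
    finally show ?thesis .
  qed
  also have "(\<integral>p. ?C p \<partial>PS) = m2"
  proof -
    have "(\<integral>p. 1 * dotp n (fst p) (fst p) \<partial>PS) = (\<integral>p. 1 * ?C p \<partial>PS)"
      by (rule tower[where \<rho>="\<lambda>_. 1" and A="R\<^sup>2" and C=1 and k=0]) (use sq in auto)
    moreover have "(\<integral>p. dotp n (fst p) (fst p) \<partial>PS) = m2"
      unfolding m2_def by (rule integral_fst_fun[of "\<lambda>x. dotp n x x"]) measurable
    ultimately show ?thesis by simp
  qed
  finally show ?thesis by simp
qed

text \<open>The I-MMSE relation in terms of the gain. The derivative is taken within
  \<open>{0..M}\<close> because the envelope grows with the gain.\<close>

lemma DERIV_J:
  assumes r: "0 \<le> r" "r \<le> M"
  shows "(J has_real_derivative r * xsq r) (at r within {0..M})"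
proof -
  have M: "M \<ge> 0" using r by simp
  have "((\<lambda>r. \<integral>p. ln (Nf P n r (chan n r p)) \<partial>PS) has_real_derivative (\<integral>p. Dj r p \<partial>PS)) (at r within {0..M})"
  proof (rule has_real_derivative_integral[where f="\<lambda>r p. ln (Nf P n r (chan n r p))" and f'=Dj
        and G="\<lambda>p. 3 * M * R\<^sup>2 + R * vnorm n (snd p)"])
    show "integrable PS (\<lambda>p. ln (Nf P n t (chan n t p)))" for t by (rule integrable_ln_Nf)
    show "Dj r \<in> borel_measurable PS"
      unfolding Dj_def[abs_def] postf_def uder_def
      by (intro borel_measurable_divide borel_measurable_lebesgue_integral) (simp_all add: split_beta', measurable)
    show "integrable PS (\<lambda>p. 3 * M * R\<^sup>2 + R * vnorm n (snd p))"
    proof (rule integrable_pair_bound[where C="3 * M * R\<^sup>2 + R" and k=1 and \<rho>=0])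
      fix x z
      have "3 * M * R\<^sup>2 + R * vnorm n z \<le> (3 * M * R\<^sup>2 + R) * (1 + (vnorm n z)\<^sup>2)"
        using M R by (intro one_plus_le_sq) auto
      moreover have "0 \<le> 3 * M * R\<^sup>2 + R * vnorm n z" using M R by auto
      ultimately show "\<bar>3 * M * R\<^sup>2 + R * vnorm n (snd (x, z))\<bar> \<le> (3 * M * R\<^sup>2 + R) * (1 + (vnorm n z)\<^sup>2) ^ 1 * exp (0 * vnorm n z)"
        by simp
    qed measurable
    show "AE p in PS. \<forall>t\<in>{0..M}. ((\<lambda>t. ln (Nf P n t (chan n t p))) has_real_derivative Dj t p) (at t within {0..M})"
      using AE_pair_bd
    proof eventually_elim
      case (elim p)
      show ?case
      proof
        fix t assume t: "t \<in> {0..M}"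
        have "((\<lambda>t. ln (Nf P n t (chan n t p))) has_real_derivative 1 / Nf P n t (chan n t p) * (\<integral>x. uder t p x * Lw n t x (chan n t p) \<partial>P)) (at t within {0..M})"
          by (rule DERIV_chain2[OF DERIV_ln_divide[OF Nf_pos] DERIV_Nf_chan]) (use t elim in auto)
        then show "((\<lambda>t. ln (Nf P n t (chan n t p))) has_real_derivative Dj t p) (at t within {0..M})"
          by (simp add: Dj_def postf_def)
      qed
    qed
    show "AE p in PS. \<forall>t\<in>{0..M}. \<bar>Dj t p\<bar> \<le> 3 * M * R\<^sup>2 + R * vnorm n (snd p)"
      using AE_pair_bd
    proof eventually_elim
      case (elim p)
      show ?case unfolding Dj_def
        by (intro ballI abs_postf_le abs_uder_le measurable_uder elim) auto
    qed
  qed (use r in auto)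
  then show ?thesis unfolding integral_Dj[OF r(1)] by (simp add: J_def[abs_def])
qed

end

section \<open>Mutual information and the secrecy rate as an integral\<close>

lemma measurable_vadd [measurable (raw)]:
  assumes [measurable]: "\<And>i. i < n \<Longrightarrow> (\<lambda>q. x q i) \<in> borel_measurable M" "\<And>i. i < n \<Longrightarrow> (\<lambda>q. z q i) \<in> borel_measurable M"
  shows "(\<lambda>q. vadd n (x q) (z q)) \<in> M \<rightarrow>\<^sub>M Rn n"
  unfolding vadd_eq_affmap by measurable

context bounded_input
begin

text \<open>Rescaling by \<open>r = 1 / sqrt v\<close> standardises the noise. Joint law and product
  of marginals have densities \<open>L\<close> and \<open>N\<close> relative to one product measure,
  so the divergence is the mean of \<open>ln L - ln N\<close>: the first part gives
  \<open>m2 / (2 v)\<close>, the second \<open>J\<close>.\<close>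

lemma awgn_mi_eq:
  assumes v: "v > 0"
  shows "awgn_mi n v P = m2 / (2 * v) - J (1 / sqrt v)"
proof -
  define c where "c = sqrt v"
  define r where "r = 1 / c"
  have c: "c > 0" "c\<^sup>2 = v" using v by (auto simp: c_def)
  have rc: "r * c = 1" "c * r = 1" using c by (auto simp: r_def)
  let ?G = "gauss n v"
  interpret V: prob_space ?G by (rule prob_space_gauss) (rule v)
  interpret PV: pair_prob_space P ?G ..
  define T where "T p = (fst p, vscale n c (snd p))" for p :: "(nat \<Rightarrow> real) \<times> (nat \<Rightarrow> real)"
  have T [measurable]: "T \<in> PS \<rightarrow>\<^sub>M P \<Otimes>\<^sub>M ?G" unfolding T_def by measurable
  \<comment> \<open>\<open>T\<close> restores the noise of standard deviation \<open>c\<close>, so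
    facts about \<open>chan\<close> transfer by push-forward.\<close>
  have PVT: "P \<Otimes>\<^sub>M ?G = distr PS (P \<Otimes>\<^sub>M ?G) T"
  proof -
    have g: "?G = distr (stdg n) ?G (vscale n c)"
    proof -
      have "distr (stdg n) ?G (vscale n c) = distr (stdg n) (Rn n) (vscale n c)" by (rule distr_cong) auto
      then show ?thesis using gauss_scale[OF c(1), of n] c(2) by simp
    qed
    have p: "P = distr P P (\<lambda>x. x)" by (simp add: distr_id2)
    have "P \<Otimes>\<^sub>M ?G = distr P P (\<lambda>x. x) \<Otimes>\<^sub>M distr (stdg n) ?G (vscale n c)"
      using p g by simp
    also have "\<dots> = distr PS (P \<Otimes>\<^sub>M ?G) (\<lambda>(x, y). (x, vscale n c y))"
      by (rule pair_measure_distr) (auto simp: g[symmetric] V.sigma_finite_measure_axioms)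
    finally show ?thesis by (simp add: T_def[abs_def] split_beta')
  qed
  define L where "L p = Lw n r (fst p) (vscale n r (snd p))" for p :: "(nat \<Rightarrow> real) \<times> (nat \<Rightarrow> real)"
  define N where "N y = Nf P n r (vscale n r y)" for y :: "nat \<Rightarrow> real"
  have [measurable]: "L \<in> borel_measurable (P \<Otimes>\<^sub>M ?G)" unfolding L_def by measurable
  have [measurable]: "N \<in> borel_measurable (Rn n)" unfolding N_def by measurable
  have vv: "Lw n s x (vscale n r (vscale n c y)) = Lw n s x y" for s x y
    using rc by (simp add: Lw_def)
  have LT: "L (T p) = Lw n r (fst p) (snd p)" for p
    by (simp add: L_def T_def vv del: vscale_vscale)
  have NT: "N (vscale n c y) = Nf P n r y" for y
    by (simp add: N_def Nf_def vv del: vscale_vscale)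
  have Lpos: "L p \<ge> 0" for p by (simp add: L_def)
  have Npos: "N y > 0" for y by (simp add: N_def Nf_pos)
  let ?W = "\<lambda>p. vadd n (fst p) (snd p)"
  have joint: "distr (P \<Otimes>\<^sub>M ?G) (P \<Otimes>\<^sub>M ?G) (\<lambda>p. (fst p, ?W p)) = density (P \<Otimes>\<^sub>M ?G) (\<lambda>p. ennreal (L p))"
  proof -
    have "distr (P \<Otimes>\<^sub>M ?G) (P \<Otimes>\<^sub>M ?G) (\<lambda>p. (fst p, ?W p)) = distr (distr PS (P \<Otimes>\<^sub>M ?G) T) (P \<Otimes>\<^sub>M ?G) (\<lambda>p. (fst p, ?W p))"
      using PVT by simp
    also have "\<dots> = distr PS (P \<Otimes>\<^sub>M ?G) (\<lambda>p. (fst (T p), ?W (T p)))"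
      by (subst distr_distr) (auto simp: comp_def)
    also have "\<dots> = distr PS (P \<Otimes>\<^sub>M ?G) (\<lambda>p. T (fst p, chan n r p))"
    proof (rule distr_cong[OF refl refl])
      fix p assume "p \<in> space PS"
      show "(fst (T p), ?W (T p)) = T (fst p, chan n r p)"
        using rc by (auto simp: T_def vadd_def vscale_def affmap_def fun_eq_iff distrib_left mult.assoc[symmetric])
    qed
    also have "\<dots> = distr (distr PS PS (\<lambda>p. (fst p, chan n r p))) (P \<Otimes>\<^sub>M ?G) T"
      by (subst distr_distr) (auto simp: comp_def)
    also have "\<dots> = distr (density PS (\<lambda>p. ennreal (L (T p)))) (P \<Otimes>\<^sub>M ?G) T"
      unfolding chan_distr LT ..
    also have "\<dots> = density (distr PS (P \<Otimes>\<^sub>M ?G) T) (\<lambda>p. ennreal (L p))"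
      by (rule density_distr[symmetric]) measurable
    finally show ?thesis using PVT by simp
  qed
  have marg: "distr (P \<Otimes>\<^sub>M ?G) ?G ?W = density ?G (\<lambda>y. ennreal (N y))"
  proof -
    have "distr (P \<Otimes>\<^sub>M ?G) ?G ?W = distr (distr (P \<Otimes>\<^sub>M ?G) (P \<Otimes>\<^sub>M ?G) (\<lambda>p. (fst p, ?W p))) ?G snd"
      by (subst distr_distr) (auto simp: comp_def)
    also have "\<dots> = distr (density (P \<Otimes>\<^sub>M ?G) (\<lambda>p. ennreal (L p))) ?G snd"
      unfolding joint ..
    also have "\<dots> = density ?G (\<lambda>y. ennreal (N y))"
    proof (rule measure_eqI)
      fix A assume "A \<in> sets (distr (density (P \<Otimes>\<^sub>M ?G) (\<lambda>p. ennreal (L p))) ?G snd)"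
      then have A [measurable]: "A \<in> sets ?G" by simp
      let ?D = "distr (density (P \<Otimes>\<^sub>M ?G) (\<lambda>p. ennreal (L p))) ?G snd"
      have "emeasure ?D A = (\<integral>\<^sup>+y. indicator A y \<partial>?D)"
        by (rule nn_integral_indicator[symmetric]) (simp only: sets_distr A)
      also have "\<dots> = (\<integral>\<^sup>+p. indicator A (snd p) \<partial>density (P \<Otimes>\<^sub>M ?G) (\<lambda>p. ennreal (L p)))"
        by (rule nn_integral_distr) measurable
      also have "\<dots> = (\<integral>\<^sup>+p. ennreal (L p) * indicator A (snd p) \<partial>(P \<Otimes>\<^sub>M ?G))"
        by (rule nn_integral_density) measurable
      also have "\<dots> = (\<integral>\<^sup>+y. (\<integral>\<^sup>+x. ennreal (L (x, y)) * indicator A y \<partial>P) \<partial>?G)"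
        using PV.nn_integral_snd[of "\<lambda>p. ennreal (L p) * indicator A (snd p)"] by (simp add: split_beta')
      also have "\<dots> = (\<integral>\<^sup>+y. ennreal (N y) * indicator A y \<partial>?G)"
      proof (rule nn_integral_cong)
        fix y
        have "(\<integral>\<^sup>+x. ennreal (L (x, y)) * indicator A y \<partial>P) = (\<integral>\<^sup>+x. ennreal (L (x, y)) \<partial>P) * indicator A y"
          by (rule nn_integral_multc) (unfold L_def fst_conv snd_conv, measurable)
        also have "(\<integral>\<^sup>+x. ennreal (L (x, y)) \<partial>P) = ennreal (N y)"
          unfolding N_def Nf_def L_def fst_conv snd_conv
          by (rule nn_integral_eq_integral[OF integrable_Lw']) simp
        finally show "(\<integral>\<^sup>+x. ennreal (L (x, y)) * indicator A y \<partial>P) = ennreal (N y) * indicator A y" .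
      qed
      also have "\<dots> = emeasure (density ?G (\<lambda>y. ennreal (N y))) A"
      proof (rule emeasure_density[symmetric])
        have "(\<lambda>y. ennreal (N y)) \<in> borel_measurable (Rn n)" by measurable
        then show "(\<lambda>y. ennreal (N y)) \<in> borel_measurable ?G" by simp
      qed (rule A)
      finally show "emeasure ?D A = emeasure (density ?G (\<lambda>y. ennreal (N y))) A" .
    qed simp
    finally show ?thesis .
  qed
  have prod: "P \<Otimes>\<^sub>M density ?G (\<lambda>y. ennreal (N y)) = density (P \<Otimes>\<^sub>M ?G) (\<lambda>p. ennreal (N (snd p)))"
  proof -
    have sf: "sigma_finite_measure (density ?G (\<lambda>y. ennreal (N y)))"
      unfolding marg[symmetric] by (intro prob_space_imp_sigma_finite PV.prob_space_distr) measurable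
    have "density P (\<lambda>_. 1) \<Otimes>\<^sub>M density ?G (\<lambda>y. ennreal (N y)) = density (P \<Otimes>\<^sub>M ?G) (\<lambda>(x, y). 1 * ennreal (N y))"
      by (rule pair_measure_density[OF _ _ _ sf]) (auto simp: V.sigma_finite_measure_axioms)
    then show ?thesis by (simp add: density_1 split_beta')
  qed
  have sP: "distr (P \<Otimes>\<^sub>M ?G) (Rn n) fst = P"
  proof -
    have "distr (P \<Otimes>\<^sub>M ?G) (Rn n) fst = distr (P \<Otimes>\<^sub>M ?G) P fst" by (rule distr_cong) auto
    then show ?thesis by (simp add: V.distr_pair_fst)
  qed
  have sW: "distr (P \<Otimes>\<^sub>M ?G) (Rn n) ?W = density ?G (\<lambda>y. ennreal (N y))"
  proof -
    have "distr (P \<Otimes>\<^sub>M ?G) (Rn n) ?W = distr (P \<Otimes>\<^sub>M ?G) ?G ?W" by (rule distr_cong) auto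
    then show ?thesis by (simp add: marg)
  qed
  have sJ: "distr (P \<Otimes>\<^sub>M ?G) (Rn n \<Otimes>\<^sub>M Rn n) (\<lambda>p. (fst p, ?W p)) = density (P \<Otimes>\<^sub>M ?G) (\<lambda>p. ennreal (L p))"
  proof -
    have "distr (P \<Otimes>\<^sub>M ?G) (Rn n \<Otimes>\<^sub>M Rn n) (\<lambda>p. (fst p, ?W p)) = distr (P \<Otimes>\<^sub>M ?G) (P \<Otimes>\<^sub>M ?G) (\<lambda>p. (fst p, ?W p))"
      by (rule distr_cong[OF refl _ refl]) (intro sets_pair_measure_cong; simp)
    then show ?thesis by (simp add: joint)
  qed
  have "awgn_mi n v P = KL_divergence (exp 1) (density (P \<Otimes>\<^sub>M ?G) (\<lambda>p. ennreal (N (snd p)))) (density (P \<Otimes>\<^sub>M ?G) (\<lambda>p. ennreal (L p)))"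
    unfolding awgn_mi_def PV.mutual_information_def split_beta' sP sW sJ prod ..
  also have "\<dots> = (\<integral>p. L p * log (exp 1) (L p / N (snd p)) \<partial>(P \<Otimes>\<^sub>M ?G))"
  proof (rule PV.KL_density_density)
    show "AE p in P \<Otimes>\<^sub>M ?G. N (snd p) = 0 \<longrightarrow> L p = 0" using Npos by (simp add: less_le)
  qed (auto simp: Lpos Npos less_imp_le)
  also have "\<dots> = (\<integral>p. L (T p) * log (exp 1) (L (T p) / N (snd (T p))) \<partial>PS)"
    by (subst PVT, subst integral_distr) auto
  also have "\<dots> = (\<integral>p. ln (Lw n r (fst p) (snd p) / Nf P n r (snd p)) * Lw n r (fst p) (snd p) \<partial>PS)"
  proof -
    have "N (snd (T p)) = Nf P n r (snd p)" for p by (simp add: T_def NT)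
    then show ?thesis unfolding LT by (simp add: log_def mult.commute)
  qed
  also have "\<dots> = (\<integral>p. ln (Lw n r (fst p) (chan n r p) / Nf P n r (chan n r p)) \<partial>PS)"
    using integral_chan[of "\<lambda>p. ln (Lw n r (fst p) (snd p) / Nf P n r (snd p))" r] by simp
  also have "\<dots> = (\<integral>p. r * (\<Sum>i<n. chan n r p i * fst p i) - r\<^sup>2 / 2 * (\<Sum>i<n. (fst p i)\<^sup>2) - ln (Nf P n r (chan n r p)) \<partial>PS)"
  proof (intro Bochner_Integration.integral_cong refl)
    fix p
    have "ln (Lw n r (fst p) (chan n r p) / Nf P n r (chan n r p)) = ln (Lw n r (fst p) (chan n r p)) - ln (Nf P n r (chan n r p))"
      by (rule ln_divide_pos) (auto simp: Nf_pos)
    then show "ln (Lw n r (fst p) (chan n r p) / Nf P n r (chan n r p))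
      = r * (\<Sum>i<n. chan n r p i * fst p i) - r\<^sup>2 / 2 * (\<Sum>i<n. (fst p i)\<^sup>2) - ln (Nf P n r (chan n r p))"
      by (simp add: Lw_def dotp_def power2_eq_square)
  qed
  also have "\<dots> = r * (r * m2) - r\<^sup>2 / 2 * m2 - J r"
  proof -
    have i2: "integrable PS (\<lambda>p. \<Sum>i<n. (fst p i)\<^sup>2)" using integrable_coord_product by auto
    show ?thesis
      using integrable_chan_fst[of r] i2 integrable_ln_Nf[of r] by (simp add: integral_chan_fst m2_eq J_def)
  qed
  also have "\<dots> = m2 / (2 * v) - J (1 / sqrt v)"
  proof -
    have "r\<^sup>2 = 1 / v" using c by (simp add: r_def power_divide)
    moreover have "r * (r * m2) - r\<^sup>2 / 2 * m2 = r\<^sup>2 * (m2 / 2)" by (simp add: power2_eq_square algebra_simps)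
    ultimately have "r * (r * m2) - r\<^sup>2 / 2 * m2 = m2 / (2 * v)" by simp
    moreover have "J r = J (1 / sqrt v)" by (simp add: r_def c_def)
    ultimately show ?thesis by linarith
  qed
  finally show ?thesis .
qed

text \<open>The substitution \<open>r = 1 / sqrt s\<close> turns \<open>J' = r * xsq r\<close> into
  \<open>- xsq / (2 s^2)\<close>; the derivative of \<open>- m2 / (2 s)\<close> completes the
  minimum error.\<close>

lemma rate_has_integral:
  assumes v: "0 < v1" "v1 \<le> v2"
  shows "((\<lambda>s. (m2 - xsq (1 / sqrt s)) / (2 * s\<^sup>2)) has_integral secrecy_rate n v1 v2 P) {v1..v2}"
proof -
  let ?F = "\<lambda>s. J (1 / sqrt s) - m2 / (2 * s)"
  have "((\<lambda>s. (m2 - xsq (1 / sqrt s)) / (2 * s\<^sup>2)) has_integral (?F v2 - ?F v1)) {v1..v2}"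
  proof (rule fundamental_theorem_of_calculus[OF v(2)])
    fix s assume s: "s \<in> {v1..v2}"
    then have s0: "s > 0" using v by simp
    let ?M = "1 / sqrt v1"
    have im: "(\<lambda>s. 1 / sqrt s) ` {v1..v2} \<subseteq> {0..?M}"
      using v by (auto intro!: divide_left_mono mult_pos_pos)
    have d1: "((\<lambda>s. 1 / sqrt s) has_real_derivative - (1 / (2 * s * sqrt s))) (at s within {v1..v2})"
      using s0 by (auto intro!: derivative_eq_intros simp: field_simps)
    have "(J has_real_derivative (1 / sqrt s) * xsq (1 / sqrt s)) (at (1 / sqrt s) within (\<lambda>s. 1 / sqrt s) ` {v1..v2})"
    proof (rule DERIV_subset[OF DERIV_J im])
      have "1 / sqrt s \<in> {0..?M}" using im s by blast
      then show "0 \<le> 1 / sqrt s" "1 / sqrt s \<le> ?M" by auto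
    qed
    from DERIV_image_chain[OF this d1, unfolded comp_def]
    have "((\<lambda>s. J (1 / sqrt s)) has_real_derivative (1 / sqrt s) * xsq (1 / sqrt s) * (- (1 / (2 * s * sqrt s)))) (at s within {v1..v2})" .
    moreover have "(1 / sqrt s) * xsq (1 / sqrt s) * (- (1 / (2 * s * sqrt s))) = - (xsq (1 / sqrt s) / (2 * s\<^sup>2))"
    proof -
      have "sqrt s * sqrt s = s" using s0 by simp
      then show ?thesis by (simp add: power2_eq_square mult_ac)
    qed
    ultimately have 1: "((\<lambda>s. J (1 / sqrt s)) has_real_derivative - (xsq (1 / sqrt s) / (2 * s\<^sup>2))) (at s within {v1..v2})" by (simp only:)
    have 2: "((\<lambda>s. m2 / (2 * s)) has_real_derivative - (m2 / (2 * s\<^sup>2))) (at s within {v1..v2})"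
      using s0 by (auto intro!: derivative_eq_intros simp: field_simps power2_eq_square)
    have "(?F has_real_derivative (m2 - xsq (1 / sqrt s)) / (2 * s\<^sup>2)) (at s within {v1..v2})"
      using DERIV_diff[OF 1 2] by (simp add: diff_divide_distrib)
    then show "(?F has_vector_derivative (m2 - xsq (1 / sqrt s)) / (2 * s\<^sup>2)) (at s within {v1..v2})"
      by (simp add: has_real_derivative_iff_has_vector_derivative)
  qed
  moreover have "?F v2 - ?F v1 = secrecy_rate n v1 v2 P"
    using v by (simp add: secrecy_rate_def awgn_mi_eq)
  ultimately show ?thesis by simp
qed

end

section \<open>Comparison with the radial estimator\<close>

context bounded_input
begin

text \<open>The Bayes estimator of the spherical input, applied to the output of an arbitrary one.\<close>

definition gest :: "real \<Rightarrow> nat \<Rightarrow> (nat \<Rightarrow> real) \<Rightarrow> real" where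
  "gest r i y = gam n (R\<^sup>2 * r\<^sup>2) (dotp n y y) * y i / r"

lemma measurable_gest [measurable]: "i < n \<Longrightarrow> gest r i \<in> borel_measurable (Rn n)"
  unfolding gest_def[abs_def] by measurable

text \<open>Orthogonality: the error of \<open>h\<close> is the minimum error plus the mean square
  of \<open>xh - h\<close>. Quadratic growth of \<open>h\<close> is permitted, which is what
  \<open>gest_bound\<close> supplies.\<close>

lemma estimator_error:
  assumes h: "\<And>i. i < n \<Longrightarrow> h i \<in> borel_measurable (Rn n)" and hb: "\<And>i y. i < n \<Longrightarrow> \<bar>h i y\<bar> \<le> C * (1 + (vnorm n y)\<^sup>2)"
  shows "integrable PS (\<lambda>p. \<Sum>i<n. (fst p i - h i (chan n r p))\<^sup>2)"
    and "m2 - xsq r \<le> (\<integral>p. (\<Sum>i<n. (fst p i - h i (chan n r p))\<^sup>2) \<partial>PS)"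
    and "(\<And>i y. i < n \<Longrightarrow> h i y = xh r i y) \<Longrightarrow> m2 - xsq r = (\<integral>p. (\<Sum>i<n. (fst p i - h i (chan n r p))\<^sup>2) \<partial>PS)"
proof -
  let ?Y = "chan n r"
  have C: "C \<ge> 0"
  proof -
    have "0 \<le> C * (1 + (vnorm n (\<lambda>_. 0))\<^sup>2)" using order_trans[OF abs_ge_zero hb[of 0 "\<lambda>_. 0"]] n by simp
    then show ?thesis by (simp add: zero_le_mult_iff vnorm_def)
  qed
  have hm: "(\<lambda>p. h i (?Y p)) \<in> borel_measurable PS" if "i < n" for i
    using measurable_compose[OF _ h[OF that], of ?Y PS] by measurable
  define K where "K = C * (1 + 2 * (\<bar>r\<bar> * R)\<^sup>2 + 2)"
  have K0: "K \<ge> 0" using C by (simp add: K_def add_nonneg_nonneg)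
  have hY: "\<bar>h i (?Y (x, z))\<bar> \<le> K * (1 + (vnorm n z)\<^sup>2)" if i: "i < n" and x: "vnorm n x \<le> R" for i x z
  proof -
    have "(vnorm n (?Y (x, z)))\<^sup>2 \<le> (\<bar>r\<bar> * R + vnorm n z)\<^sup>2"
      using vnorm_chan_le[of "(x, z)" r] x by (intro power_mono) auto
    also have "\<dots> \<le> 2 * (\<bar>r\<bar> * R)\<^sup>2 + 2 * (vnorm n z)\<^sup>2"
      using zero_le_power2[of "\<bar>r\<bar> * R - vnorm n z"] by (simp add: power2_sum power2_diff)
    finally have "1 + (vnorm n (?Y (x, z)))\<^sup>2 \<le> 1 + 2 * (\<bar>r\<bar> * R)\<^sup>2 + 2 * (vnorm n z)\<^sup>2" by simp
    also have "\<dots> \<le> (1 + 2 * (\<bar>r\<bar> * R)\<^sup>2 + 2) * (1 + (vnorm n z)\<^sup>2)"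
      by (simp add: distrib_right distrib_left)
    finally have "C * (1 + (vnorm n (?Y (x, z)))\<^sup>2) \<le> C * ((1 + 2 * (\<bar>r\<bar> * R)\<^sup>2 + 2) * (1 + (vnorm n z)\<^sup>2))"
      using C by (rule mult_left_mono)
    then show ?thesis using hb[OF i, of "?Y (x, z)"] by (simp add: K_def mult.assoc)
  qed
  have ihh: "integrable PS (\<lambda>p. (h i (?Y p))\<^sup>2)" if i: "i < n" for i
  proof (rule integrable_pair_bound[where C="K\<^sup>2" and k=2 and \<rho>=0])
    fix x z assume "vnorm n x \<le> R"
    from power_mono[OF hY[OF i this, of z], of 2]
    show "\<bar>(h i (?Y (x, z)))\<^sup>2\<bar> \<le> K\<^sup>2 * (1 + (vnorm n z)\<^sup>2) ^ 2 * exp (0 * vnorm n z)"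
      by (simp add: power_mult_distrib)
  qed (use hm[OF i] in measurable)
  have ihx: "integrable PS (\<lambda>p. h i (?Y p) * fst p i)" if i: "i < n" for i
  proof (rule integrable_pair_bound[where C="K * R" and k=1 and \<rho>=0])
    fix x z assume x: "vnorm n x \<le> R"
    have "\<bar>h i (?Y (x, z))\<bar> * \<bar>x i\<bar> \<le> K * (1 + (vnorm n z)\<^sup>2) * R"
      using hY[OF i x, of z] abs_component_le[OF i, of x] x K0 by (intro mult_mono) auto
    then show "\<bar>h i (?Y (x, z)) * fst (x, z) i\<bar> \<le> K * R * (1 + (vnorm n z)\<^sup>2) ^ 1 * exp (0 * vnorm n z)"
      by (simp add: abs_mult mult_ac)
  qed (use hm[OF i] i in measurable)
  have ihxh: "integrable PS (\<lambda>p. h i (?Y p) * xh r i (?Y p))" if i: "i < n" for i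
  proof (rule integrable_pair_bound[where C="K * R" and k=1 and \<rho>=0])
    fix x z assume x: "vnorm n x \<le> R"
    have "\<bar>h i (?Y (x, z))\<bar> * \<bar>xh r i (?Y (x, z))\<bar> \<le> K * (1 + (vnorm n z)\<^sup>2) * R"
      using hY[OF i x, of z] abs_xh_le[OF i] K0 by (intro mult_mono) auto
    then show "\<bar>h i (?Y (x, z)) * xh r i (?Y (x, z))\<bar> \<le> K * R * (1 + (vnorm n z)\<^sup>2) ^ 1 * exp (0 * vnorm n z)"
      by (simp add: abs_mult mult_ac)
  qed (use hm[OF i] i in measurable)
  have e1: "(fst p i - h i (?Y p))\<^sup>2 = (fst p i)\<^sup>2 - 2 * (h i (?Y p) * fst p i) + (h i (?Y p))\<^sup>2" for p i
    by (simp add: power2_diff mult_ac)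
  have e2: "(xh r i (?Y p) - h i (?Y p))\<^sup>2 = (xh r i (?Y p))\<^sup>2 - 2 * (h i (?Y p) * xh r i (?Y p)) + (h i (?Y p))\<^sup>2" for p i
    by (simp add: power2_diff mult_ac)
  have i1: "integrable PS (\<lambda>p. (fst p i - h i (?Y p))\<^sup>2)" if "i < n" for i
    unfolding e1 using ihh[OF that] ihx[OF that] integrable_coord_product(2)[OF that] by simp
  then show "integrable PS (\<lambda>p. \<Sum>i<n. (fst p i - h i (chan n r p))\<^sup>2)" by auto
  have tw: "(\<integral>p. h i (?Y p) * fst p i \<partial>PS) = (\<integral>p. h i (?Y p) * xh r i (?Y p) \<partial>PS)" if i: "i < n" for i
    by (rule tower_coord[OF i h[OF i], where C=C and k=1]) (use hb[OF i] in simp)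
  have "(\<integral>p. (\<Sum>i<n. (fst p i - h i (?Y p))\<^sup>2) \<partial>PS) = (\<Sum>i<n. \<integral>p. (fst p i - h i (?Y p))\<^sup>2 \<partial>PS)"
    using i1 by (intro Bochner_Integration.integral_sum) auto
  also have "\<dots> = (\<Sum>i<n. (\<integral>p. (fst p i)\<^sup>2 \<partial>PS) - (\<integral>p. (xh r i (?Y p))\<^sup>2 \<partial>PS) + (\<integral>p. (xh r i (?Y p) - h i (?Y p))\<^sup>2 \<partial>PS))"
  proof (intro sum.cong refl)
    fix i assume "i \<in> {..<n}"
    then have i: "i < n" by simp
    show "(\<integral>p. (fst p i - h i (?Y p))\<^sup>2 \<partial>PS) = (\<integral>p. (fst p i)\<^sup>2 \<partial>PS) - (\<integral>p. (xh r i (?Y p))\<^sup>2 \<partial>PS) + (\<integral>p. (xh r i (?Y p) - h i (?Y p))\<^sup>2 \<partial>PS)"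
      unfolding e1 e2 using ihh[OF i] ihx[OF i] ihxh[OF i] integrable_coord_product(2)[OF i] integrable_xh_products(3)[OF i, of r]
      by (simp add: tw[OF i])
  qed
  also have "\<dots> = m2 - xsq r + (\<Sum>i<n. \<integral>p. (xh r i (?Y p) - h i (?Y p))\<^sup>2 \<partial>PS)"
  proof -
    have "m2 = (\<Sum>i<n. \<integral>p. (fst p i)\<^sup>2 \<partial>PS)"
      unfolding m2_eq[symmetric] using integrable_coord_product(2) by (intro Bochner_Integration.integral_sum) auto
    moreover have "xsq r = (\<Sum>i<n. \<integral>p. (xh r i (?Y p))\<^sup>2 \<partial>PS)"
      unfolding xsq_def using integrable_xh_products(3) by (intro Bochner_Integration.integral_sum) auto
    ultimately show ?thesis by (simp add: sum.distrib sum_subtractf)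
  qed
  finally have eq: "(\<integral>p. (\<Sum>i<n. (fst p i - h i (?Y p))\<^sup>2) \<partial>PS) = m2 - xsq r + (\<Sum>i<n. \<integral>p. (xh r i (?Y p) - h i (?Y p))\<^sup>2 \<partial>PS)" .
  show "m2 - xsq r \<le> (\<integral>p. (\<Sum>i<n. (fst p i - h i (chan n r p))\<^sup>2) \<partial>PS)"
    unfolding eq by (simp add: sum_nonneg)
  show "m2 - xsq r = (\<integral>p. (\<Sum>i<n. (fst p i - h i (chan n r p))\<^sup>2) \<partial>PS)" if "\<And>i y. i < n \<Longrightarrow> h i y = xh r i y"
    unfolding eq using that by simp
qed

lemma gest_bound: assumes r: "r > 0" and i: "i < n"
  shows "\<bar>gest r i y\<bar> \<le> (R\<^sup>2 * r) * (1 + (vnorm n y)\<^sup>2)"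
proof -
  have a: "R\<^sup>2 * r\<^sup>2 \<ge> 0" by simp
  have "\<bar>y i\<bar> \<le> 0 + 1 * vnorm n y" using abs_component_le[OF i, of y] by simp
  also have "\<dots> \<le> (0 + 1) * (1 + (vnorm n y)\<^sup>2)" by (rule one_plus_le_sq) auto
  finally have "\<bar>gam n (R\<^sup>2 * r\<^sup>2) (dotp n y y)\<bar> * \<bar>y i\<bar> \<le> (R\<^sup>2 * r\<^sup>2) * (1 + (vnorm n y)\<^sup>2)"
    using abs_gam_le[OF n a, of "dotp n y y"] by (intro mult_mono) auto
  then have "\<bar>gam n (R\<^sup>2 * r\<^sup>2) (dotp n y y)\<bar> * \<bar>y i\<bar> / r \<le> (R\<^sup>2 * r\<^sup>2) * (1 + (vnorm n y)\<^sup>2) / r"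
    using r by (intro divide_right_mono) auto
  then show ?thesis using r by (simp add: gest_def abs_mult abs_divide power2_eq_square)
qed

text \<open>The factor \<open>r^2\<close> brings the error into the form of
  \<open>estimation_error\<close> with \<open>\<xi> = r x\<close>; \<open>gam_sq\<close> converts
  the squared estimate into \<open>Ha\<close>.\<close>

lemma gest_error_sum:
  assumes r: "r > 0"
  shows "r\<^sup>2 * (\<Sum>i<n. (x i - gest r i y)\<^sup>2)
    = dotp n (vscale n r x) (vscale n r x) - 2 * gam n (R\<^sup>2 * r\<^sup>2) (dotp n y y) * dotp n (vscale n r x) y
      + (R\<^sup>2 * r\<^sup>2) * Ha n (R\<^sup>2 * r\<^sup>2) (dotp n y y)"
proof -
  define g where "g = gam n (R\<^sup>2 * r\<^sup>2) (dotp n y y)"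
  have "r\<^sup>2 * (\<Sum>i<n. (x i - gest r i y)\<^sup>2) = (\<Sum>i<n. r\<^sup>2 * (x i * x i) - 2 * g * (r * (x i * y i)) + g\<^sup>2 * (y i * y i))"
    unfolding sum_distrib_left
  proof (intro sum.cong refl)
    fix i
    have "r\<^sup>2 * (x i - gest r i y)\<^sup>2 = (r * x i - g * y i)\<^sup>2"
      unfolding power_mult_distrib[symmetric] using r by (simp add: gest_def g_def right_diff_distrib)
    then show "r\<^sup>2 * (x i - gest r i y)\<^sup>2 = r\<^sup>2 * (x i * x i) - 2 * g * (r * (x i * y i)) + g\<^sup>2 * (y i * y i)"
      by (simp add: power2_eq_square algebra_simps)
  qed
  also have "\<dots> = r\<^sup>2 * dotp n x x - 2 * g * (r * dotp n x y) + dotp n y y * g\<^sup>2"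
    by (simp add: dotp_def sum.distrib sum_subtractf sum_distrib_left mult.commute)
  also have "\<dots> = dotp n (vscale n r x) (vscale n r x) - 2 * g * dotp n (vscale n r x) y + dotp n y y * g\<^sup>2"
    by (simp add: power2_eq_square)
  finally show ?thesis unfolding g_def gam_sq .
qed

text \<open>By Fubini the noise is averaged first, and that mean sees the input only through its
  squared norm.\<close>

lemma gest_error_integral:
  assumes r: "r > 0"
  shows "integrable P (\<lambda>x. psi n (R\<^sup>2 * r\<^sup>2) (r\<^sup>2 * dotp n x x))"
    and "r\<^sup>2 * (\<integral>p. (\<Sum>i<n. (fst p i - gest r i (chan n r p))\<^sup>2) \<partial>PS) = (\<integral>x. psi n (R\<^sup>2 * r\<^sup>2) (r\<^sup>2 * dotp n x x) \<partial>P)"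
proof -
  let ?a = "R\<^sup>2 * r\<^sup>2"
  define H where "H x z = r\<^sup>2 * (\<Sum>i<n. (x i - gest r i (chan n r (x, z)))\<^sup>2)" for x z
  have "integrable PS (\<lambda>p. \<Sum>i<n. (fst p i - gest r i (chan n r p))\<^sup>2)"
    by (rule estimator_error(1)) (use gest_bound[OF r] in auto)
  then have i: "integrable PS (case_prod H)"
    by (simp add: H_def split_beta')
  have inner: "(\<integral>z. H x z \<partial>stdg n) = psi n ?a (r\<^sup>2 * dotp n x x)" for x
  proof -
    have "(\<integral>z. H x z \<partial>stdg n) = psi n ?a (dotp n (vscale n r x) (vscale n r x))"
      unfolding H_def gest_error_sum[OF r] fst_conv snd_conv
      by (rule estimation_error[OF n]) simp
    then show ?thesis by (simp add: power2_eq_square mult.assoc)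
  qed
  show "integrable P (\<lambda>x. psi n ?a (r\<^sup>2 * dotp n x x))"
    using PG.integrable_fst[OF i] by (simp add: inner)
  show "r\<^sup>2 * (\<integral>p. (\<Sum>i<n. (fst p i - gest r i (chan n r p))\<^sup>2) \<partial>PS) = (\<integral>x. psi n ?a (r\<^sup>2 * dotp n x x) \<partial>P)"
  proof -
    have "(\<integral>x. psi n ?a (r\<^sup>2 * dotp n x x) \<partial>P) = (\<integral>p. case_prod H p \<partial>PS)"
      using PG.integral_fst[OF i] by (simp add: inner)
    also have "\<dots> = r\<^sup>2 * (\<integral>p. (\<Sum>i<n. (fst p i - gest r i (chan n r p))\<^sup>2) \<partial>PS)"
      unfolding H_def split_beta' prod.collapse by (rule integral_mult_right_zero)
    finally show ?thesis by simp
  qed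
qed

lemma integrable_dotp_P: "integrable P (\<lambda>x. dotp n x x)"
proof (rule integrable_const_bound[where B="R\<^sup>2"])
  show "AE x in P. norm (dotp n x x) \<le> R\<^sup>2" using bd by eventually_elim (use dotp_self_le in simp)
qed measurable

lemma m2_nonneg: "m2 \<ge> 0" unfolding m2_def by (intro Bochner_Integration.integral_nonneg) simp

lemma m2_le: "m2 \<le> R\<^sup>2"
proof -
  have "m2 \<le> (\<integral>x. R\<^sup>2 \<partial>P)"
    unfolding m2_def using bd by (intro integral_mono_AE integrable_dotp_P) (auto elim!: eventually_mono intro: dotp_self_le)
  then show ?thesis using prob_space by simp
qed

text \<open>\<open>gest\<close> is an admissible estimator for any input, and \<open>psi\<close>
  lies below its chord at weight \<open>|x|^2 / R^2\<close>. The bound is affine in the squared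
  norm, so averaging leaves only \<open>m2\<close>.\<close>

lemma mmse_le_chord:
  assumes r: "r > 0" and R0: "R > 0"
  shows "r\<^sup>2 * (m2 - xsq r) \<le> (1 - m2 / R\<^sup>2) * psi n (R\<^sup>2 * r\<^sup>2) 0 + m2 / R\<^sup>2 * psi n (R\<^sup>2 * r\<^sup>2) (R\<^sup>2 * r\<^sup>2)"
proof -
  let ?a = "R\<^sup>2 * r\<^sup>2"
  have "m2 - xsq r \<le> (\<integral>p. (\<Sum>i<n. (fst p i - gest r i (chan n r p))\<^sup>2) \<partial>PS)"
    by (rule estimator_error(2)) (use gest_bound[OF r] in auto)
  then have "r\<^sup>2 * (m2 - xsq r) \<le> (\<integral>x. psi n ?a (r\<^sup>2 * dotp n x x) \<partial>P)"
    unfolding gest_error_integral(2)[OF r, symmetric] by (rule mult_left_mono) simp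
  also have "\<dots> \<le> (\<integral>x. psi n ?a 0 + (psi n ?a ?a - psi n ?a 0) / R\<^sup>2 * dotp n x x \<partial>P)"
  proof (rule integral_mono_AE[OF gest_error_integral(1)[OF r]])
    show "integrable P (\<lambda>x. psi n ?a 0 + (psi n ?a ?a - psi n ?a 0) / R\<^sup>2 * dotp n x x)"
      using integrable_dotp_P by simp
    show "AE x in P. psi n ?a (r\<^sup>2 * dotp n x x) \<le> psi n ?a 0 + (psi n ?a ?a - psi n ?a 0) / R\<^sup>2 * dotp n x x"
      using bd
    proof eventually_elim
      case (elim x)
      have "psi n ?a (dotp n x x / R\<^sup>2 * ?a) \<le> (1 - dotp n x x / R\<^sup>2) * psi n ?a 0 + dotp n x x / R\<^sup>2 * psi n ?a ?a"
        using dotp_self_le[OF elim] R0 by (intro psi_chord[OF n]) (auto simp: divide_simps)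
      moreover have "dotp n x x / R\<^sup>2 * ?a = r\<^sup>2 * dotp n x x" using R0 by simp
      ultimately show ?case by (simp add: algebra_simps diff_divide_distrib)
    qed
  qed
  also have "\<dots> = psi n ?a 0 + (psi n ?a ?a - psi n ?a 0) / R\<^sup>2 * m2"
    using integrable_dotp_P prob_space by (simp add: m2_def)
  also have "\<dots> = (1 - m2 / R\<^sup>2) * psi n ?a 0 + m2 / R\<^sup>2 * psi n ?a ?a"
    by (simp add: algebra_simps diff_divide_distrib)
  finally show ?thesis .
qed

end

text \<open>Isolates the two properties of the spherical law that enter the comparison: constant
  norm, and \<open>gest\<close> as exact conditional mean.\<close>

locale sphere_input = bounded_input +
  assumes on_sphere: "AE x in P. vnorm n x = R" and xh_gest: "\<And>r i y. r > 0 \<Longrightarrow> i < n \<Longrightarrow> xh r i y = gest r i y"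
begin

lemma m2_sphere: "m2 = R\<^sup>2"
proof -
  have "m2 = (\<integral>x. R\<^sup>2 \<partial>P)"
    unfolding m2_def using on_sphere by (intro integral_cong_AE) (auto elim!: eventually_mono simp flip: vnorm_sq)
  then show ?thesis using prob_space by simp
qed

lemma sum_xh_sq: assumes r: "r > 0" shows "(\<Sum>i<n. (xh r i y)\<^sup>2) = R\<^sup>2 * Ha n (R\<^sup>2 * r\<^sup>2) (dotp n y y)"
proof -
  define g where "g = gam n (R\<^sup>2 * r\<^sup>2) (dotp n y y)"
  have "(\<Sum>i<n. (xh r i y)\<^sup>2) = (\<Sum>i<n. g\<^sup>2 / r\<^sup>2 * (y i * y i))"
    using r by (intro sum.cong refl) (simp add: xh_gest gest_def g_def power_divide power_mult_distrib power2_eq_square)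
  also have "\<dots> = g\<^sup>2 / r\<^sup>2 * dotp n y y" unfolding dotp_def by (rule sum_distrib_left[symmetric])
  also have "\<dots> = (dotp n y y * g\<^sup>2) / r\<^sup>2" by (simp add: mult.commute)
  also have "dotp n y y * g\<^sup>2 = (R\<^sup>2 * r\<^sup>2) * Ha n (R\<^sup>2 * r\<^sup>2) (dotp n y y)" unfolding g_def gam_sq ..
  finally show ?thesis using r by simp
qed

text \<open>On the sphere \<open>r x\<close> has squared norm \<open>R^2 r^2\<close>, the same
  number as the parameter of \<open>Ha\<close>; hence the diagonal function
  \<open>Bfun\<close>.\<close>

lemma xsq_sphere: assumes r: "r > 0" shows "xsq r = R\<^sup>2 * Bfun n (R\<^sup>2 * r\<^sup>2)"
proof -
  let ?a = "R\<^sup>2 * r\<^sup>2"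
  define H where "H x z = Ha n ?a (dotp n (chan n r (x, z)) (chan n r (x, z)))" for x z
  have i: "integrable PS (case_prod H)"
  proof (rule integrable_pair_bound[where C=1 and k=0 and \<rho>=0])
    show "case_prod H \<in> borel_measurable PS" unfolding H_def split_beta' by measurable
    fix x z show "\<bar>case_prod H (x, z)\<bar> \<le> 1 * (1 + (vnorm n z)\<^sup>2) ^ 0 * exp (0 * vnorm n z)"
      using abs_Ha_le[OF n, of ?a] by (simp add: H_def)
  qed
  have "xsq r = (\<integral>p. R\<^sup>2 * case_prod H p \<partial>PS)"
    unfolding xsq_def sum_xh_sq[OF r] by (simp add: H_def split_beta')
  also have "\<dots> = R\<^sup>2 * (\<integral>x. (\<integral>z. H x z \<partial>stdg n) \<partial>P)"
    using PG.integral_fst[OF i] by simp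
  also have "(\<integral>x. (\<integral>z. H x z \<partial>stdg n) \<partial>P) = (\<integral>x. Bfun n ?a \<partial>P)"
  proof (rule integral_cong_AE)
    show "(\<lambda>x. \<integral>z. H x z \<partial>stdg n) \<in> borel_measurable P" using PG.integrable_fst[OF i] by auto
    show "AE x in P. (\<integral>z. H x z \<partial>stdg n) = Bfun n ?a"
      using on_sphere
    proof eventually_elim
      case (elim x)
      have "dotp n (vscale n r x) (vscale n r x) = ?a"
        using elim vnorm_sq[of n x] by (simp add: power2_eq_square mult_ac)
      then show ?case using Bfun_eq[OF n, of ?a "vscale n r x"] by (simp add: H_def)
    qed
  qed simp
  finally show ?thesis using prob_space by simp
qed

text \<open>For the sphere \<open>gest\<close> attains the minimum error \<open>m2 - xsq r\<close>,
  and \<open>psi\<close> is constant on the support. This evaluates the Poisson series without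
  computing its terms.\<close>

lemma psi_diag: assumes r: "r > 0" shows "psi n (R\<^sup>2 * r\<^sup>2) (R\<^sup>2 * r\<^sup>2) = (R\<^sup>2 * r\<^sup>2) * (1 - Bfun n (R\<^sup>2 * r\<^sup>2))"
proof -
  let ?a = "R\<^sup>2 * r\<^sup>2"
  have "m2 - xsq r = (\<integral>p. (\<Sum>i<n. (fst p i - gest r i (chan n r p))\<^sup>2) \<partial>PS)"
    by (rule estimator_error(3)) (use gest_bound[OF r] xh_gest r in auto)
  then have "r\<^sup>2 * (m2 - xsq r) = (\<integral>x. psi n ?a (r\<^sup>2 * dotp n x x) \<partial>P)"
    using gest_error_integral(2)[OF r] by simp
  also have "\<dots> = (\<integral>x. psi n ?a ?a \<partial>P)"
  proof (rule integral_cong_AE)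
    show "(\<lambda>x. psi n ?a (r\<^sup>2 * dotp n x x)) \<in> borel_measurable P" using gest_error_integral(1)[OF r] by auto
    show "AE x in P. psi n ?a (r\<^sup>2 * dotp n x x) = psi n ?a ?a"
      using on_sphere by eventually_elim (simp add: mult.commute flip: vnorm_sq)
  qed simp
  finally show ?thesis using prob_space by (simp add: m2_sphere xsq_sphere[OF r] algebra_simps)
qed

end

section \<open>The spherical input\<close>

lemma vnorm_sphmap_eq: "R \<ge> 0 \<Longrightarrow> dotp n z z > 0 \<Longrightarrow> vnorm n (sphmap n R z) = R"
  by (simp add: sphmap_def vnorm_dotp)

lemma dotp_sphmap: "dotp n y (sphmap n R z) = R * dotp n y (sphmap n 1 z)"
  by (simp add: sphmap_def)

lemma sphmap_component: "i < n \<Longrightarrow> sphmap n R z i = R * sphmap n 1 z i"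
  by (simp add: sphmap_def vscale_def)

lemma AE_sphere_norm:
  assumes "n \<ge> 1" "R \<ge> 0"
  shows "AE x in sphere_unif n R. vnorm n x = R"
proof -
  have "AE z in stdg n. vnorm n (sphmap n R z) = R"
    using AE_stdg_nonzero[OF assms(1)] by eventually_elim (rule vnorm_sphmap_eq[OF assms(2)])
  then show ?thesis
    unfolding sphere_unif_eq_distr by (subst AE_distr_iff) (auto simp: measurable_sphmap)
qed

lemma bounded_input_sphere:
  assumes n: "n \<ge> 1" and R: "R \<ge> 0"
  shows "bounded_input (sphere_unif n R) n R"
proof (intro bounded_input.intro bounded_input_axioms.intro n R)
  show "prob_space (sphere_unif n R)"
    unfolding sphere_unif_eq_distr by (rule prob_space.prob_space_distr[OF prob_space_gauss]) (auto simp: measurable_sphmap)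
  show "sets (sphere_unif n R) = sets (Rn n)" by (simp add: sphere_unif_def)
  show "AE x in sphere_unif n R. vnorm n x \<le> R"
    using AE_sphere_norm[OF n R] by eventually_elim simp
qed

text \<open>The input is \<open>R\<close> times a normalised Gaussian. Its norm is almost surely
  constant, so the quadratic part of the likelihood becomes the prefactor.\<close>

lemma sphere_Lw_integral:
  assumes n: "n \<ge> 1" and R: "R \<ge> 0" and a [measurable]: "a \<in> borel_measurable (Rn n)"
  shows "(\<integral>x. a x * Lw n r x y \<partial>sphere_unif n R)
    = exp (- (r\<^sup>2 * R\<^sup>2 / 2)) * (\<integral>z. a (sphmap n R z) * exp (dotp n (vscale n (r * R) y) (sphmap n 1 z)) \<partial>stdg n)"
proof -
  have m: "sphmap n R \<in> stdg n \<rightarrow>\<^sub>M Rn n" using measurable_sphmap by simp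
  have "(\<integral>x. a x * Lw n r x y \<partial>sphere_unif n R) = (\<integral>z. a (sphmap n R z) * Lw n r (sphmap n R z) y \<partial>stdg n)"
    unfolding sphere_unif_eq_distr by (rule integral_distr[OF m]) measurable
  also have "\<dots> = (\<integral>z. exp (- (r\<^sup>2 * R\<^sup>2 / 2)) * (a (sphmap n R z) * exp (dotp n (vscale n (r * R) y) (sphmap n 1 z))) \<partial>stdg n)"
  proof (rule integral_cong_AE)
    have [measurable]: "(\<lambda>z. a (sphmap n R z)) \<in> borel_measurable (stdg n)" by (rule measurable_compose[OF m a])
    have s [measurable]: "i < n \<Longrightarrow> (\<lambda>z. sphmap n S z i) \<in> borel_measurable (stdg n)" for S i
      by (rule measurable_comp_Rn) (use measurable_sphmap in auto)
    show "(\<lambda>z. a (sphmap n R z) * Lw n r (sphmap n R z) y) \<in> borel_measurable (stdg n)" by measurable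
    show "(\<lambda>z. exp (- (r\<^sup>2 * R\<^sup>2 / 2)) * (a (sphmap n R z) * exp (dotp n (vscale n (r * R) y) (sphmap n 1 z)))) \<in> borel_measurable (stdg n)"
      by measurable
    show "AE z in stdg n. a (sphmap n R z) * Lw n r (sphmap n R z) y = exp (- (r\<^sup>2 * R\<^sup>2 / 2)) * (a (sphmap n R z) * exp (dotp n (vscale n (r * R) y) (sphmap n 1 z)))"
      using AE_stdg_nonzero[OF n]
    proof eventually_elim
      case (elim z)
      have "dotp n (sphmap n R z) (sphmap n R z) = R\<^sup>2"
        using vnorm_sphmap_eq[OF R elim] vnorm_sq[of n "sphmap n R z"] by simp
      then have "Lw n r (sphmap n R z) y = exp (- (r\<^sup>2 * R\<^sup>2 / 2)) * exp (dotp n (vscale n (r * R) y) (sphmap n 1 z))"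
        unfolding exp_add[symmetric] using dotp_sphmap[of n y R z] by (simp add: Lw_def)
      then show ?case by (simp only: mult_ac)
    qed
  qed
  also have "\<dots> = exp (- (r\<^sup>2 * R\<^sup>2 / 2)) * (\<integral>z. a (sphmap n R z) * exp (dotp n (vscale n (r * R) y) (sphmap n 1 z)) \<partial>stdg n)"
    by (rule integral_mult_right_zero)
  finally show ?thesis .
qed

lemma sphere_Nf:
  assumes n: "n \<ge> 1" and R: "R \<ge> 0"
  shows "Nf (sphere_unif n R) n r y = exp (- (r\<^sup>2 * R\<^sup>2 / 2)) * Bs n (R\<^sup>2 * r\<^sup>2 * dotp n y y)"
proof -
  have "dotp n (vscale n (r * R) y) (vscale n (r * R) y) = R\<^sup>2 * r\<^sup>2 * dotp n y y"
    by (simp add: power2_eq_square mult_ac)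
  then have "(\<integral>z. exp (dotp n (vscale n (r * R) y) (sphmap n 1 z)) \<partial>stdg n) = Bs n (R\<^sup>2 * r\<^sup>2 * dotp n y y)"
    using sphere_mgf[OF n, of "vscale n (r * R) y"] by (simp only:)
  then show ?thesis
    unfolding Nf_def using sphere_Lw_integral[OF n R, of "\<lambda>_. 1" r y] by (simp only: mult_1 borel_measurable_const simp_thms)
qed

text \<open>The conditional mean is a logarithmic gradient of the moment generating function:
  \<open>sphere_mgf_deriv\<close> over \<open>sphere_mgf\<close> gives the quotient
  \<open>Bs1 / Bs\<close>, and the prefactors cancel.\<close>

lemma sphere_input_sphere:
  assumes n: "n \<ge> 1" and R: "R \<ge> 0"
  shows "sphere_input (sphere_unif n R) n R"
proof -
  interpret bounded_input "sphere_unif n R" n R by (rule bounded_input_sphere[OF n R])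
  have "xh r i y = gest r i y" if r: "r > 0" and i: "i < n" for r i y
  proof -
    let ?w = "R\<^sup>2 * r\<^sup>2 * dotp n y y" and ?e = "exp (- (r\<^sup>2 * R\<^sup>2 / 2))"
    have w: "dotp n (vscale n (r * R) y) (vscale n (r * R) y) = ?w"
      by (simp add: power2_eq_square mult_ac)
    have "(\<integral>z. sphmap n R z i * exp (dotp n (vscale n (r * R) y) (sphmap n 1 z)) \<partial>stdg n)
        = R * (\<integral>z. sphmap n 1 z i * exp (dotp n (vscale n (r * R) y) (sphmap n 1 z)) \<partial>stdg n)"
      unfolding sphmap_component[OF i, of R] mult.assoc by (rule integral_mult_right_zero)
    also have "\<dots> = R * (2 * (r * R * y i) * Bs1 n ?w)"
      unfolding sphere_mgf_deriv[OF n i] w using i by (simp add: vscale_def)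
    finally have "(\<integral>x. x i * Lw n r x y \<partial>sphere_unif n R) = ?e * (R * (2 * (r * R * y i) * Bs1 n ?w))"
      using sphere_Lw_integral[OF n R, of "\<lambda>x. x i" r y] i by simp
    then have "xh r i y = R * (2 * (r * R * y i) * Bs1 n ?w) / Bs n ?w"
      by (simp add: xh_def postf_def sphere_Nf[OF n R])
    then show ?thesis using r by (simp add: gest_def gam_def qf_def power2_eq_square)
  qed
  then show ?thesis
    by unfold_locales (use AE_sphere_norm[OF n R] in auto)
qed

text \<open>Factoring out \<open>sqrt s\<close> turns the squared arguments of the Bessel quotient
  into \<open>R^2 / s\<close> times the squared norms of \<open>z\<close> and of
  \<open>\<xi> + z\<close>, where \<open>\<xi>\<close> has squared norm
  \<open>R^2 / s\<close>.\<close>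

lemma f_fun_eq:
  assumes n: "n \<ge> 1" and v: "0 < v1" and R: "R \<ge> 0"
  shows "f_fun n v1 v2 R = integral {v1..v2} (\<lambda>s. phi n (R\<^sup>2 / s) / s\<^sup>2)"
  unfolding f_fun_def
proof (rule integral_cong)
  fix s assume "s \<in> {v1..v2}"
  then have s: "s > 0" using v by simp
  let ?a = "R\<^sup>2 / s"
  define \<xi> where "\<xi> = vscale n (R / sqrt s) (e1 n)"
  have a: "?a \<ge> 0" using s by simp
  have xx: "dotp n \<xi> \<xi> = ?a"
    using s vnorm_e1[OF n] by (simp add: \<xi>_def power2_eq_square)
  have h: "(bessel_h (real n / 2) (vnorm n x * R / s))\<^sup>2 = Hf n (dotp n x x * R\<^sup>2 / s\<^sup>2)" for x
    using bessel_h_sq[OF n, of "vnorm n x * R / s"] s R by (simp add: power_mult_distrib power_divide vnorm_sq)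
  have 1: "(bessel_h (real n / 2) (vnorm n (vscale n (sqrt s) z) * R / s))\<^sup>2 = Ha n ?a (dotp n z z)" for z
  proof -
    have zz: "dotp n (vscale n (sqrt s) z) (vscale n (sqrt s) z) = s * dotp n z z"
      using s by (simp add: mult.assoc[symmetric])
    show ?thesis unfolding h Ha_def zz using s by (simp add: power2_eq_square mult_ac)
  qed
  have 2: "(bessel_h (real n / 2) (vnorm n (vadd n (vscale n R (e1 n)) (vscale n (sqrt s) z)) * R / s))\<^sup>2
      = Ha n ?a (dotp n (affmap n \<xi> 1 z) (affmap n \<xi> 1 z))" for z
  proof -
    have "dotp n (vadd n (vscale n R (e1 n)) (vscale n (sqrt s) z)) (vadd n (vscale n R (e1 n)) (vscale n (sqrt s) z))
      = R\<^sup>2 + 2 * R * sqrt s * dotp n (e1 n) z + s * dotp n z z"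
      unfolding vadd_eq_affmap dotp_affmap_self using s vnorm_e1[OF n] by (simp add: power2_eq_square)
    also have "\<dots> = s * dotp n (affmap n \<xi> 1 z) (affmap n \<xi> 1 z)"
    proof -
      have "s * (2 * 1 * dotp n \<xi> z) = 2 * (s / sqrt s) * R * dotp n (e1 n) z" by (simp add: \<xi>_def mult_ac)
      also have "\<dots> = 2 * R * sqrt s * dotp n (e1 n) z" unfolding real_div_sqrt[OF less_imp_le[OF s]] by simp
      finally show ?thesis unfolding dotp_affmap_self xx distrib_left using s by simp
    qed
    finally show ?thesis unfolding h Ha_def using s by (simp add: power2_eq_square mult_ac)
  qed
  have i1: "integrable (stdg n) (\<lambda>z. Ha n ?a (dotp n (affmap n \<xi> 1 z) (affmap n \<xi> 1 z)))"
  proof (rule integrable_stdg_bound[where C=1 and k=0 and \<rho>=0])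
    show "(\<lambda>z. Ha n ?a (dotp n (affmap n \<xi> 1 z) (affmap n \<xi> 1 z))) \<in> borel_measurable (Rn n)" by measurable
  qed (use abs_Ha_le[OF n a] in auto)
  show "((\<integral>z. (bessel_h (real n / 2) (vnorm n (vscale n (sqrt s) z) * R / s))\<^sup>2
      + (bessel_h (real n / 2) (vnorm n (vadd n (vscale n R (e1 n)) (vscale n (sqrt s) z)) * R / s))\<^sup>2 \<partial>stdg n) - 1) / s\<^sup>2
      = phi n ?a / s\<^sup>2"
    unfolding 1 2 phi_def Bfun_eq[OF n a xx] Afun_def
    by (subst Bochner_Integration.integral_add[OF integrable_Ha[OF n a] i1]) simp
qed

lemma continuous_on_f_integrand:
  assumes n: "n \<ge> 1" and v: "0 < v1"
  shows "continuous_on ({0..} \<times> cbox v1 v2) (\<lambda>(R, s). phi n (R\<^sup>2 / s) / s\<^sup>2)"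
  unfolding split_beta'
proof (intro continuous_on_divide continuous_intros)
  show "continuous_on ({0..} \<times> cbox v1 v2) (\<lambda>p. phi n ((fst p)\<^sup>2 / snd p))"
  proof (rule continuous_on_compose2[OF continuous_on_phi[OF n]])
    show "continuous_on ({0..} \<times> cbox v1 v2) (\<lambda>p. (fst p)\<^sup>2 / snd p)"
      using v by (intro continuous_intros) auto
  qed (use v in auto)
qed (use v in auto)

lemma f_fun_has_integral:
  assumes n: "n \<ge> 1" and v: "0 < v1" and R: "R \<ge> 0"
  shows "((\<lambda>s. phi n (R\<^sup>2 / s) / s\<^sup>2) has_integral f_fun n v1 v2 R) {v1..v2}"
    and "continuous_on {v1..v2} (\<lambda>s. phi n (R\<^sup>2 / s) / s\<^sup>2)"
proof -
  show c: "continuous_on {v1..v2} (\<lambda>s. phi n (R\<^sup>2 / s) / s\<^sup>2)"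
  proof -
    have "continuous_on {v1..v2} (\<lambda>s. case (R, s) of (R, s) \<Rightarrow> phi n (R\<^sup>2 / s) / s\<^sup>2)"
      by (rule continuous_on_compose2[OF continuous_on_f_integrand[OF n v, of v2]])
         (use R in \<open>auto intro!: continuous_intros\<close>)
    then show ?thesis by simp
  qed
  show "((\<lambda>s. phi n (R\<^sup>2 / s) / s\<^sup>2) has_integral f_fun n v1 v2 R) {v1..v2}"
    unfolding f_fun_eq[OF n v R] by (rule integrable_integral[OF integrable_continuous_real[OF c]])
qed

lemma continuous_on_f_fun:
  assumes n: "n \<ge> 1" and v: "0 < v1"
  shows "continuous_on {0..} (f_fun n v1 v2)"
  using integral_continuous_on_param[OF continuous_on_f_integrand[OF n v]]
  by (rule continuous_on_eq) (simp add: f_fun_eq[OF n v])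

lemma f_fun_strict_mono:
  assumes n: "n \<ge> 1" and v: "0 < v1" "v1 < v2" and R: "0 \<le> R" "R < R'"
  shows "f_fun n v1 v2 R < f_fun n v1 v2 R'"
proof -
  have R': "R' \<ge> 0" using R by simp
  have "integral {v1..v2} (\<lambda>s. phi n (R\<^sup>2 / s) / s\<^sup>2) < integral {v1..v2} (\<lambda>s. phi n (R'\<^sup>2 / s) / s\<^sup>2)"
  proof (rule integral_less_real[OF f_fun_has_integral(2)[OF n v(1) R(1)] f_fun_has_integral(2)[OF n v(1) R']])
    show "{v1<..<v2} \<noteq> {}" using v by simp
    fix s assume "s \<in> {v1<..<v2}"
    then have s: "s > 0" using v by simp
    have "R\<^sup>2 / s < R'\<^sup>2 / s" using s R by (intro divide_strict_right_mono power_strict_mono) auto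
    then have "phi n (R\<^sup>2 / s) < phi n (R'\<^sup>2 / s)" using s by (intro phi_strict_mono[OF n]) auto
    then show "phi n (R\<^sup>2 / s) / s\<^sup>2 < phi n (R'\<^sup>2 / s) / s\<^sup>2" using s by (intro divide_strict_right_mono) auto
  qed
  then show ?thesis using f_fun_eq[OF n v(1) R(1)] f_fun_eq[OF n v(1) R'] by simp
qed

lemma f_fun_0_neg:
  assumes n: "n \<ge> 1" and v: "0 < v1" "v1 < v2"
  shows "f_fun n v1 v2 0 < 0"
proof -
  have "integral {v1..v2} (\<lambda>s. phi n (0\<^sup>2 / s) / s\<^sup>2) < integral {v1..v2} (\<lambda>s. 0)"
  proof (rule integral_less_real[OF f_fun_has_integral(2)[OF n v(1) order_refl]])
    show "{v1<..<v2} \<noteq> {}" using v by simp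
  qed (use v phi_0[OF n] in auto)
  then show ?thesis using f_fun_eq[OF n v(1) order_refl] by simp
qed

lemma f_fun_root:
  assumes n: "n \<ge> 1" and v: "0 < v1" "v1 < v2"
  obtains R0 where "R0 \<ge> 0" "f_fun n v1 v2 R0 = 0"
proof -
  obtain a0 where a0: "a0 > 0" "phi n a0 \<ge> 0" using phi_eventually_nonneg[OF n] .
  \<comment> \<open>With this radius \<open>?M^2 / s \<ge> a0\<close> on the whole interval, with
    equality at \<open>s = v2\<close>.\<close>
  let ?M = "sqrt (a0 * v2)"
  have M: "?M \<ge> 0" using a0 v by simp
  have "0 \<le> f_fun n v1 v2 ?M"
  proof (rule has_integral_nonneg[OF f_fun_has_integral(1)[OF n v(1) M]])
    fix s assume s: "s \<in> {v1..v2}"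
    then have "a0 * s \<le> a0 * v2" using a0 by (intro mult_left_mono) auto
    then have "a0 \<le> ?M\<^sup>2 / s" using s v a0 by (simp add: pos_le_divide_eq)
    then have "phi n a0 \<le> phi n (?M\<^sup>2 / s)"
      using phi_strict_mono[OF n, of a0 "?M\<^sup>2 / s"] a0 by (cases "a0 = ?M\<^sup>2 / s") auto
    then show "0 \<le> phi n (?M\<^sup>2 / s) / s\<^sup>2" using a0 by simp
  qed
  moreover have "continuous_on {0..?M} (f_fun n v1 v2)"
    by (rule continuous_on_subset[OF continuous_on_f_fun[OF n v(1)]]) auto
  ultimately obtain x where "0 \<le> x" "x \<le> ?M" "f_fun n v1 v2 x = 0"
    using IVT'[of "f_fun n v1 v2" 0 0 ?M] f_fun_0_neg[OF n v] M by auto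
  then show ?thesis using that by blast
qed

section \<open>Comparison of secrecy rates with that of the sphere\<close>

lemma sphere_rate_has_integral:
  assumes n: "n \<ge> 1" and v: "0 < v1" "v1 \<le> v2" and R: "R \<ge> 0"
  shows "((\<lambda>s. R\<^sup>2 * (1 - Bfun n (R\<^sup>2 / s)) / (2 * s\<^sup>2)) has_integral secrecy_rate n v1 v2 (sphere_unif n R)) {v1..v2}"
proof -
  interpret sphere_input "sphere_unif n R" n R by (rule sphere_input_sphere[OF n R])
  show ?thesis
  proof (rule has_integral_eq[OF _ rate_has_integral[OF v]])
    fix s assume "s \<in> {v1..v2}"
    then have s: "s > 0" using v by simp
    then have "xsq (1 / sqrt s) = R\<^sup>2 * Bfun n (R\<^sup>2 / s)"
      using xsq_sphere[of "1 / sqrt s"] by (simp add: power_divide)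
    then show "(m2 - xsq (1 / sqrt s)) / (2 * s\<^sup>2) = R\<^sup>2 * (1 - Bfun n (R\<^sup>2 / s)) / (2 * s\<^sup>2)"
      by (simp add: m2_sphere right_diff_distrib)
  qed
qed

text \<open>The identity \<open>Afun = phi + (1 - Bfun)\<close>, integrated. The value is the level
  of the integrated chord at its origin end, expressed by \<open>f\<close> and the spherical
  rate.\<close>

lemma Afun_has_integral:
  assumes n: "n \<ge> 1" and v: "0 < v1" "v1 \<le> v2" and R: "R \<ge> 0"
  shows "((\<lambda>s. R\<^sup>2 * Afun n (R\<^sup>2 / s) / (2 * s\<^sup>2)) has_integral
    (R\<^sup>2 / 2 * f_fun n v1 v2 R + secrecy_rate n v1 v2 (sphere_unif n R))) {v1..v2}"
proof (rule has_integral_eq[OF _ has_integral_add[OF has_integral_mult_right[OF f_fun_has_integral(1)[OF n v(1) R]] sphere_rate_has_integral[OF n v R]]])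
  fix s assume "s \<in> {v1..v2}"
  then have s: "s > 0" using v by simp
  show "R\<^sup>2 / 2 * (phi n (R\<^sup>2 / s) / s\<^sup>2) + R\<^sup>2 * (1 - Bfun n (R\<^sup>2 / s)) / (2 * s\<^sup>2) = R\<^sup>2 * Afun n (R\<^sup>2 / s) / (2 * s\<^sup>2)"
    using s by (simp add: phi_def field_simps)
qed

lemma admissible_bounded_input: "n \<ge> 1 \<Longrightarrow> R \<ge> 0 \<Longrightarrow> admissible n R P \<Longrightarrow> bounded_input P n R"
  unfolding admissible_def by (intro bounded_input.intro bounded_input_axioms.intro) auto

lemma bounded_input_admissible: "bounded_input P n R \<Longrightarrow> admissible n R P"
  unfolding admissible_def bounded_input_def bounded_input_axioms_def by simp

text \<open>The integrated chord gives weight \<open>\<theta>\<close> to the spherical rate and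
  \<open>1 - \<theta>\<close> to the level at the origin, which differs from it by
  \<open>R^2 / 2 * f\<close>. Since \<open>\<theta> = m2 / R^2\<close> does not depend on
  \<open>s\<close>, integration respects the combination.\<close>

lemma secrecy_rate_le_sphere:
  assumes n: "n \<ge> 1" and v: "0 < v1" "v1 \<le> v2" and Rp: "R > 0" and P: "bounded_input P n R"
    and f: "f_fun n v1 v2 R \<le> 0"
  shows "secrecy_rate n v1 v2 P \<le> secrecy_rate n v1 v2 (sphere_unif n R)"
proof -
  interpret bounded_input P n R by (rule P)
  have R0: "R \<ge> 0" using Rp by simp
  define \<theta> where "\<theta> = m2 / R\<^sup>2"
  have th: "0 \<le> \<theta>" "\<theta> \<le> 1" using m2_nonneg m2_le Rp by (auto simp: \<theta>_def divide_le_eq_1)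
  let ?S = "secrecy_rate n v1 v2 (sphere_unif n R)"
  have "secrecy_rate n v1 v2 P \<le> (1 - \<theta>) * (R\<^sup>2 / 2 * f_fun n v1 v2 R + ?S) + \<theta> * ?S"
  proof (rule has_integral_le[OF rate_has_integral[OF v]
        has_integral_add[OF has_integral_mult_right[OF Afun_has_integral[OF n v R0]] has_integral_mult_right[OF sphere_rate_has_integral[OF n v R0]]]])
    fix s assume "s \<in> {v1..v2}"
    then have s: "s > 0" using v by simp
    have r: "1 / sqrt s > 0" using s by simp
    have r2: "(1 / sqrt s)\<^sup>2 = 1 / s" using s by (simp add: power_divide)
    have "psi n (R\<^sup>2 / s) (R\<^sup>2 / s) = R\<^sup>2 / s * (1 - Bfun n (R\<^sup>2 / s))"
      using sphere_input.psi_diag[OF sphere_input_sphere[OF n R0] r] unfolding r2 by simp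
    then have "1 / s * (m2 - xsq (1 / sqrt s)) \<le> (1 - \<theta>) * (R\<^sup>2 / s * Afun n (R\<^sup>2 / s)) + \<theta> * (R\<^sup>2 / s * (1 - Bfun n (R\<^sup>2 / s)))"
      using mmse_le_chord[OF r Rp] unfolding r2 \<theta>_def[symmetric] by (simp add: psi_0)
    then have "1 / (2 * s) * (1 / s * (m2 - xsq (1 / sqrt s))) \<le> 1 / (2 * s) * ((1 - \<theta>) * (R\<^sup>2 / s * Afun n (R\<^sup>2 / s)) + \<theta> * (R\<^sup>2 / s * (1 - Bfun n (R\<^sup>2 / s))))"
      using s by (intro mult_left_mono) auto
    then show "(m2 - xsq (1 / sqrt s)) / (2 * s\<^sup>2) \<le> (1 - \<theta>) * (R\<^sup>2 * Afun n (R\<^sup>2 / s) / (2 * s\<^sup>2)) + \<theta> * (R\<^sup>2 * (1 - Bfun n (R\<^sup>2 / s)) / (2 * s\<^sup>2))"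
      by (simp add: power2_eq_square distrib_left mult_ac)
  qed
  also have "\<dots> = (1 - \<theta>) * (R\<^sup>2 / 2 * f_fun n v1 v2 R) + ?S" by (simp add: algebra_simps)
  also have "\<dots> \<le> ?S" using th f by (simp add: mult_nonneg_nonpos)
  finally show ?thesis .
qed

text \<open>Separate because the chord weight divides by \<open>R^2\<close>. Here
  \<open>m2 \<le> 0\<close>, so no rate exceeds \<open>0\<close>, the rate of the degenerate
  sphere.\<close>

lemma attains_Cs_0:
  assumes n: "n \<ge> 1" and v: "0 < v1" "v1 \<le> v2"
  shows "attains_Cs n v1 v2 0"
  unfolding attains_Cs_def
proof (intro conjI allI impI)
  show "admissible n 0 (sphere_unif n 0)" by (intro bounded_input_admissible bounded_input_sphere[OF n]) simp
  fix P assume "admissible n 0 P"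
  then interpret bounded_input P n 0 by (intro admissible_bounded_input[OF n]) simp_all
  show "secrecy_rate n v1 v2 P \<le> secrecy_rate n v1 v2 (sphere_unif n 0)"
  proof (rule has_integral_le[OF rate_has_integral[OF v] sphere_rate_has_integral[OF n v order_refl]])
    fix s assume s: "s \<in> {v1..v2}"
    have "xsq (1 / sqrt s) \<ge> 0" unfolding xsq_def by (intro Bochner_Integration.integral_nonneg sum_nonneg) simp
    then have "m2 - xsq (1 / sqrt s) \<le> 0" using m2_le by simp
    then show "(m2 - xsq (1 / sqrt s)) / (2 * s\<^sup>2) \<le> 0\<^sup>2 * (1 - Bfun n (0\<^sup>2 / s)) / (2 * s\<^sup>2)"
      by (simp add: divide_nonpos_nonneg)
  qed
qed

section \<open>Mixing the input with a point mass at the origin\<close>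

text \<open>With probability \<open>e\<close> a coin multiplies the sample by \<open>0\<close>. The
  point mass then sits at \<open>vscale n 0 x\<close>, the zero vector of the extensional function
  space, whatever \<open>x\<close> is.\<close>

definition origin_mixture :: "real \<Rightarrow> nat \<Rightarrow> (nat \<Rightarrow> real) measure \<Rightarrow> (nat \<Rightarrow> real) measure" where
  "origin_mixture e n P = distr (measure_pmf (bernoulli_pmf e) \<Otimes>\<^sub>M P) (Rn n) (\<lambda>p. vscale n (if fst p then 0 else 1) (snd p))"

context bounded_input
begin

lemma measurable_origin_mixture [measurable]:
  "(\<lambda>p. vscale n (if fst p then 0 else 1) (snd p)) \<in> measure_pmf (bernoulli_pmf e) \<Otimes>\<^sub>M P \<rightarrow>\<^sub>M Rn n"
proof -
  have [measurable]: "i < n \<Longrightarrow> (\<lambda>p. snd p i) \<in> borel_measurable (measure_pmf (bernoulli_pmf e) \<Otimes>\<^sub>M P)" for i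
    by (rule measurable_compose[OF measurable_snd]) simp
  have "(\<lambda>b. if b then 0 else 1 :: real) \<in> borel_measurable (measure_pmf (bernoulli_pmf e))" by simp
  from measurable_compose[OF measurable_fst this]
  have [measurable]: "(\<lambda>p. if fst p then 0 else 1 :: real) \<in> borel_measurable (measure_pmf (bernoulli_pmf e) \<Otimes>\<^sub>M P)" .
  show ?thesis by measurable
qed

lemma bounded_input_origin_mixture: "bounded_input (origin_mixture e n P) n R"
proof (intro bounded_input.intro bounded_input_axioms.intro n R)
  interpret B: prob_space "measure_pmf (bernoulli_pmf e)" by (rule measure_pmf.prob_space_axioms)
  interpret BP: pair_prob_space "measure_pmf (bernoulli_pmf e)" P ..
  show "prob_space (origin_mixture e n P)"
    unfolding origin_mixture_def by (rule BP.prob_space_distr) measurable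
  show "sets (origin_mixture e n P) = sets (Rn n)" by (simp add: origin_mixture_def)
  have "AE p in measure_pmf (bernoulli_pmf e) \<Otimes>\<^sub>M P. vnorm n (vscale n (if fst p then 0 else 1) (snd p)) \<le> R"
  proof (rule BP.AE_pair_measure)
    show "AE b in measure_pmf (bernoulli_pmf e). AE x in P. vnorm n (vscale n (if fst (b, x) then 0 else 1) (snd (b, x))) \<le> R"
    proof (rule AE_I2)
      fix b show "AE x in P. vnorm n (vscale n (if fst (b, x) then 0 else 1) (snd (b, x))) \<le> R"
        using bd by eventually_elim (use R in auto)
    qed
    have [measurable]: "(\<lambda>p. vnorm n (vscale n (if fst p then 0 else 1) (snd p))) \<in> borel_measurable (measure_pmf (bernoulli_pmf e) \<Otimes>\<^sub>M P)"
      by (rule measurable_compose[OF measurable_origin_mixture]) measurable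
    show "{p \<in> space (measure_pmf (bernoulli_pmf e) \<Otimes>\<^sub>M P). vnorm n (vscale n (if fst p then 0 else 1) (snd p)) \<le> R}
      \<in> sets (measure_pmf (bernoulli_pmf e) \<Otimes>\<^sub>M P)"
      by measurable
  qed
  then show "AE x in origin_mixture e n P. vnorm n x \<le> R"
    unfolding origin_mixture_def by (subst AE_distr_iff) auto
qed

lemma integral_origin_mixture:
  assumes e: "0 \<le> e" "e \<le> 1" and f: "integrable (origin_mixture e n P) f"
  shows "(\<integral>x. f x \<partial>origin_mixture e n P) = e * f (vscale n 0 x0) + (1 - e) * (\<integral>x. f x \<partial>P :: real)"
proof -
  interpret B: prob_space "measure_pmf (bernoulli_pmf e)" by (rule measure_pmf.prob_space_axioms)
  interpret BP: pair_prob_space "measure_pmf (bernoulli_pmf e)" P ..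
  have fm: "f \<in> borel_measurable (Rn n)"
    using borel_measurable_integrable[OF f] by (simp add: origin_mixture_def)
  define g where "g b x = f (vscale n (if b then 0 else 1) x)" for b x
  have "integrable (measure_pmf (bernoulli_pmf e) \<Otimes>\<^sub>M P) (\<lambda>p. f (vscale n (if fst p then 0 else 1) (snd p)))"
    by (rule integrable_distr[OF measurable_origin_mixture]) (use f in \<open>simp add: origin_mixture_def\<close>)
  then have i: "integrable (measure_pmf (bernoulli_pmf e) \<Otimes>\<^sub>M P) (\<lambda>p. g (fst p) (snd p))" by (simp add: g_def)
  have "(\<integral>x. f x \<partial>origin_mixture e n P) = (\<integral>p. g (fst p) (snd p) \<partial>(measure_pmf (bernoulli_pmf e) \<Otimes>\<^sub>M P))"
    unfolding origin_mixture_def g_def by (rule integral_distr[OF measurable_origin_mixture fm])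
  also have "\<dots> = (\<integral>b. (\<integral>x. g b x \<partial>P) \<partial>measure_pmf (bernoulli_pmf e))"
    using BP.integral_fst'[OF i] by simp
  also have "\<dots> = (\<integral>x. g True x \<partial>P) * e + (\<integral>x. g False x \<partial>P) * (1 - e)"
    by (rule integral_bernoulli_pmf[OF e])
  also have "(\<integral>x. g True x \<partial>P) = (\<integral>x. f (vscale n 0 x0) \<partial>P)"
    by (simp add: g_def vscale_def)
  also have "(\<integral>x. g False x \<partial>P) = (\<integral>x. f x \<partial>P)"
  proof (rule Bochner_Integration.integral_cong[OF refl])
    fix x assume "x \<in> space P"
    then have "vscale n 1 x = x" by (auto simp: vscale_def space_Rn PiE_def extensional_def restrict_def fun_eq_iff)
    then show "g False x = f x" by (simp add: g_def)
  qed
  finally show ?thesis using prob_space by (simp add: mult.commute)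
qed

text \<open>The origin has likelihood \<open>1\<close>: it adds \<open>e\<close> to the normalising
  integral and nothing to the first moment, so the estimate shrinks.\<close>

lemma xh_origin_mixture:
  assumes e: "0 \<le> e" "e \<le> 1" and i: "i < n"
  shows "bounded_input.xh (origin_mixture e n P) n r i y = (1 - e) * Nf P n r y / (e + (1 - e) * Nf P n r y) * xh r i y"
proof -
  interpret Q: bounded_input "origin_mixture e n P" n R by (rule bounded_input_origin_mixture)
  have "Nf (origin_mixture e n P) n r y = e + (1 - e) * Nf P n r y"
    using integral_origin_mixture[OF e Q.integrable_Lw', of r y undefined] by (simp add: Nf_def Lw_def dotp_commute[of n _ "vscale n 0 undefined"])
  moreover have "(\<integral>x. x i * Lw n r x y \<partial>origin_mixture e n P) = (1 - e) * (xh r i y * Nf P n r y)"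
  proof -
    have "integrable (origin_mixture e n P) (\<lambda>x. x i * Lw n r x y)"
      by (rule Q.integrable_Lw[where A=R]) (use i abs_component_le[OF i] in \<open>auto intro: order_trans\<close>)
    from integral_origin_mixture[OF e this, of undefined] show ?thesis
      using i by (simp add: xh_def postf_Nf vscale_def)
  qed
  ultimately show ?thesis unfolding Q.xh_def by (simp add: postf_def[of "origin_mixture e n P"] mult_ac)
qed

end

context sphere_input
begin

text \<open>The mixture's own conditional mean \<open>h\<close> is tested on both components. On
  \<open>P\<close> its error is at least the minimum \<open>m2 - xsq r\<close>; at the origin it is
  the mean of \<open>|h|^2\<close>, that is of \<open>|xh|^2\<close> times the squared shrinkage.
  The shrinkage factor increases with \<open>Nf\<close>, hence the role of the lower bound
  \<open>k\<close>.\<close>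

lemma mmse_origin_mixture_ge:
  fixes e r :: real
  defines "Q \<equiv> origin_mixture e n P"
  assumes e: "0 < e" "e < 1" and r: "r > 0" and k: "k > 0" "\<And>y. k \<le> Nf P n r y"
  shows "e * ((1 - e) * k / (e + (1 - e) * k))\<^sup>2 * (R\<^sup>2 * Afun n (R\<^sup>2 * r\<^sup>2)) + (1 - e) * (m2 - xsq r)
    \<le> bounded_input.m2 Q n - bounded_input.xsq Q n r"
proof -
  interpret Q: bounded_input Q n R unfolding Q_def by (rule bounded_input_origin_mixture)
  let ?a = "R\<^sup>2 * r\<^sup>2"
  have e': "0 \<le> e" "e \<le> 1" using e by auto
  define t where "t y = (1 - e) * Nf P n r y / (e + (1 - e) * Nf P n r y)" for y
  define t0 where "t0 = (1 - e) * k / (e + (1 - e) * k)"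
  have t0: "0 \<le> t0" using e k by (simp add: t0_def)
  have t: "t0 \<le> t y" for y
  proof -
    have mono: "u / (e + u) \<le> w / (e + w)" if "0 < u" "u \<le> w" for u w
    proof -
      have "u * (e + w) \<le> w * (e + u)" using that e by (simp add: distrib_left mult.commute)
      then show ?thesis using that e by (simp add: pos_divide_le_eq pos_le_divide_eq)
    qed
    show ?thesis unfolding t_def t0_def using e k by (intro mono mult_left_mono mult_pos_pos) auto
  qed
  define h where "h i = Q.xh r i" for i
  have h: "i < n \<Longrightarrow> h i y = t y * xh r i y" for i y
    unfolding h_def t_def Q_def by (rule xh_origin_mixture[OF e'])
  have hm: "i < n \<Longrightarrow> h i \<in> borel_measurable (Rn n)" for i
    unfolding h_def by (rule Q.measurable_xh) auto
  have hb: "\<bar>h i y\<bar> \<le> R * (1 + (vnorm n y)\<^sup>2)" if "i < n" for i y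
  proof -
    from that have "\<bar>h i y\<bar> \<le> R" unfolding h_def by (rule Q.abs_xh_le)
    moreover have "R * 1 \<le> R * (1 + (vnorm n y)\<^sup>2)" using R by (intro mult_left_mono) auto
    ultimately show ?thesis by simp
  qed
  define D where "D x z = (\<Sum>i<n. (x i - h i (chan n r (x, z)))\<^sup>2)" for x z
  define K where "K x = (\<integral>z. D x z \<partial>stdg n)" for x
  have D: "case_prod D = (\<lambda>p. \<Sum>i<n. (fst p i - h i (chan n r p))\<^sup>2)"
    by (simp add: D_def split_beta')
  have iQ: "integrable Q.PS (case_prod D)"
    unfolding D by (rule Q.estimator_error(1)) (use hm hb in auto)
  have iP: "integrable PS (case_prod D)"
    unfolding D by (rule estimator_error(1)) (use hm hb in auto)
  have "m2 - xsq r \<le> (\<integral>p. case_prod D p \<partial>PS)"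
    unfolding D by (rule estimator_error(2)) (use hm hb in auto)
  also have "\<dots> = (\<integral>x. K x \<partial>P)" unfolding K_def by (rule PG.integral_fst[OF iP, symmetric])
  finally have P: "m2 - xsq r \<le> (\<integral>x. K x \<partial>P)" .
  have iK: "integrable Q K" using Q.PG.integrable_fst[OF iQ] by (simp add: K_def[abs_def])
  have "Q.m2 - Q.xsq r = (\<integral>p. case_prod D p \<partial>Q.PS)"
    unfolding D
  proof (rule Q.estimator_error(3)[where h=h and C=R and r=r])
    fix i y assume i: "i < n"
    show "h i \<in> borel_measurable (Rn n)" by (rule hm[OF i])
    show "\<bar>h i y\<bar> \<le> R * (1 + (vnorm n y)\<^sup>2)" by (rule hb[OF i])
    show "h i y = Q.xh r i y" by (simp only: h_def)
  qed
  also have "\<dots> = (\<integral>x. K x \<partial>Q)" unfolding K_def by (rule Q.PG.integral_fst[OF iQ, symmetric])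
  also have "\<dots> = e * K (vscale n 0 undefined) + (1 - e) * (\<integral>x. K x \<partial>P)"
    unfolding Q_def by (rule integral_origin_mixture[OF e' iK[unfolded Q_def]])
  finally have Q: "Q.m2 - Q.xsq r = e * K (vscale n 0 undefined) + (1 - e) * (\<integral>x. K x \<partial>P)" .
  have "t0\<^sup>2 * (R\<^sup>2 * Afun n ?a) = (\<integral>z. t0\<^sup>2 * (R\<^sup>2 * Ha n ?a (dotp n z z)) \<partial>stdg n)"
    by (simp add: Afun_def)
  also have "\<dots> \<le> K (vscale n 0 undefined)"
    unfolding K_def
  proof (rule integral_mono_AE)
    show "integrable (stdg n) (\<lambda>z. t0\<^sup>2 * (R\<^sup>2 * Ha n ?a (dotp n z z)))"
      using integrable_Ha[OF n, of ?a] by simp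
    show "integrable (stdg n) (D (vscale n 0 undefined))"
    proof (rule G.integrable_const_bound[where B="real n * R\<^sup>2"], rule AE_I2)
      show "D (vscale n 0 undefined) \<in> borel_measurable (stdg n)"
      proof -
        have y: "(\<lambda>z. chan n r (vscale n 0 undefined, z)) \<in> stdg n \<rightarrow>\<^sub>M Rn n" by measurable
        have "(\<lambda>z. h i (chan n r (vscale n 0 undefined, z))) \<in> borel_measurable (stdg n)" if "i < n" for i
          by (rule measurable_compose[OF y hm[OF that]])
        then have "(\<lambda>z. D (vscale n 0 undefined) z) \<in> borel_measurable (stdg n)"
          unfolding D_def by (intro borel_measurable_sum borel_measurable_power borel_measurable_diff borel_measurable_const) simp
        then show ?thesis .
      qed
      fix z
      have "D (vscale n 0 undefined) z \<le> (\<Sum>i<n. R\<^sup>2)"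
        unfolding D_def
      proof (rule sum_mono)
        fix i assume "i \<in> {..<n}"
        then have "\<bar>h i (chan n r (vscale n 0 undefined, z))\<bar> \<le> R" and "vscale n 0 undefined i = 0"
          using Q.abs_xh_le by (auto simp: h_def vscale_def)
        then show "(vscale n 0 undefined i - h i (chan n r (vscale n 0 undefined, z)))\<^sup>2 \<le> R\<^sup>2"
          using power_mono[of "\<bar>h i (chan n r (vscale n 0 undefined, z))\<bar>" R 2] by simp
      qed
      moreover have "D (vscale n 0 undefined) z \<ge> 0" unfolding D_def by (intro sum_nonneg) simp
      ultimately show "norm (D (vscale n 0 undefined) z) \<le> real n * R\<^sup>2" by simp
    qed
    show "AE z in stdg n. t0\<^sup>2 * (R\<^sup>2 * Ha n ?a (dotp n z z)) \<le> D (vscale n 0 undefined) z"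
    proof (rule AE_I2)
      fix z
      let ?y = "chan n r (vscale n 0 undefined, z)"
      have yy: "dotp n ?y ?y = dotp n z z" by (simp add: dotp_affmap_self)
      have "D (vscale n 0 undefined) z = (\<Sum>i<n. (t ?y)\<^sup>2 * (xh r i ?y)\<^sup>2)"
        unfolding D_def by (intro sum.cong refl) (simp add: h power_mult_distrib vscale_def)
      also have "\<dots> = (t ?y)\<^sup>2 * (R\<^sup>2 * Ha n ?a (dotp n z z))"
        unfolding sum_distrib_left[symmetric] sum_xh_sq[OF r] yy ..
      finally have D: "D (vscale n 0 undefined) z = (t ?y)\<^sup>2 * (R\<^sup>2 * Ha n ?a (dotp n z z))" .
      show "t0\<^sup>2 * (R\<^sup>2 * Ha n ?a (dotp n z z)) \<le> D (vscale n 0 undefined) z"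
        unfolding D using t0 t[of ?y] Hf_nonneg[of n "?a * dotp n z z"] n by (intro mult_right_mono power_mono) (auto simp: Ha_def)
    qed
  qed
  finally have "e * (t0\<^sup>2 * (R\<^sup>2 * Afun n ?a)) + (1 - e) * (m2 - xsq r) \<le> e * K (vscale n 0 undefined) + (1 - e) * (\<integral>x. K x \<partial>P)"
    using e P by (intro add_mono mult_left_mono) auto
  then show ?thesis unfolding Q t0_def[symmetric] by (simp add: mult.assoc)
qed

end

text \<open>Let \<open>I\<close> be the level at the origin and \<open>S\<close> the spherical rate.
  Optimality against the mixture gives \<open>e t^2 I + (1 - e) S \<le> S\<close>, hence
  \<open>t^2 I \<le> S\<close>; as \<open>e\<close> tends to \<open>0\<close> the shrinkage
  \<open>t\<close> tends to \<open>1\<close>, so \<open>I - S = R^2 / 2 * f\<close> is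
  nonpositive.\<close>

lemma attains_Cs_imp_f_nonpos:
  assumes n: "n \<ge> 1" and v: "0 < v1" "v1 \<le> v2" and R: "R > 0" and att: "attains_Cs n v1 v2 R"
  shows "f_fun n v1 v2 R \<le> 0"
proof -
  have R0: "R \<ge> 0" by (rule less_imp_le[OF R])
  interpret S: sphere_input "sphere_unif n R" n R by (rule sphere_input_sphere[OF n R0])
  let ?S = "secrecy_rate n v1 v2 (sphere_unif n R)"
  let ?I = "R\<^sup>2 / 2 * f_fun n v1 v2 R + ?S"
  \<comment> \<open>A lower bound for \<open>Nf\<close> uniform in the output and in
    \<open>s\<close>: \<open>Bs \<ge> 1\<close>, and the prefactor
    \<open>exp (- R^2 / (2 s))\<close> is smallest at \<open>s = v1\<close>.\<close>
  define k where "k = exp (- (R\<^sup>2 / (2 * v1)))"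
  have k: "k > 0" by (simp add: k_def)
  define t where "t e = (1 - e) * k / (e + (1 - e) * k)" for e
  have le: "(t e)\<^sup>2 * ?I \<le> ?S" if e: "0 < e" "e < 1" for e
  proof -
    let ?Q = "origin_mixture e n (sphere_unif n R)"
    interpret Q: bounded_input ?Q n R by (rule S.bounded_input_origin_mixture)
    have "e * (t e)\<^sup>2 * ?I + (1 - e) * ?S \<le> secrecy_rate n v1 v2 ?Q"
    proof (rule has_integral_le[OF has_integral_add[OF has_integral_mult_right[OF Afun_has_integral[OF n v R0]] has_integral_mult_right[OF S.rate_has_integral[OF v]]] Q.rate_has_integral[OF v]])
      fix s assume s: "s \<in> {v1..v2}"
      then have s0: "s > 0" using v by simp
      have r: "1 / sqrt s > 0" using s0 by simp
      have r2: "(1 / sqrt s)\<^sup>2 = 1 / s" using s0 by (simp add: power_divide)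
      have "k \<le> Nf (sphere_unif n R) n (1 / sqrt s) y" for y
      proof -
        have "k \<le> exp (- ((1 / sqrt s)\<^sup>2 * R\<^sup>2 / 2)) * 1"
          unfolding k_def r2 using s v by (auto intro!: divide_left_mono)
        also have "\<dots> \<le> exp (- ((1 / sqrt s)\<^sup>2 * R\<^sup>2 / 2)) * Bs n (R\<^sup>2 * (1 / sqrt s)\<^sup>2 * dotp n y y)"
          by (intro mult_left_mono Bs_ge_1[OF n]) auto
        finally show ?thesis unfolding sphere_Nf[OF n R0] .
      qed
      from S.mmse_origin_mixture_ge[OF e r k this]
      have "e * (t e)\<^sup>2 * (R\<^sup>2 * Afun n (R\<^sup>2 / s)) + (1 - e) * (S.m2 - S.xsq (1 / sqrt s)) \<le> Q.m2 - Q.xsq (1 / sqrt s)"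
        unfolding t_def r2 by simp
      then have "(e * (t e)\<^sup>2 * (R\<^sup>2 * Afun n (R\<^sup>2 / s)) + (1 - e) * (S.m2 - S.xsq (1 / sqrt s))) / (2 * s\<^sup>2) \<le> (Q.m2 - Q.xsq (1 / sqrt s)) / (2 * s\<^sup>2)"
        by (rule divide_right_mono) simp
      then show "e * (t e)\<^sup>2 * (R\<^sup>2 * Afun n (R\<^sup>2 / s) / (2 * s\<^sup>2)) + (1 - e) * ((S.m2 - S.xsq (1 / sqrt s)) / (2 * s\<^sup>2)) \<le> (Q.m2 - Q.xsq (1 / sqrt s)) / (2 * s\<^sup>2)"
        by (simp add: add_divide_distrib)
    qed
    also have "\<dots> \<le> ?S" using att bounded_input_admissible[OF Q.bounded_input_axioms] by (simp add: attains_Cs_def)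
    finally have "e * ((t e)\<^sup>2 * ?I) \<le> e * ?S" by (simp add: algebra_simps)
    then show ?thesis using e by simp
  qed
  have "(t \<longlongrightarrow> (1 - 0) * k / (0 + (1 - 0) * k)) (at_right 0)"
    unfolding t_def using k by (intro tendsto_intros) auto
  then have "((\<lambda>e. (t e)\<^sup>2 * ?I) \<longlongrightarrow> 1\<^sup>2 * ?I) (at_right 0)"
    using k by (intro tendsto_intros) auto
  moreover have "\<forall>\<^sub>F e in at_right 0. (t e)\<^sup>2 * ?I \<le> ?S"
    using eventually_at_right_real[OF zero_less_one] by (rule eventually_mono) (use le in auto)
  ultimately have "1\<^sup>2 * ?I \<le> ?S" by (rule tendsto_upperbound) simp
  then have "R\<^sup>2 / 2 * f_fun n v1 v2 R \<le> 0" by simp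
  then show ?thesis using R by (simp add: mult_le_0_iff divide_le_0_iff)
qed

lemma attains_Cs_iff:
  assumes n: "n \<ge> 1" and v: "0 < v1" "v1 < v2" and R: "R \<ge> 0"
  shows "attains_Cs n v1 v2 R \<longleftrightarrow> f_fun n v1 v2 R \<le> 0"
proof (cases "R = 0")
  case True
  then show ?thesis using attains_Cs_0[OF n v(1)] f_fun_0_neg[OF n v] v by auto
next
  case False
  then have R': "R > 0" using R by simp
  have "attains_Cs n v1 v2 R" if "f_fun n v1 v2 R \<le> 0"
    unfolding attains_Cs_def
    using secrecy_rate_le_sphere[OF n v(1) _ R' _ that] admissible_bounded_input[OF n R] v
      bounded_input_admissible[OF bounded_input_sphere[OF n R]] by auto
  then show ?thesis using attains_Cs_imp_f_nonpos[OF n v(1) _ R'] v by auto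
qed

theorem theorem2:
  fixes n :: nat and v1 v2 :: real
  assumes "n \<ge> 1" and "0 < v1" and "v1 < v2" and "assumption_A"
  shows "(\<forall>R \<ge> 0. attains_Cs n v1 v2 R \<longleftrightarrow> R \<le> Rbar n v1 v2)
         \<and> f_fun n v1 v2 (Rbar n v1 v2) = 0
         \<and> (\<forall>R \<ge> 0. f_fun n v1 v2 R = 0 \<longrightarrow> R = Rbar n v1 v2)"
proof -
  obtain R0 where R0: "R0 \<ge> 0" "f_fun n v1 v2 R0 = 0" using f_fun_root[OF assms(1-3)] .
  have le: "f_fun n v1 v2 R \<le> 0 \<longleftrightarrow> R \<le> R0" if "R \<ge> 0" for R
    using f_fun_strict_mono[OF assms(1-3) that, of R0] f_fun_strict_mono[OF assms(1-3) R0(1), of R] R0(2)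
    by (cases R R0 rule: linorder_cases) simp_all
  have att: "attains_Cs n v1 v2 R \<longleftrightarrow> R \<le> R0" if "R \<ge> 0" for R
    using attains_Cs_iff[OF assms(1-3) that] le[OF that] by simp
  \<comment> \<open>The optimal radii form the closed interval from \<open>0\<close> to the root, so
    the greatest one exists and is the root.\<close>
  have g: "(GREATEST R. 0 \<le> R \<and> attains_Cs n v1 v2 R) = R0"
    by (rule Greatest_equality) (use att R0 in auto)
  have ne: "{R. 0 \<le> R \<and> attains_Cs n v1 v2 R} \<noteq> {}" using att[OF R0(1)] R0(1) by auto
  have "Rbar n v1 v2 = R0" unfolding Rbar_def if_not_P[OF ne] by (rule g)
  have uniq: "R = R0" if "R \<ge> 0" "f_fun n v1 v2 R = 0" for R
    using f_fun_strict_mono[OF assms(1-3) that(1), of R0] f_fun_strict_mono[OF assms(1-3) R0(1), of R] R0(2) that(2)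
    by (cases R R0 rule: linorder_cases) simp_all
  show ?thesis unfolding \<open>Rbar n v1 v2 = R0\<close>
    by (intro conjI allI impI att R0(2) uniq)
qed

end
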